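(* Let $M$ be a smooth manifold, $\Theta\in\Omega^n(M)$, and let $\alpha\in\Omega^{n-p}(M)$, $\beta\in\Omega^{n-q}(M)$, $\gamma\in\Omega^{n-r}(M)$ be conformal Hamiltonian forms. Then the graded Jacobi bracket $\{\cdot,\cdot\}$ of conformal Hamiltonian forms is graded skew-symmetric and satisfies the graded Jacobi identity, namely (i) $\{\alpha,\beta\}=-(-1)^{(p-1)(q-1)}\{\beta,\alpha\}$; (ii) $(-1)^{(p-1)(r-1)}\{\alpha,\{\beta,\gamma\}\}+(-1)^{(r-1)(q-1)}\{\gamma,\{\alpha,\beta\}\}+(-1)^{(q-1)(p-1)}\{\beta,\{\gamma,\alpha\}\}=0$.
   Context: $\mathfrak{X}^p(M)=\Gamma(\bigwedge^p TM)$. Conventions: $\iota_{U\wedge V}=\iota_V\iota_U$; for $U\in\mathfrak{X}^p(M)$, $\mathcal{L}_U\alpha=d\iota_U\alpha-(-1)^p\iota_U d\alpha$; the Schouten--Nijenhuis bracket of $U\in\mathfrak{X}^p(M)$, $V\in\mathfrak{X}^q(M)$ is normalized by $\iota_{[U,V]}=(-1)^{(p-1)q}\mathcal{L}_U\iota_V-\iota_V\mathcal{L}_U$. Forms of negative degree are zero. For $1\le p\le n$, $X\in\mathfrak{X}^p(M)$ is an infinitesimal conformal transformation of $\Theta$ if $\mathcal{L}_X\Theta=\iota_V\Theta$ for some $V\in\mathfrak{X}^{p-1}(M)$. A form $\alpha\in\Omega^{n-p}(M)$ is conformal Hamiltonian if $\iota_{X_\alpha}\Theta=-\alpha$ for some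 infinitesimal conformal transformation $X_\alpha\in\mathfrak{X}^p(M)$. The graded Jacobi bracket of two conformal Hamiltonian forms is $\{\alpha,\beta\}:=-\iota_{[X_\alpha,X_\beta]}\Theta$; it is independent of the choice of $X_\alpha,X_\beta$ and is again conformal Hamiltonian. *)

theory Defs
  imports "HOL-Analysis.Analysis" "HOL-Library.Function_Algebras"
begin

section \<open>Smooth manifolds\<close>

text \<open>C^k maps on an open subset \<open>S\<close> of a finite-dimensional normed space, by recursion over the
  directional derivatives.\<close>

fun Ck_on :: "nat \<Rightarrow> 'e::real_normed_vector set \<Rightarrow> ('e \<Rightarrow> 'f::real_normed_vector) \<Rightarrow> bool" where
  "Ck_on 0 S f \<longleftrightarrow> continuous_on S f"
| "Ck_on (Suc k) S f \<longleftrightarrow>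
     (\<forall>x\<in>S. f differentiable (at x)) \<and> (\<forall>v. Ck_on k S (\<lambda>x. frechet_derivative f (at x) v))"

definition smooth_on :: "'e::real_normed_vector set \<Rightarrow> ('e \<Rightarrow> 'f::real_normed_vector) \<Rightarrow> bool" where
  "smooth_on S f \<longleftrightarrow> (\<forall>k. Ck_on k S f)"

text \<open>A chart is a pair of its domain and its coordinate map; only the values of the coordinate
  map on the domain matter.\<close>

type_synonym ('m, 'e) chart = "'m set \<times> ('m \<Rightarrow> 'e)"

definition chart_image :: "('m, 'e) chart \<Rightarrow> 'e set" where
  "chart_image c = snd c ` fst c"

definition overlap :: "('m, 'e) chart \<Rightarrow> ('m, 'e) chart \<Rightarrow> 'e set" where
  "overlap c c' = snd c ` (fst c \<inter> fst c')"

definition transition :: "('m, 'e) chart \<Rightarrow> ('m, 'e) chart \<Rightarrow> 'e \<Rightarrow> 'e" where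
  "transition c c' = snd c' \<circ> inv_into (fst c) (snd c)"

text \<open>The model space is an arbitrary finite-dimensional normed space rather than a
  \<open>euclidean_space\<close>, because the latter class excludes dimension zero. The atlas
  \<open>A\<close> need not be maximal.\<close>

definition smooth_manifold :: "'m topology \<Rightarrow> ('m, 'e::real_normed_vector) chart set \<Rightarrow> bool" where
  "smooth_manifold M A \<longleftrightarrow>
     Hausdorff_space M \<and> second_countable M \<and>
     (\<exists>B :: 'e set. finite B \<and> span B = UNIV) \<and>
     (\<forall>c\<in>A. openin M (fst c) \<and> open (chart_image c) \<and>
        homeomorphic_map (subtopology M (fst c)) (top_of_set (chart_image c)) (snd c)) \<and>
     (\<Union>c\<in>A. fst c) = topspace M \<and>
     (\<forall>c\<in>A. \<forall>c'\<in>A. smooth_on (overlap c c') (transition c c'))"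


section \<open>Exterior algebra of a vector space\<close>

text \<open>Alternating \<open>k\<close>-linear forms; the arguments are collected in a list, and the value on
  lists of any other length is zero.\<close>

definition alt_forms :: "nat \<Rightarrow> ('e::real_vector list \<Rightarrow> real) set" where
  "alt_forms k = {\<eta>.
     (\<forall>vs. length vs \<noteq> k \<longrightarrow> \<eta> vs = 0) \<and>
     (\<forall>vs i. length vs = k \<and> i < k \<longrightarrow> linear (\<lambda>v. \<eta> (vs[i := v]))) \<and>
     (\<forall>vs. length vs = k \<and> \<not> distinct vs \<longrightarrow> \<eta> vs = 0)}"

text \<open>The exterior power \<open>\<Lambda>\<^sup>p E\<close> is realised inside the dual of the space of alternating
  \<open>p\<close>-forms: \<open>v\<^sub>1 \<and> \<dots> \<and> v\<^sub>p\<close> is evaluation at \<open>(v\<^sub>1, \<dots>, v\<^sub>p)\<close>, and \<open>\<Lambda>\<^sup>p E\<close> is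
  the linear span of these elements. Elements are extended by zero to functions that are not
  alternating \<open>p\<close>-forms, so that equality is equality in \<open>\<Lambda>\<^sup>p E\<close>.\<close>

definition wedge :: "'e::real_vector list \<Rightarrow> ('e list \<Rightarrow> real) \<Rightarrow> real" where
  "wedge vs = (\<lambda>\<eta>. if \<eta> \<in> alt_forms (length vs) then \<eta> vs else 0)"

definition multivectors :: "nat \<Rightarrow> (('e::real_vector list \<Rightarrow> real) \<Rightarrow> real) set" where
  "multivectors p = {U. \<exists>S a. finite S \<and> (\<forall>vs\<in>S. length vs = p) \<and>
                              U = (\<lambda>\<eta>. \<Sum>vs\<in>S. a vs * wedge vs \<eta>)}"


section \<open>Differential forms and multivector fields\<close>

text \<open>A field is given by its local representatives, one for each chart of the atlas, subject to
  the transformation law on overlaps: representatives of a differential form are related by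
  pullback along the transition maps, those of a multivector field by pushforward.
  Representatives are zero outside the image of their chart (and for charts outside the atlas), so
  that equality of fields is equality of functions.\<close>

type_synonym ('m, 'e) form = "('m, 'e) chart \<Rightarrow> 'e \<Rightarrow> 'e list \<Rightarrow> real"
type_synonym ('m, 'e) mvf = "('m, 'e) chart \<Rightarrow> 'e \<Rightarrow> ('e list \<Rightarrow> real) \<Rightarrow> real"

definition diff_forms :: "('m, 'e::real_normed_vector) chart set \<Rightarrow> nat \<Rightarrow> ('m, 'e) form set" where
  "diff_forms A k = {\<omega>.
     (\<forall>c x. c \<notin> A \<or> x \<notin> chart_image c \<longrightarrow> \<omega> c x = (\<lambda>vs. 0)) \<and>
     (\<forall>c\<in>A. \<forall>x\<in>chart_image c. \<omega> c x \<in> alt_forms k) \<and>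
     (\<forall>c\<in>A. \<forall>vs. smooth_on (chart_image c) (\<lambda>x. \<omega> c x vs)) \<and>
     (\<forall>c\<in>A. \<forall>c'\<in>A. \<forall>x\<in>overlap c c'. \<forall>vs.
        \<omega> c x vs = \<omega> c' (transition c c' x) (map (frechet_derivative (transition c c') (at x)) vs))}"

definition multivector_fields ::
    "('m, 'e::real_normed_vector) chart set \<Rightarrow> nat \<Rightarrow> ('m, 'e) mvf set" where
  "multivector_fields A p = {U.
     (\<forall>c x. c \<notin> A \<or> x \<notin> chart_image c \<longrightarrow> U c x = (\<lambda>\<eta>. 0)) \<and>
     (\<forall>c\<in>A. \<forall>x\<in>chart_image c. U c x \<in> multivectors p) \<and>
     (\<forall>c\<in>A. \<forall>\<eta>\<in>alt_forms p. smooth_on (chart_image c) (\<lambda>x. U c x \<eta>)) \<and>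
     (\<forall>c\<in>A. \<forall>c'\<in>A. \<forall>x\<in>overlap c c'. \<forall>\<eta>\<in>alt_forms p.
        U c' (transition c c' x) \<eta> =
        U c x (\<lambda>vs. \<eta> (map (frechet_derivative (transition c c') (at x)) vs)))}"

text \<open>Sums and negatives of forms are the pointwise ones.\<close>

definition form_scale :: "real \<Rightarrow> ('m, 'e) form \<Rightarrow> ('m, 'e) form" (infixr "*\<^sub>F" 75) where
  "a *\<^sub>F \<omega> = (\<lambda>c x vs. a * \<omega> c x vs)"

text \<open>For \<open>U = v\<^sub>1 \<and> \<dots> \<and> v\<^sub>p\<close> this is \<open>\<omega>(v\<^sub>1, \<dots>, v\<^sub>p, \<dots>)\<close>, hence contraction with
  \<open>U \<and> V\<close> is contraction with \<open>U\<close> followed by contraction with \<open>V\<close>. It vanishes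
  when the degree of \<open>U\<close> exceeds that of the form, since elements of \<open>\<Lambda>\<^sup>p E\<close> are zero on
  functions that are not alternating \<open>p\<close>-forms.\<close>

definition contract :: "('m, 'e) mvf \<Rightarrow> ('m, 'e) form \<Rightarrow> ('m, 'e) form" where
  "contract U \<omega> = (\<lambda>c x ws. U c x (\<lambda>vs. \<omega> c x (vs @ ws)))"

text \<open>In a chart, \<open>(d\<omega>)(v\<^sub>0, \<dots>, v\<^sub>k)\<close> is the alternating sum of the derivatives of
  \<open>\<omega>(\<dots>, v\<^sub>i omitted, \<dots>)\<close> in the direction of \<open>v\<^sub>i\<close>, for constant \<open>v\<^sub>0, \<dots>, v\<^sub>k\<close>.\<close>

definition ext_d :: "('m, 'e::real_normed_vector) chart set \<Rightarrow> ('m, 'e) form \<Rightarrow> ('m, 'e) form" where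
  "ext_d A \<omega> = (\<lambda>c x vs.
     if c \<in> A \<and> x \<in> chart_image c
     then \<Sum>i<length vs. (-1) ^ i *
            frechet_derivative (\<lambda>y. \<omega> c y (take i vs @ drop (Suc i) vs)) (at x) (vs ! i)
     else 0)"

definition lie_deriv ::
    "('m, 'e::real_normed_vector) chart set \<Rightarrow> nat \<Rightarrow> ('m, 'e) mvf \<Rightarrow> ('m, 'e) form \<Rightarrow> ('m, 'e) form"
  where
  "lie_deriv A p U \<omega> = ext_d A (contract U \<omega>) - (-1) ^ p *\<^sub>F contract U (ext_d A \<omega>)"

text \<open>The Schouten--Nijenhuis bracket. A multivector field is determined by its contractions with
  differential forms, so the field selected here is unique. The exponent is an integer because
  \<open>p\<close> may be zero.\<close>

definition schouten ::
    "('m, 'e::real_normed_vector) chart set \<Rightarrow> nat \<Rightarrow> nat \<Rightarrow> ('m, 'e) mvf \<Rightarrow> ('m, 'e) mvf \<Rightarrow> ('m, 'e) mvf"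
  where
  "schouten A p q U V = (SOME W. W \<in> multivector_fields A (p + q - 1) \<and>
     (\<forall>k. \<forall>\<omega>\<in>diff_forms A k.
        contract W \<omega> =
        ((-1) powi ((int p - 1) * int q)) *\<^sub>F lie_deriv A p U (contract V \<omega>)
        - contract V (lie_deriv A p U \<omega>)))"


section \<open>Conformal Hamiltonian forms\<close>

definition inf_conformal ::
    "('m, 'e::real_normed_vector) chart set \<Rightarrow> nat \<Rightarrow> ('m, 'e) form \<Rightarrow> nat \<Rightarrow> ('m, 'e) mvf \<Rightarrow> bool"
  where
  "inf_conformal A n \<Theta> p X \<longleftrightarrow>
     1 \<le> p \<and> p \<le> n \<and> X \<in> multivector_fields A p \<and>
     (\<exists>V\<in>multivector_fields A (p - 1). lie_deriv A p X \<Theta> = contract V \<Theta>)"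

definition is_hamiltonian_mvf ::
    "('m, 'e::real_normed_vector) chart set \<Rightarrow> nat \<Rightarrow> ('m, 'e) form \<Rightarrow> nat \<Rightarrow>
     ('m, 'e) form \<Rightarrow> ('m, 'e) mvf \<Rightarrow> bool"
  where
  "is_hamiltonian_mvf A n \<Theta> p \<alpha> X \<longleftrightarrow> inf_conformal A n \<Theta> p X \<and> contract X \<Theta> = - \<alpha>"

definition conformal_hamiltonian ::
    "('m, 'e::real_normed_vector) chart set \<Rightarrow> nat \<Rightarrow> ('m, 'e) form \<Rightarrow> nat \<Rightarrow> ('m, 'e) form \<Rightarrow> bool"
  where
  "conformal_hamiltonian A n \<Theta> p \<alpha> \<longleftrightarrow>
     \<alpha> \<in> diff_forms A (n - p) \<and> (\<exists>X. is_hamiltonian_mvf A n \<Theta> p \<alpha> X)"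

text \<open>The bracket of forms of degrees \<open>n - p\<close> and \<open>n - q\<close>. It has degree
  \<open>n - (p + q - 1)\<close>, and forms of negative degree are zero.\<close>

definition jacobi_bracket ::
    "('m, 'e::real_normed_vector) chart set \<Rightarrow> nat \<Rightarrow> ('m, 'e) form \<Rightarrow> nat \<Rightarrow> nat \<Rightarrow>
     ('m, 'e) form \<Rightarrow> ('m, 'e) form \<Rightarrow> ('m, 'e) form"
  where
  "jacobi_bracket A n \<Theta> p q \<alpha> \<beta> =
     (if p + q - 1 \<le> n
      then THE \<gamma>. \<exists>X Y. is_hamiltonian_mvf A n \<Theta> p \<alpha> X \<and> is_hamiltonian_mvf A n \<Theta> q \<beta> Y \<and>
                       \<gamma> = - contract (schouten A p q X Y) \<Theta>
      else 0)"

end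

theory Submission
  imports Defs
begin

text \<open>Write \<open>\<iota>\<^sub>U\<close> for contraction and \<open>L\<^sub>U = [d, \<iota>\<^sub>U]\<close> for the Lie derivative, a graded
  commutator. The Schouten bracket is characterised by \<open>\<iota>\<^sub>[\<^sub>U\<^sub>,\<^sub>V\<^sub>] = \<plusminus>[L\<^sub>U, \<iota>\<^sub>V]\<close>, so its graded skew-symmetry
  and graded Jacobi identity are identities between operators on forms that follow from \<open>d \<circ> d = 0\<close>
  and from the graded commutation of contractions: first
  \<open>L\<^sub>[\<^sub>U\<^sub>,\<^sub>V\<^sub>] = \<plusminus>[L\<^sub>U, L\<^sub>V]\<close> (\<open>lie_deriv_schouten\<close>), then \<open>schouten_skew\<close> and
  \<open>schouten_jacobi\<close>.

  These identities pass to forms because \<open>\<Theta>\<close> turns brackets of fields into brackets of forms.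
  If \<open>L\<^sub>X \<Theta> = \<iota>\<^sub>V \<Theta>\<close> and \<open>L\<^sub>Y \<Theta> = \<iota>\<^sub>W \<Theta>\<close>, then \<open>[L\<^sub>X, L\<^sub>Y] \<Theta>\<close> is a contraction of \<open>\<Theta>\<close>, because the
  two terms with \<open>V\<close> and \<open>W\<close> cancel; hence \<open>[X, Y]\<close> is again conformal
  (\<open>inf_conformal_schouten\<close>) and is a Hamiltonian field of \<open>{\<alpha>, \<beta>}\<close>, which may be used to compute
  nested brackets. Moreover \<open>\<iota>\<^sub>[\<^sub>X\<^sub>,\<^sub>Y\<^sub>] \<Theta>\<close> depends on \<open>X\<close> only through \<open>\<iota>\<^sub>X \<Theta>\<close>
  (\<open>contract_schouten_conformal\<close>), and by skew-symmetry the same is true of \<open>Y\<close>, so the bracket of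
  forms does not depend on the choice of Hamiltonian fields.

  What remains is that a Schouten bracket exists at all, as a smooth multivector field on the manifold
  (\<open>schouten_exists\<close>). In a chart, the operator \<open>\<plusminus>[L\<^sub>U, \<iota>\<^sub>V]\<close> is computed with the product rule:
  all terms that differentiate the form cancel, and what is left, \<open>bracket_symbol\<close>, is contraction
  of the value of the form at the point (\<open>local_bracket_eq_symbol\<close>). Applying the operator to forms
  with constant coefficients therefore defines a functional on alternating forms, hence a multivector.
  These local fields agree on overlaps because \<open>d\<close> and contraction commute with pullback along the
  transition maps. The two facts from analysis behind this are the symmetry of second derivatives
  (for \<open>d \<circ> d = 0\<close> and for the naturality of \<open>d\<close>) and the boundedness of linear functionals in
  finite dimension.\<close>

section \<open>Alternating functions of lists\<close>

definition alternating :: "('e::real_vector list \<Rightarrow> real) \<Rightarrow> bool" where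
  "alternating \<eta> \<longleftrightarrow>
     (\<forall>vs i. i < length vs \<longrightarrow> linear (\<lambda>v. \<eta> (vs[i := v]))) \<and>
     (\<forall>vs. \<not> distinct vs \<longrightarrow> \<eta> vs = 0)"

lemma linear_zero_fun: "linear (\<lambda>v. 0::real)"
  by (simp add: linear_iff)

lemma alt_forms_iff: "\<eta> \<in> alt_forms k \<longleftrightarrow> alternating \<eta> \<and> (\<forall>vs. length vs \<noteq> k \<longrightarrow> \<eta> vs = 0)"
proof -
  have *: "linear (\<lambda>v. \<eta> (vs[i := v]))"
    if "\<forall>vs. length vs \<noteq> k \<longrightarrow> \<eta> vs = 0" "length vs \<noteq> k" for vs i
    using that by (simp add: linear_zero_fun)
  show ?thesis (is "?l \<longleftrightarrow> ?r")
  proof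
    assume l: ?l
    then have supp: "\<forall>vs. length vs \<noteq> k \<longrightarrow> \<eta> vs = 0"
      by (simp add: alt_forms_def)
    have "alternating \<eta>"
      unfolding alternating_def
    proof (intro conjI allI impI)
      fix vs :: "'a list" and i assume "i < length vs"
      then show "linear (\<lambda>v. \<eta> (vs[i := v]))"
        using l *[OF supp, of vs i] by (cases "length vs = k") (auto simp: alt_forms_def)
    next
      fix vs :: "'a list" assume "\<not> distinct vs"
      then show "\<eta> vs = 0"
        using l by (cases "length vs = k") (auto simp: alt_forms_def)
    qed
    with supp show ?r by blast
  next
    assume ?r
    then show ?l unfolding alt_forms_def alternating_def by auto
  qed
qed

lemma alternating_zero [simp]: "alternating (\<lambda>vs. 0)"
  by (simp add: alternating_def linear_zero_fun)

lemma alternating_append: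
  assumes "alternating \<eta>"
  shows "alternating (\<lambda>vs. \<eta> (us @ vs @ ws))"
  unfolding alternating_def
proof (intro conjI allI impI)
  fix vs :: "'a list" and i assume "i < length vs"
  then have "us @ vs[i := v] @ ws = (us @ vs @ ws)[length us + i := v]" for v
    by (simp add: list_update_append)
  moreover have "linear (\<lambda>v. \<eta> ((us @ vs @ ws)[length us + i := v]))"
    using assms \<open>i < length vs\<close> by (simp add: alternating_def)
  ultimately show "linear (\<lambda>v. \<eta> (us @ vs[i := v] @ ws))" by simp
next
  fix vs :: "'a list" assume "\<not> distinct vs"
  then have "\<not> distinct (us @ vs @ ws)" by auto
  then show "\<eta> (us @ vs @ ws) = 0" using assms unfolding alternating_def by blast
qed

lemma alternating_Cons: "alternating \<eta> \<Longrightarrow> alternating (\<lambda>vs. \<eta> (a # vs))"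
  using alternating_append[of \<eta> "[a]" "[]"] by simp

lemma alternating_linear_Cons:
  assumes "alternating \<eta>" shows "linear (\<lambda>v. \<eta> (v # vs))"
proof -
  have "0 < length (undefined # vs)" by simp
  then have "linear (\<lambda>v. \<eta> ((undefined # vs)[0 := v]))"
    using assms[unfolded alternating_def, THEN conjunct1] by blast
  then show ?thesis by simp
qed

lemma alternating_distinct: "alternating \<eta> \<Longrightarrow> \<not> distinct vs \<Longrightarrow> \<eta> vs = 0"
  by (simp add: alternating_def)

lemma alternating_swap:
  assumes "alternating \<eta>" shows "\<eta> (a # b # vs) = - \<eta> (b # a # vs)"
proof -
  have l1: "linear (\<lambda>v. \<eta> (v # us))" for us using assms by (rule alternating_linear_Cons)
  have l2: "linear (\<lambda>v. \<eta> (u # v # us))" for u us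
    using alternating_linear_Cons[OF alternating_Cons[OF assms]] .
  have "0 = \<eta> ((a + b) # (a + b) # vs)"
    using alternating_distinct[OF assms] by simp
  also have "\<dots> = \<eta> (a # a # vs) + \<eta> (a # b # vs) + (\<eta> (b # a # vs) + \<eta> (b # b # vs))"
    by (simp add: linear_add[OF l1] linear_add[OF l2])
  also have "\<dots> = \<eta> (a # b # vs) + \<eta> (b # a # vs)"
    using alternating_distinct[OF assms] by simp
  finally show ?thesis by simp
qed

lemma alternating_move:
  assumes "alternating \<eta>" shows "\<eta> (a # us @ ws) = (-1) ^ length us * \<eta> (us @ a # ws)"
  using assms
proof (induction us arbitrary: \<eta>)
  case (Cons u us)
  show ?case
    using Cons.IH[OF alternating_Cons[OF Cons.prems, of u]] alternating_swap[OF Cons.prems, of a u]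
    by simp
qed simp

text \<open>Each of the \<open>length us\<close> vectors is moved past \<open>length vs\<close> others, one transposition at a time.\<close>

lemma alternating_block_swap:
  assumes "alternating \<eta>"
  shows "\<eta> (us @ vs @ ws) = (-1) ^ (length us * length vs) * \<eta> (vs @ us @ ws)"
  using assms
proof (induction us arbitrary: \<eta>)
  case (Cons u us)
  have "\<eta> (u # us @ vs @ ws) = (-1) ^ (length us * length vs) * \<eta> (u # vs @ us @ ws)"
    using Cons.IH[OF alternating_Cons[OF Cons.prems]] .
  also have "\<eta> (u # vs @ us @ ws) = (-1) ^ length vs * \<eta> (vs @ u # us @ ws)"
    using alternating_move[OF Cons.prems] by simp
  finally show ?case by (simp add: power_add algebra_simps)
qed simp

text \<open>For a family of alternating forms \<open>\<phi> v\<close> depending linearly on \<open>v\<close>, this is the antisymmetrisation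
  \<open>\<Sum>\<^sub>i (-1)\<^sup>i \<phi> v\<^sub>i (\<dots>, v\<^sub>i omitted, \<dots>)\<close>; with \<open>\<phi> v\<close> the derivative of a form in the direction \<open>v\<close> it is the
  exterior derivative. The recursion on the list splits off the first argument and turns the usual
  index computations with alternating sums into short inductions.\<close>

primrec alt_sum :: "('e \<Rightarrow> 'e list \<Rightarrow> real) \<Rightarrow> 'e list \<Rightarrow> real" where
  "alt_sum \<phi> [] = 0"
| "alt_sum \<phi> (v # vs) = \<phi> v vs - alt_sum (\<lambda>u us. \<phi> u (v # us)) vs"

lemma alt_sum_eq_sum:
  "alt_sum \<phi> vs = (\<Sum>i<length vs. (-1) ^ i * \<phi> (vs ! i) (take i vs @ drop (Suc i) vs))"
proof (induction vs arbitrary: \<phi>)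
  case (Cons v vs)
  show ?case
    by (simp del: sum.lessThan_Suc add: sum.lessThan_Suc_shift Cons.IH sum_negf)
qed simp

lemma alt_sum_zero [simp]: "alt_sum (\<lambda>u us. 0) vs = 0"
  by (induction vs) auto

lemma alt_sum_add: "alt_sum (\<lambda>u us. \<phi> u us + \<psi> u us) vs = alt_sum \<phi> vs + alt_sum \<psi> vs"
  by (induction vs arbitrary: \<phi> \<psi>) auto

lemma alt_sum_diff: "alt_sum (\<lambda>u us. \<phi> u us - \<psi> u us) vs = alt_sum \<phi> vs - alt_sum \<psi> vs"
  by (induction vs arbitrary: \<phi> \<psi>) auto

lemma alt_sum_cmult: "alt_sum (\<lambda>u us. c * \<phi> u us) vs = c * alt_sum \<phi> vs"
  by (induction vs arbitrary: \<phi>) (auto simp: algebra_simps)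

lemma alt_sum_sum: "alt_sum (\<lambda>u us. \<Sum>i\<in>I. \<phi> i u us) vs = (\<Sum>i\<in>I. alt_sum (\<phi> i) vs)"
  by (induction vs arbitrary: \<phi>) (auto simp: sum_subtractf)

lemma alt_sum_cong:
  assumes "\<And>u us. Suc (length us) = length vs \<Longrightarrow> \<phi> u us = \<psi> u us"
  shows "alt_sum \<phi> vs = alt_sum \<psi> vs"
  using assms
proof (induction vs arbitrary: \<phi> \<psi>)
  case (Cons v vs)
  have "alt_sum (\<lambda>u us. \<phi> u (v # us)) vs = alt_sum (\<lambda>u us. \<psi> u (v # us)) vs"
    by (rule Cons.IH) (simp add: Cons.prems)
  then show ?case using Cons.prems[of vs] by simp
qed simp

lemma alt_sum_append:
  "alt_sum \<phi> (us @ ws) =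
     alt_sum (\<lambda>v vs. \<phi> v (vs @ ws)) us + (-1) ^ length us * alt_sum (\<lambda>v vs. \<phi> v (us @ vs)) ws"
proof (induction us arbitrary: \<phi>)
  case (Cons u us)
  show ?case using Cons.IH[of "\<lambda>v vs. \<phi> v (u # vs)"] by simp
qed simp

lemma alt_sum_linear:
  assumes "\<And>u us. Suc (length us) = length vs \<Longrightarrow> linear (\<lambda>v. \<phi> v u us)"
  shows "linear (\<lambda>v. alt_sum (\<phi> v) vs)"
  using assms
proof (induction vs arbitrary: \<phi>)
  case (Cons w vs)
  have "linear (\<lambda>v. alt_sum (\<lambda>u us. \<phi> v u (w # us)) vs)"
    by (rule Cons.IH) (simp add: Cons.prems)
  then show ?case using Cons.prems[of vs w] by (simp add: linear_compose_sub)
qed (simp add: linear_zero_fun)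

text \<open>The algebraic content of \<open>d \<circ> d = 0\<close>: when the first argument \<open>a\<close> is split off from both sums, the
  two terms in which \<open>a\<close> fills one slot of \<open>h\<close> cancel by symmetry, and the rest is a sum of the same kind
  over the shorter list.\<close>

lemma alt_sum_symmetric:
  assumes "\<And>u v us. h u v us = h v u us"
  shows "alt_sum (\<lambda>u. alt_sum (h u)) vs = 0"
  using assms
proof (induction vs arbitrary: h)
  case (Cons a vs)
  have eq: "(\<lambda>u us. h u a us) = h a" by (intro ext) (rule Cons.prems)
  have "alt_sum (\<lambda>u us. alt_sum (h u) (a # us)) vs =
        alt_sum (h a) vs - alt_sum (\<lambda>u. alt_sum (\<lambda>v us. h u v (a # us))) vs"
    by (simp add: alt_sum_diff) (subst eq, rule refl)
  moreover have "alt_sum (\<lambda>u. alt_sum (\<lambda>v us. h u v (a # us))) vs = 0"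
    by (rule Cons.IH) (rule Cons.prems)
  ultimately show ?case by simp
qed simp

text \<open>A summand that keeps an occurrence of \<open>v\<close> in \<open>vs\<close> vanishes. In the one that removes it,
  moving \<open>v\<close> back to its place produces the sign that cancels the one of the alternating sum.\<close>

lemma alt_sum_insert:
  assumes "\<And>u. alternating (\<phi> u)" "v \<in> set vs"
  shows "alt_sum (\<lambda>u us. \<phi> u (v # us)) vs = \<phi> v vs"
  using assms
proof (induction vs arbitrary: \<phi>)
  case (Cons a vs)
  show ?case
  proof (cases "a = v")
    case True
    have "\<phi> u (v # v # us) = 0" for u us
      by (rule alternating_distinct[OF Cons.prems(1)]) simp
    then show ?thesis using True by simp
  next
    case False
    with Cons.prems have "v \<in> set vs" by simp
    then have "\<phi> a (v # vs) = 0"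
      by (intro alternating_distinct[OF Cons.prems(1)]) simp
    moreover have "alt_sum (\<lambda>u us. \<phi> u (v # a # us)) vs = - \<phi> v (a # vs)"
    proof -
      have "alt_sum (\<lambda>u us. \<phi> u (a # v # us)) vs = \<phi> v (a # vs)"
        using \<open>v \<in> set vs\<close>
        by (intro Cons.IH) (simp_all add: alternating_Cons Cons.prems)
      moreover have "(\<lambda>u us. \<phi> u (v # a # us)) = (\<lambda>u us. -1 * \<phi> u (a # v # us))"
        by (intro ext, simp only: mult_minus1, rule alternating_swap[OF Cons.prems(1)])
      ultimately show ?thesis by (simp only: alt_sum_cmult)
    qed
    ultimately show ?thesis by simp
  qed
qed simp

text \<open>This makes the exterior derivative of an alternating form alternating. If the repeated vector
  is the first one, \<open>alt_sum_insert\<close> matches the first summand with all the others.\<close>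

lemma alternating_alt_sum:
  assumes alt: "\<And>u. alternating (\<phi> u)" and lin: "\<And>us. linear (\<lambda>u. \<phi> u us)"
  shows "alternating (alt_sum \<phi>)"
  unfolding alternating_def
proof (intro conjI allI impI)
  fix vs :: "'a list" and i assume "i < length vs"
  with alt lin show "linear (\<lambda>v. alt_sum \<phi> (vs[i := v]))"
  proof (induction vs arbitrary: \<phi> i)
    case (Cons a vs)
    show ?case
    proof (cases i)
      case 0
      have "linear (\<lambda>v. alt_sum (\<lambda>u us. \<phi> u (v # us)) vs)"
        by (intro alt_sum_linear alternating_linear_Cons Cons.prems)
      then show ?thesis using 0 Cons.prems(2)[of vs] by (simp add: linear_compose_sub)
    next
      case (Suc j)
      with Cons.prems(3) have "j < length vs" by simp
      then have "linear (\<lambda>v. alt_sum (\<lambda>u us. \<phi> u (a # us)) (vs[j := v]))"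
        by (intro Cons.IH alternating_Cons Cons.prems)
      moreover have "linear (\<lambda>v. \<phi> a (vs[j := v]))"
        using Cons.prems(1)[of a] \<open>j < length vs\<close> by (simp add: alternating_def)
      ultimately show ?thesis using Suc by (simp add: linear_compose_sub)
    qed
  qed simp
next
  fix vs :: "'a list" assume "\<not> distinct vs"
  with alt show "alt_sum \<phi> vs = 0"
  proof (induction vs arbitrary: \<phi>)
    case (Cons a vs)
    show ?case
    proof (cases "distinct vs")
      case True
      then show ?thesis using Cons.prems by (simp add: alt_sum_insert)
    next
      case False
      then show ?thesis
        using Cons.IH[OF alternating_Cons[OF Cons.prems(1)]] alternating_distinct[OF Cons.prems(1)]
        by simp
    qed
  qed simp
qed

text \<open>The part of the product rule for \<open>y \<mapsto> \<eta> (f\<^sub>1 y, \<dots>, f\<^sub>k y)\<close> in which the arguments are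
  differentiated: the list holds the pairs of the value of \<open>f\<^sub>i\<close> and its derivative.\<close>

primrec leibniz :: "('e list \<Rightarrow> real) \<Rightarrow> ('e \<times> 'e) list \<Rightarrow> real" where
  "leibniz \<eta> [] = 0"
| "leibniz \<eta> (p # ps) = \<eta> (snd p # map fst ps) + leibniz (\<lambda>vs. \<eta> (fst p # vs)) ps"

text \<open>Moving the differentiated argument to the front turns the sum over the slots of \<open>\<eta>\<close> into an
  alternating sum.\<close>

lemma leibniz_eq_alt_sum:
  assumes "alternating \<eta>"
  shows "leibniz \<eta> (map (\<lambda>u. (t u, s u)) vs) = alt_sum (\<lambda>u us. \<eta> (s u # map t us)) vs"
  using assms
proof (induction vs arbitrary: \<eta>)
  case (Cons a vs)
  have "(\<lambda>u us. \<eta> (s u # t a # map t us)) = (\<lambda>u us. -1 * \<eta> (t a # s u # map t us))"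
    by (intro ext, simp only: mult_minus1, rule alternating_swap[OF Cons.prems])
  then have "alt_sum (\<lambda>u us. \<eta> (s u # t a # map t us)) vs =
             - alt_sum (\<lambda>u us. \<eta> (t a # s u # map t us)) vs"
    by (simp only: alt_sum_cmult)
  then show ?case
    using Cons.IH[OF alternating_Cons[OF Cons.prems, of "t a"]] by (simp add: comp_def)
qed simp

text \<open>Reason for the naturality of \<open>d\<close>: in the exterior derivative of a pullback along a map with
  derivative \<open>t\<close> and second derivative \<open>s\<close>, the terms with second derivatives sum to zero.\<close>

lemma alt_sum_leibniz:
  assumes "alternating \<eta>" and "\<And>u v. s u v = s v u"
  shows "alt_sum (\<lambda>u us. leibniz \<eta> (map (\<lambda>v. (t v, s u v)) us)) vs = 0"
  using assms(1)
proof (induction vs arbitrary: \<eta>)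
  case (Cons a vs)
  have sa: "(\<lambda>u us. \<eta> (s u a # map t us)) = (\<lambda>u us. \<eta> (s a u # map t us))"
    by (simp only: assms(2))
  have "alt_sum (\<lambda>u us. leibniz \<eta> (map (\<lambda>v. (t v, s u v)) (a # us))) vs =
        alt_sum (\<lambda>u us. \<eta> (s a u # map t us)) vs +
        alt_sum (\<lambda>u us. leibniz (\<lambda>vs. \<eta> (t a # vs)) (map (\<lambda>v. (t v, s u v)) us)) vs"
    by (simp only: list.map leibniz.simps fst_conv snd_conv map_map comp_def alt_sum_add)
       (subst sa, rule refl)
  also have "alt_sum (\<lambda>u us. leibniz (\<lambda>vs. \<eta> (t a # vs)) (map (\<lambda>v. (t v, s u v)) us)) vs = 0"
    by (intro Cons.IH alternating_Cons Cons.prems)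
  also have "alt_sum (\<lambda>u us. \<eta> (s a u # map t us)) vs = leibniz \<eta> (map (\<lambda>v. (t v, s a v)) vs)"
    by (rule leibniz_eq_alt_sum[OF Cons.prems, symmetric])
  finally show ?case by simp
qed simp

section \<open>Multivectors as functionals on alternating forms\<close>

text \<open>Gaussian elimination for a space of functions whose elements are determined by their values on a
  finite set. If some element does not vanish at the point \<open>i\<close>, it is normalised there, and the
  elements vanishing at \<open>i\<close> form a space determined by the remaining points. The family obtained need not
  be a basis, but every element is the combination with its own values as coefficients.\<close>

lemma exists_dual_family:
  fixes F :: "('i \<Rightarrow> real) set"
  assumes "finite I" and "(\<lambda>x. 0) \<in> F"
    and "\<And>f g c. f \<in> F \<Longrightarrow> g \<in> F \<Longrightarrow> (\<lambda>x. f x + c * g x) \<in> F"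
    and "\<And>f. f \<in> F \<Longrightarrow> \<forall>i\<in>I. f i = 0 \<Longrightarrow> f = (\<lambda>x. 0)"
  shows "\<exists>\<theta>. (\<forall>i. \<theta> i \<in> F) \<and> (\<forall>f\<in>F. \<forall>x. f x = (\<Sum>i\<in>I. f i * \<theta> i x))"
  using assms
proof (induction I arbitrary: F rule: finite_induct)
  case empty
  have "f x = 0" if "f \<in> F" for f x
    by (subst empty.prems(3)[OF that]) simp_all
  then show ?case using empty.prems(1) by (intro exI[of _ "\<lambda>i x. 0"]) simp
next
  case (insert i I)
  note zero = insert.prems(1) and comb = insert.prems(2) and sep = insert.prems(3)
  show ?case
  proof (cases "\<forall>f\<in>F. f i = 0")
    case True
    have "\<exists>\<theta>. (\<forall>i. \<theta> i \<in> F) \<and> (\<forall>f\<in>F. \<forall>x. f x = (\<Sum>i\<in>I. f i * \<theta> i x))"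
    proof (rule insert.IH[OF zero comb])
      fix f assume "f \<in> F" "\<forall>j\<in>I. f j = 0"
      then show "f = (\<lambda>x. 0)" using True by (intro sep) simp_all
    qed
    then obtain \<theta> where "\<forall>i. \<theta> i \<in> F" "\<forall>f\<in>F. \<forall>x. f x = (\<Sum>i\<in>I. f i * \<theta> i x)" by blast
    then show ?thesis using True insert.hyps by (intro exI[of _ \<theta>]) simp
  next
    case False
    then obtain g where g: "g \<in> F" "g i \<noteq> 0" by blast
    \<comment> \<open>the zero summand puts the multiple of \<open>g\<close> into the form in which \<open>F\<close> is closed\<close>
    define e where "e = (\<lambda>x. 0 + (1 / g i) * g x)"
    have e: "e \<in> F" "e i = 1"
      unfolding e_def using g(2) comb[OF zero g(1), of "1 / g i"] by simp_all
    define F' where "F' = {f \<in> F. f i = 0}"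
    have "\<exists>\<theta>. (\<forall>i. \<theta> i \<in> F') \<and> (\<forall>f\<in>F'. \<forall>x. f x = (\<Sum>i\<in>I. f i * \<theta> i x))"
    proof (rule insert.IH)
      fix f assume "f \<in> F'" "\<forall>j\<in>I. f j = 0"
      then show "f = (\<lambda>x. 0)" by (intro sep) (simp_all add: F'_def)
    qed (simp_all add: F'_def zero comb)
    then obtain \<theta> where \<theta>: "\<And>j. \<theta> j \<in> F'" "\<And>f x. f \<in> F' \<Longrightarrow> f x = (\<Sum>i\<in>I. f i * \<theta> i x)"
      by blast
    have sub: "(\<lambda>x. e x + (\<Sum>l\<in>J. - e l * \<theta> l x)) \<in> F" if "finite J" for J
      using that
    proof (induction J rule: finite_induct)
      case (insert j J)
      have "(\<lambda>x. (e x + (\<Sum>l\<in>J. - e l * \<theta> l x)) + (- e j) * \<theta> j x) \<in> F"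
        using insert.IH \<theta>(1) by (intro comb) (auto simp: F'_def)
      then show ?case using insert.hyps by (simp add: algebra_simps)
    qed (use e in simp)
    define \<theta>' where "\<theta>' = (\<lambda>j. if j = i then (\<lambda>x. e x + (\<Sum>l\<in>I. - e l * \<theta> l x)) else \<theta> j)"
    have "\<theta>' j \<in> F" for j
      using sub[OF insert.hyps(1)] \<theta>(1) by (auto simp: \<theta>'_def F'_def)
    moreover have "f x = (\<Sum>j\<in>insert i I. f j * \<theta>' j x)" if "f \<in> F" for f x
    proof -
      have "(\<lambda>x. f x + (- f i) * e x) \<in> F'"
        using comb[OF that e(1), of "- f i"] e(2) by (simp add: F'_def)
      from \<theta>(2)[OF this, of x]
      have "f x = f i * e x + (\<Sum>l\<in>I. (f l + (- f i) * e l) * \<theta> l x)" by simp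
      also have "\<dots> = f i * (e x + (\<Sum>l\<in>I. - e l * \<theta> l x)) + (\<Sum>l\<in>I. f l * \<theta> l x)"
        by (simp add: algebra_simps sum.distrib sum_distrib_left sum_negf sum_subtractf)
      also have "(\<Sum>l\<in>I. f l * \<theta> l x) = (\<Sum>l\<in>I. f l * \<theta>' l x)"
        using insert.hyps by (intro sum.cong) (auto simp: \<theta>'_def)
      finally show ?thesis using insert.hyps by (simp add: \<theta>'_def)
    qed
    ultimately show ?thesis by blast
  qed
qed

lemma linear_lincomb:
  "linear f \<Longrightarrow> linear g \<Longrightarrow> linear (\<lambda>v. f v + c * g v)" for f g :: "'a::real_vector \<Rightarrow> real"
  by (simp add: linear_iff algebra_simps)

lemma alternating_lincomb:
  assumes "alternating \<eta>" "alternating \<zeta>"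
  shows "alternating (\<lambda>vs. \<eta> vs + c * \<zeta> vs)"
  using assms unfolding alternating_def
  by (auto intro!: linear_lincomb)

lemma alt_forms_lincomb:
  "\<eta> \<in> alt_forms k \<Longrightarrow> \<zeta> \<in> alt_forms k \<Longrightarrow> (\<lambda>vs. \<eta> vs + c * \<zeta> vs) \<in> alt_forms k"
  by (simp add: alt_forms_iff alternating_lincomb)

lemma alt_forms_zero [simp]: "(\<lambda>vs. 0) \<in> alt_forms k"
  by (simp add: alt_forms_iff)

lemma alt_forms_append:
  assumes "\<eta> \<in> alt_forms (length us + k + length ws)"
  shows "(\<lambda>vs. \<eta> (us @ vs @ ws)) \<in> alt_forms k"
  using assms by (auto simp: alt_forms_iff alternating_append)

lemma alt_forms_map:
  assumes "\<eta> \<in> alt_forms k" and T: "linear T"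
  shows "(\<lambda>vs. \<eta> (map T vs)) \<in> alt_forms k"
proof -
  have "linear (\<lambda>v. \<eta> (map T (vs[i := v])))" if "i < length vs" for vs i
  proof -
    have "linear (\<lambda>v. \<eta> ((map T vs)[i := v]))"
      using assms(1) that by (simp add: alt_forms_iff alternating_def)
    from linear_compose[OF T this] show ?thesis by (simp add: comp_def map_update)
  qed
  moreover have "\<not> distinct vs \<Longrightarrow> \<eta> (map T vs) = 0" for vs
    using assms(1) by (auto simp: alt_forms_iff alternating_def distinct_map)
  ultimately show ?thesis
    using assms(1) by (simp add: alt_forms_iff alternating_def)
qed

lemma multivector_lincomb:
  assumes "U \<in> multivectors p" "f \<in> alt_forms p" "g \<in> alt_forms p"
  shows "U (\<lambda>vs. f vs + c * g vs) = U f + c * U g"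
proof -
  obtain S a where S: "finite S" "\<forall>vs\<in>S. length vs = p"
    and U: "U = (\<lambda>\<eta>. \<Sum>vs\<in>S. a vs * wedge vs \<eta>)"
    using assms(1) unfolding multivectors_def by blast
  have "wedge vs (\<lambda>vs. f vs + c * g vs) = wedge vs f + c * wedge vs g" if "vs \<in> S" for vs
    using that S(2) assms(2,3) by (simp add: wedge_def alt_forms_lincomb)
  then have "(\<Sum>vs\<in>S. a vs * wedge vs (\<lambda>vs. f vs + c * g vs)) =
             (\<Sum>vs\<in>S. a vs * wedge vs f + c * (a vs * wedge vs g))"
    by (intro sum.cong) (simp_all add: algebra_simps)
  then show ?thesis
    unfolding U by (simp add: sum.distrib sum_distrib_left)
qed

lemma multivector_zero [simp]:
  assumes "U \<in> multivectors p" shows "U (\<lambda>vs. 0) = 0"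
  using multivector_lincomb[OF assms, of "\<lambda>vs. 0" "\<lambda>vs. 0" 1] by simp

lemma multivector_outside:
  assumes "U \<in> multivectors p" "f \<notin> alt_forms p" shows "U f = 0"
  using assms by (auto simp: multivectors_def wedge_def intro!: sum.neutral)

text \<open>The model space of a manifold is only known to have some finite spanning set. A basis \<open>B\<close> is
  fixed to expand arguments of forms and to write multivectors with finitely many coefficients.\<close>

locale finite_dim =
  fixes B :: "'e::real_normed_vector set"
  assumes finite_B: "finite B" and independent_B: "independent B" and span_B: "span B = UNIV"
begin

definition basis_lists :: "nat \<Rightarrow> 'e list set" where
  "basis_lists p = {bs. set bs \<subseteq> B \<and> length bs = p}"

lemma finite_basis_lists [simp]: "finite (basis_lists p)"
  unfolding basis_lists_def using finite_B by (rule finite_lists_length_eq)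

lemma length_basis_lists: "bs \<in> basis_lists p \<Longrightarrow> length bs = p"
  by (simp add: basis_lists_def)

text \<open>Induction on the arguments: the form with the first slot filled by a basis vector vanishes by the
  induction hypothesis, and linearity in the first slot extends this to the span.\<close>

lemma alternating_eq_zero:
  assumes "alternating \<eta>" "\<forall>bs\<in>basis_lists (length vs). \<eta> bs = 0"
  shows "\<eta> vs = 0"
  using assms
proof (induction vs arbitrary: \<eta>)
  case Nil
  then show ?case by (simp add: basis_lists_def)
next
  case (Cons v vs)
  have "\<eta> (b # vs) = 0" if "b \<in> B" for b
    by (rule Cons.IH[OF alternating_Cons[OF Cons.prems(1)]])
       (use Cons.prems(2) that in \<open>auto simp: basis_lists_def\<close>)
  then show ?case
    using linear_eq_0_on_span[OF alternating_linear_Cons[OF Cons.prems(1)], of B vs v]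
    by (simp add: span_B)
qed

text \<open>A choice of alternating forms replacing the basis dual to the wedges of basis vectors: every form is
  expanded with its own values on basis lists as coefficients, so a linear functional on forms is
  determined by its values on these forms.\<close>

definition dual_form :: "nat \<Rightarrow> 'e list \<Rightarrow> 'e list \<Rightarrow> real" where
  "dual_form p = (SOME \<theta>. (\<forall>bs. \<theta> bs \<in> alt_forms p) \<and>
     (\<forall>\<eta>\<in>alt_forms p. \<forall>vs. \<eta> vs = (\<Sum>bs\<in>basis_lists p. \<eta> bs * \<theta> bs vs)))"

lemma dual_form:
  shows dual_form_alt [simp]: "dual_form p bs \<in> alt_forms p"
    and dual_form_expand:
      "\<eta> \<in> alt_forms p \<Longrightarrow> \<eta> = (\<lambda>vs. \<Sum>bs\<in>basis_lists p. \<eta> bs * dual_form p bs vs)"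
proof -
  have "\<eta> = (\<lambda>vs. 0)" if "\<eta> \<in> alt_forms p" "\<forall>bs\<in>basis_lists p. \<eta> bs = 0" for \<eta> :: "'e list \<Rightarrow> real"
  proof
    fix vs show "\<eta> vs = 0"
      using that alternating_eq_zero[of \<eta> vs] by (cases "length vs = p") (auto simp: alt_forms_iff)
  qed
  then have "\<exists>\<theta>. (\<forall>bs. \<theta> bs \<in> alt_forms p) \<and>
     (\<forall>\<eta>\<in>alt_forms p. \<forall>vs. \<eta> vs = (\<Sum>bs\<in>basis_lists p. \<eta> bs * \<theta> bs vs))"
    by (intro exists_dual_family) (auto simp: alt_forms_lincomb)
  from someI_ex[OF this]
  show "dual_form p bs \<in> alt_forms p"
    and "\<eta> \<in> alt_forms p \<Longrightarrow> \<eta> = (\<lambda>vs. \<Sum>bs\<in>basis_lists p. \<eta> bs * dual_form p bs vs)"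
    unfolding dual_form_def[symmetric] by (simp_all add: fun_eq_iff)
qed

text \<open>Stated for functionals that are additive and homogeneous on the alternating forms only, since
  multivectors are extended by zero to all other functions.\<close>

lemma functional_expand:
  assumes comb: "\<And>f g c. f \<in> alt_forms p \<Longrightarrow> g \<in> alt_forms p \<Longrightarrow>
                   U (\<lambda>vs. f vs + c * g vs) = U f + c * U g"
    and "\<eta> \<in> alt_forms p"
  shows "U \<eta> = (\<Sum>bs\<in>basis_lists p. U (dual_form p bs) * \<eta> bs)"
proof -
  have zero: "U (\<lambda>vs. 0) = 0"
    using comb[of "\<lambda>vs. 0" "\<lambda>vs. 0" 1] by simp
  have "(\<lambda>vs. \<Sum>bs\<in>J. \<eta> bs * dual_form p bs vs) \<in> alt_forms p \<and>
        U (\<lambda>vs. \<Sum>bs\<in>J. \<eta> bs * dual_form p bs vs) = (\<Sum>bs\<in>J. U (dual_form p bs) * \<eta> bs)"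
    if "finite J" for J
    using that
  proof (induction J rule: finite_induct)
    case empty
    then show ?case by (simp add: zero)
  next
    case (insert j J)
    have eq: "(\<lambda>vs. \<Sum>bs\<in>insert j J. \<eta> bs * dual_form p bs vs) =
          (\<lambda>vs. (\<Sum>bs\<in>J. \<eta> bs * dual_form p bs vs) + \<eta> j * dual_form p j vs)"
      using insert.hyps by (simp add: algebra_simps)
    show ?case
      unfolding eq using insert.IH insert.hyps by (simp add: alt_forms_lincomb comb)
  qed
  from this[of "basis_lists p"] show ?thesis
    using dual_form_expand[OF assms(2)] by simp
qed

text \<open>Every linear functional on alternating forms is a combination of evaluations at basis lists, so
  the exterior power is the full dual space. The Schouten bracket is constructed as such a functional.\<close>

lemma multivectorsI:
  fixes U :: "('e list \<Rightarrow> real) \<Rightarrow> real"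
  assumes comb: "\<And>f g c. f \<in> alt_forms p \<Longrightarrow> g \<in> alt_forms p \<Longrightarrow>
                   U (\<lambda>vs. f vs + c * g vs) = U f + c * U g"
    and zero: "\<And>f. f \<notin> alt_forms p \<Longrightarrow> U f = 0"
  shows "U \<in> multivectors p"
proof -
  have "U \<eta> = (\<Sum>bs\<in>basis_lists p. U (dual_form p bs) * wedge bs \<eta>)" for \<eta>
  proof (cases "\<eta> \<in> alt_forms p")
    case True
    then show ?thesis
      by (subst functional_expand[OF comb True]) (auto simp: wedge_def length_basis_lists)
  next
    case False
    then show ?thesis by (auto simp: zero wedge_def length_basis_lists intro!: sum.neutral[symmetric])
  qed
  then have "U = (\<lambda>\<eta>. \<Sum>bs\<in>basis_lists p. U (dual_form p bs) * wedge bs \<eta>)" ..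
  then show ?thesis
    unfolding multivectors_def
    by (intro CollectI exI[of _ "basis_lists p"] exI[of _ "\<lambda>bs. U (dual_form p bs)"])
       (simp add: length_basis_lists)
qed

text \<open>Contraction with the multivector \<open>\<Sum> u bs \<cdot> (b\<^sub>1 \<and> \<dots> \<and> b\<^sub>p)\<close>. In contrast to a multivector, which
  vanishes on functions that are not alternating \<open>p\<close>-forms, this is linear in \<open>\<eta>\<close> and in
  \<open>u\<close> without conditions, which the product rule below exploits.\<close>

definition frame_contract :: "nat \<Rightarrow> ('e list \<Rightarrow> real) \<Rightarrow> ('e list \<Rightarrow> real) \<Rightarrow> 'e list \<Rightarrow> real" where
  "frame_contract p u \<eta> ws = (\<Sum>bs\<in>basis_lists p. u bs * \<eta> (bs @ ws))"

definition coeff :: "nat \<Rightarrow> (('e list \<Rightarrow> real) \<Rightarrow> real) \<Rightarrow> 'e list \<Rightarrow> real" where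
  "coeff p U bs = U (dual_form p bs)"

text \<open>When the degrees do not match, both sides vanish: the argument of \<open>U\<close> is then either zero or not an
  alternating \<open>p\<close>-form.\<close>

lemma contract_eq_frame:
  assumes U: "U \<in> multivectors p" and \<eta>: "\<eta> \<in> alt_forms k"
  shows "U (\<lambda>vs. \<eta> (vs @ ws)) = frame_contract p (coeff p U) \<eta> ws"
proof (cases "p + length ws = k")
  case True
  then have "(\<lambda>vs. \<eta> (vs @ ws)) \<in> alt_forms p"
    using alt_forms_append[of \<eta> "[]" p ws] \<eta> by simp
  then have "U (\<lambda>vs. \<eta> (vs @ ws)) = (\<Sum>bs\<in>basis_lists p. U (dual_form p bs) * \<eta> (bs @ ws))"
    by (rule functional_expand[rotated]) (rule multivector_lincomb[OF U])
  then show ?thesis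
    by (simp add: frame_contract_def coeff_def)
next
  case False
  have "frame_contract p (coeff p U) \<eta> ws = 0"
    unfolding frame_contract_def using False \<eta>
    by (intro sum.neutral) (auto simp: alt_forms_iff length_basis_lists)
  moreover have "U (\<lambda>vs. \<eta> (vs @ ws)) = 0"
  proof (cases "(\<lambda>vs. \<eta> (vs @ ws)) \<in> alt_forms p")
    case alt: True
    have "\<eta> (vs @ ws) = 0" for vs
      using False \<eta> alt by (cases "length vs = p") (auto simp: alt_forms_iff)
    then show ?thesis using U by simp
  qed (simp add: multivector_outside[OF U])
  ultimately show ?thesis by simp
qed

lemma frame_contract_alternating: "alternating \<eta> \<Longrightarrow> alternating (frame_contract p u \<eta>)"
proof -
  assume \<eta>: "alternating \<eta>"
  have "alternating (\<lambda>ws. \<Sum>bs\<in>J. u bs * \<eta> (bs @ ws))" if "finite J" for J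
    using that
  proof (induction J rule: finite_induct)
    case (insert j J)
    have "alternating (\<lambda>ws. (\<Sum>bs\<in>J. u bs * \<eta> (bs @ ws)) + u j * \<eta> (j @ ws))"
      using alternating_append[OF \<eta>, of j "[]"] by (intro alternating_lincomb insert.IH) simp
    then show ?case using insert.hyps by (simp add: algebra_simps)
  qed simp
  from this[of "basis_lists p"] show ?thesis by (simp add: frame_contract_def[abs_def])
qed

lemma frame_contract_alt_forms:
  assumes "\<eta> \<in> alt_forms k" "p \<le> k"
  shows "frame_contract p u \<eta> \<in> alt_forms (k - p)"
proof -
  have "frame_contract p u \<eta> ws = 0" if "length ws \<noteq> k - p" for ws
    unfolding frame_contract_def using that assms
    by (intro sum.neutral) (auto simp: alt_forms_iff length_basis_lists)
  with assms show ?thesis by (simp add: alt_forms_iff frame_contract_alternating)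
qed

lemma frame_contract_high_degree:
  assumes "\<eta> \<in> alt_forms k" "k < p"
  shows "frame_contract p u \<eta> = (\<lambda>ws. 0)"
  unfolding frame_contract_def using assms
  by (intro ext sum.neutral) (auto simp: alt_forms_iff length_basis_lists)

lemma frame_contract_commute:
  assumes "alternating \<eta>"
  shows "frame_contract p u (frame_contract q w \<eta>) ws = (-1) ^ (p * q) * frame_contract q w (frame_contract p u \<eta>) ws"
proof -
  have "frame_contract p u (frame_contract q w \<eta>) ws =
      (\<Sum>bs\<in>basis_lists p. \<Sum>cs\<in>basis_lists q. u bs * (w cs * \<eta> (cs @ bs @ ws)))"
    by (simp add: frame_contract_def sum_distrib_left)
  also have "\<dots> = (\<Sum>bs\<in>basis_lists p. \<Sum>cs\<in>basis_lists q.
                   (-1) ^ (p * q) * (w cs * (u bs * \<eta> (bs @ cs @ ws))))"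
    by (intro sum.cong refl, subst alternating_block_swap[OF assms])
       (simp add: length_basis_lists algebra_simps)
  also have "\<dots> = (\<Sum>cs\<in>basis_lists q. \<Sum>bs\<in>basis_lists p.
                   (-1) ^ (p * q) * (w cs * (u bs * \<eta> (bs @ cs @ ws))))"
    by (rule sum.swap)
  also have "\<dots> = (-1) ^ (p * q) * frame_contract q w (frame_contract p u \<eta>) ws"
    by (simp add: frame_contract_def sum_distrib_left)
  finally show ?thesis .
qed

end

section \<open>Calculus in a finite-dimensional normed space\<close>

lemma has_derivative_eq_on_open:
  assumes "(f has_derivative f') (at x)" "(g has_derivative g') (at x)"
    and "open S" "x \<in> S" "\<And>y. y \<in> S \<Longrightarrow> f y = g y"
  shows "f' = g'"
  using has_derivative_unique[OF has_derivative_transform_within_open[OF assms(1,3,4,5)] assms(2)] .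

lemma Ck_on_cong:
  assumes "open S" "\<And>x. x \<in> S \<Longrightarrow> f x = g x" "Ck_on k S f"
  shows "Ck_on k S g"
  using assms(2,3)
proof (induction k arbitrary: f g)
  case 0
  then show ?case using continuous_on_cong[of S S f g] by simp
next
  case (Suc k)
  have diff: "f differentiable (at x)" if "x \<in> S" for x using Suc.prems that by simp
  have "g differentiable (at x)" if "x \<in> S" for x
  proof -
    from diff[OF that] obtain D where "(f has_derivative D) (at x)"
      by (auto simp: differentiable_def)
    then have "(g has_derivative D) (at x)"
      by (rule has_derivative_transform_within_open[OF _ \<open>open S\<close> that Suc.prems(1)])
    then show ?thesis by (auto simp: differentiable_def)
  qed
  moreover have "Ck_on k S (\<lambda>x. frechet_derivative g (at x) v)" for v
  proof (rule Suc.IH)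
    show "Ck_on k S (\<lambda>x. frechet_derivative f (at x) v)" using Suc.prems by simp
    show "frechet_derivative f (at x) v = frechet_derivative g (at x) v" if "x \<in> S" for x
      using frechet_derivative_transform_within_open[OF diff[OF that] \<open>open S\<close> that Suc.prems(1)]
      by simp
  qed
  ultimately show ?case by simp
qed

lemma smooth_on_cong:
  "open S \<Longrightarrow> (\<And>x. x \<in> S \<Longrightarrow> f x = g x) \<Longrightarrow> smooth_on S f \<Longrightarrow> smooth_on S g"
  unfolding smooth_on_def using Ck_on_cong by blast

lemma smooth_on_differentiable:
  "smooth_on S f \<Longrightarrow> x \<in> S \<Longrightarrow> f differentiable (at x)"
  unfolding smooth_on_def by (metis Ck_on.simps(2))

lemma smooth_on_has_derivative:
  "smooth_on S f \<Longrightarrow> x \<in> S \<Longrightarrow> (f has_derivative frechet_derivative f (at x)) (at x)"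
  using smooth_on_differentiable frechet_derivative_works by blast

lemma smooth_on_derivative:
  "smooth_on S f \<Longrightarrow> smooth_on S (\<lambda>x. frechet_derivative f (at x) v)"
  unfolding smooth_on_def by (metis Ck_on.simps(2))

lemma Ck_on_const: "Ck_on k S (\<lambda>x. c)"
  by (induction k arbitrary: c) simp_all

lemma smooth_on_const [simp]: "smooth_on S (\<lambda>x. c)"
  by (simp add: smooth_on_def Ck_on_const)

lemma Ck_on_add:
  assumes "open S" "Ck_on k S f" "Ck_on k S g"
  shows "Ck_on k S (\<lambda>x. f x + g x)"
  using assms(2,3)
proof (induction k arbitrary: f g)
  case (Suc k)
  have "Ck_on k S (\<lambda>x. frechet_derivative (\<lambda>x. f x + g x) (at x) v)" for v
  proof (rule Ck_on_cong[OF \<open>open S\<close>])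
    show "Ck_on k S (\<lambda>x. frechet_derivative f (at x) v + frechet_derivative g (at x) v)"
      using Suc by simp
    fix x assume "x \<in> S"
    then have "((\<lambda>x. f x + g x) has_derivative
        (\<lambda>v. frechet_derivative f (at x) v + frechet_derivative g (at x) v)) (at x)"
      using Suc.prems by (intro has_derivative_add) (simp_all add: frechet_derivative_works[symmetric])
    from frechet_derivative_at[OF this]
    show "frechet_derivative f (at x) v + frechet_derivative g (at x) v =
          frechet_derivative (\<lambda>x. f x + g x) (at x) v" by (rule fun_cong)
  qed
  then show ?case using Suc.prems by simp
qed (simp add: continuous_on_add)

lemma smooth_on_add:
  "open S \<Longrightarrow> smooth_on S f \<Longrightarrow> smooth_on S g \<Longrightarrow> smooth_on S (\<lambda>x. f x + g x)"
  unfolding smooth_on_def using Ck_on_add by blast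

text \<open>The derivative of a product contains the undifferentiated factors, so the induction on \<open>k\<close> needs
  factors with one more derivative; assuming them smooth provides this at every stage.\<close>

lemma Ck_on_mult:
  fixes f g :: "'a::real_normed_vector \<Rightarrow> real"
  assumes "open S" "smooth_on S f" "smooth_on S g"
  shows "Ck_on k S (\<lambda>x. f x * g x)"
  using assms(2,3)
proof (induction k arbitrary: f g)
  case 0
  then show ?case by (metis Ck_on.simps(1) continuous_on_mult smooth_on_def)
next
  case (Suc k)
  note d = smooth_on_differentiable[OF Suc.prems(1)] smooth_on_differentiable[OF Suc.prems(2)]
  have "Ck_on k S (\<lambda>x. frechet_derivative (\<lambda>x. f x * g x) (at x) v)" for v
  proof (rule Ck_on_cong[OF \<open>open S\<close>])
    show "Ck_on k S (\<lambda>x. f x * frechet_derivative g (at x) v + frechet_derivative f (at x) v * g x)"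
      by (intro Ck_on_add \<open>open S\<close> Suc.IH smooth_on_derivative Suc.prems)
    fix x assume "x \<in> S"
    then have "((\<lambda>x. f x * g x) has_derivative
        (\<lambda>v. f x * frechet_derivative g (at x) v + frechet_derivative f (at x) v * g x)) (at x)"
      using d by (intro has_derivative_mult) (simp_all add: frechet_derivative_works[symmetric])
    from frechet_derivative_at[OF this]
    show "f x * frechet_derivative g (at x) v + frechet_derivative f (at x) v * g x =
          frechet_derivative (\<lambda>x. f x * g x) (at x) v" by (rule fun_cong)
  qed
  then show ?case using d by simp
qed

lemma smooth_on_mult:
  fixes f g :: "'a::real_normed_vector \<Rightarrow> real"
  shows "open S \<Longrightarrow> smooth_on S f \<Longrightarrow> smooth_on S g \<Longrightarrow> smooth_on S (\<lambda>x. f x * g x)"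
  using Ck_on_mult unfolding smooth_on_def[of S "\<lambda>x. f x * g x"] by blast

lemma smooth_on_diff:
  fixes f g :: "'a::real_normed_vector \<Rightarrow> real"
  assumes "open S" "smooth_on S f" "smooth_on S g"
  shows "smooth_on S (\<lambda>x. f x - g x)"
  using smooth_on_add[OF assms(1,2) smooth_on_mult[OF assms(1) smooth_on_const[of S "-1"] assms(3)]]
  by simp

lemma smooth_on_sum:
  assumes "open S" "\<And>i. i \<in> I \<Longrightarrow> smooth_on S (f i)"
  shows "smooth_on S (\<lambda>x. \<Sum>i\<in>I. f i x)"
  using assms(2) by (induction I rule: infinite_finite_induct) (simp_all add: smooth_on_add assms(1))

text \<open>By the mean value theorem in the direction \<open>u\<close>, the second difference is \<open>t\<close> times the
  increment along \<open>t v\<close> of the derivative in the direction \<open>u\<close>, at some point of the segment; differentiability of that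
  derivative at \<open>x\<close> turns the increment into \<open>t H v + o(t)\<close>.\<close>

lemma second_difference_quotient:
  fixes f :: "'a::real_normed_vector \<Rightarrow> real"
  assumes "open S" "x \<in> S" and f': "\<And>y. y \<in> S \<Longrightarrow> (f has_derivative f' y) (at y)"
    and H: "((\<lambda>y. f' y u) has_derivative H) (at x)"
  shows "((\<lambda>t. (f (x + t *\<^sub>R u + t *\<^sub>R v) - f (x + t *\<^sub>R u) - f (x + t *\<^sub>R v) + f x) / t\<^sup>2)
           \<longlongrightarrow> H v) (at_right 0)"
proof (rule tendstoI)
  fix e :: real assume "e > 0"
  define K where "K = norm u + norm v + 1"
  have "K > 0" by (simp add: K_def add_nonneg_pos)
  define e' where "e' = e / (4 * K)"
  have "e' > 0" using \<open>e > 0\<close> \<open>K > 0\<close> by (simp add: e'_def)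
  interpret H: bounded_linear H using H by (rule has_derivative_bounded_linear)
  from H \<open>e' > 0\<close> obtain d1 where "d1 > 0"
    and d1: "\<And>y. norm (y - x) < d1 \<Longrightarrow> \<bar>f' y u - f' x u - H (y - x)\<bar> \<le> e' * norm (y - x)"
    unfolding has_derivative_at_alt by (metis real_norm_def)
  from \<open>open S\<close> \<open>x \<in> S\<close> obtain d2 where "d2 > 0" and d2: "ball x d2 \<subseteq> S"
    using open_contains_ball by blast
  define d where "d = min d1 d2 / K"
  have "d > 0" using \<open>d1 > 0\<close> \<open>d2 > 0\<close> \<open>K > 0\<close> by (simp add: d_def)
  show "eventually (\<lambda>t. dist ((f (x + t *\<^sub>R u + t *\<^sub>R v) - f (x + t *\<^sub>R u) - f (x + t *\<^sub>R v) + f x) / t\<^sup>2)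
           (H v) < e) (at_right 0)"
  proof (rule eventually_at_rightI[of 0 d])
    fix t assume "t \<in> {0<..<d}"
    then have t: "0 < t" "t * K < min d1 d2"
      using \<open>K > 0\<close> by (simp_all add: d_def pos_less_divide_eq)
    have small: "norm (s *\<^sub>R u + r *\<^sub>R v) \<le> t * K" if "0 \<le> s" "s \<le> t" "0 \<le> r" "r \<le> t" for s r
    proof -
      have "norm (s *\<^sub>R u + r *\<^sub>R v) \<le> s * norm u + r * norm v"
        using norm_triangle_ineq[of "s *\<^sub>R u" "r *\<^sub>R v"] that by simp
      also have "\<dots> \<le> t * norm u + t * norm v"
        using that by (intro add_mono mult_right_mono) simp_all
      also have "\<dots> \<le> t * K" using t by (simp add: K_def algebra_simps)
      finally show ?thesis .
    qed
    have inS: "x + s *\<^sub>R u + r *\<^sub>R v \<in> S" if "0 \<le> s" "s \<le> t" "0 \<le> r" "r \<le> t" for s r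
    proof -
      have "dist x (x + s *\<^sub>R u + r *\<^sub>R v) = norm (s *\<^sub>R u + r *\<^sub>R v)"
        by (simp add: dist_norm norm_minus_commute add.assoc add.commute)
      then show ?thesis using small[OF that] t d2 by (auto simp: subset_iff)
    qed
    define g where "g = (\<lambda>s. f (x + s *\<^sub>R u + t *\<^sub>R v) - f (x + s *\<^sub>R u))"
    define g' where "g' = (\<lambda>s. f' (x + s *\<^sub>R u + t *\<^sub>R v) u - f' (x + s *\<^sub>R u) u)"
    have deriv: "((\<lambda>s. f (x + s *\<^sub>R u + r *\<^sub>R v)) has_real_derivative f' (x + s *\<^sub>R u + r *\<^sub>R v) u) (at s)"
      if "0 \<le> s" "s \<le> t" "0 \<le> r" "r \<le> t" for s r
    proof -
      note fd = f'[OF inS[OF that]]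
      have "((\<lambda>s. x + s *\<^sub>R u + r *\<^sub>R v) has_derivative (\<lambda>h. h *\<^sub>R u)) (at s)"
        by (auto intro!: derivative_eq_intros)
      from has_derivative_compose[OF this fd]
      have "((\<lambda>s. f (x + s *\<^sub>R u + r *\<^sub>R v)) has_derivative (\<lambda>h. f' (x + s *\<^sub>R u + r *\<^sub>R v) (h *\<^sub>R u))) (at s)" .
      moreover have "f' (x + s *\<^sub>R u + r *\<^sub>R v) (h *\<^sub>R u) = f' (x + s *\<^sub>R u + r *\<^sub>R v) u * h" for h
        using linear_scale[OF has_derivative_linear[OF fd]] by simp
      ultimately show ?thesis by (simp add: has_field_derivative_def)
    qed
    have "(g has_real_derivative g' s) (at s)" if "0 \<le> s" "s \<le> t" for s
      unfolding g_def g'_def using deriv[OF that, of t] deriv[OF that, of 0] t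
      by (intro DERIV_diff) simp_all
    with MVT2[of 0 t g g'] t obtain z where z: "0 < z" "z < t" "g t - g 0 = t * g' z" by auto
    \<comment> \<open>remainder of the first-order expansion at \<open>x\<close> of the derivative in the direction \<open>u\<close>\<close>
    define R where "R = (\<lambda>w. f' (x + w) u - f' x u - H w)"
    have R: "\<bar>R w\<bar> \<le> e' * (t * K)" if "norm w \<le> t * K" for w
    proof -
      have "\<bar>R w\<bar> \<le> e' * norm w" using d1[of "x + w"] that t by (simp add: R_def)
      also have "\<dots> \<le> e' * (t * K)" using that \<open>e' > 0\<close> by simp
      finally show ?thesis .
    qed
    have "g' z = t * H v + R (z *\<^sub>R u + t *\<^sub>R v) - R (z *\<^sub>R u)"
      by (simp add: g'_def R_def H.add H.scaleR add.assoc)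
    moreover have "\<bar>R (z *\<^sub>R u)\<bar> \<le> e' * (t * K)"
      using small[of z 0] z t by (intro R) simp
    moreover have "\<bar>R (z *\<^sub>R u + t *\<^sub>R v)\<bar> \<le> e' * (t * K)"
      using z t by (intro R small) simp_all
    ultimately have "\<bar>g' z - t * H v\<bar> \<le> e' * (t * K) + e' * (t * K)"
      by linarith
    also have "\<dots> = t * (e / 2)" using \<open>K > 0\<close> by (simp add: e'_def field_simps)
    finally have "\<bar>g' z - t * H v\<bar> / t \<le> e / 2" using t by (simp add: field_simps)
    moreover have "(f (x + t *\<^sub>R u + t *\<^sub>R v) - f (x + t *\<^sub>R u) - f (x + t *\<^sub>R v) + f x) / t\<^sup>2 - H v
          = (g' z - t * H v) / t"
      using z(3) t by (simp add: g_def power2_eq_square field_simps)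
    ultimately have "dist ((f (x + t *\<^sub>R u + t *\<^sub>R v) - f (x + t *\<^sub>R u) - f (x + t *\<^sub>R v) + f x) / t\<^sup>2)
           (H v) \<le> e / 2"
      using t by (simp add: dist_real_def)
    then show "dist ((f (x + t *\<^sub>R u + t *\<^sub>R v) - f (x + t *\<^sub>R u) - f (x + t *\<^sub>R v) + f x) / t\<^sup>2)
           (H v) < e"
      using \<open>e > 0\<close> by linarith
  qed (rule \<open>d > 0\<close>)
qed

text \<open>The second difference is symmetric in \<open>u\<close> and \<open>v\<close>, and its quotient by \<open>t\<^sup>2\<close> converges to either side.\<close>

lemma second_derivative_symmetric:
  fixes f :: "'a::real_normed_vector \<Rightarrow> real"
  assumes "open S" "x \<in> S" and "\<And>y. y \<in> S \<Longrightarrow> (f has_derivative f' y) (at y)"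
    and "((\<lambda>y. f' y u) has_derivative H) (at x)" "((\<lambda>y. f' y v) has_derivative K) (at x)"
  shows "H v = K u"
proof -
  let ?q = "\<lambda>u v t. (f (x + t *\<^sub>R u + t *\<^sub>R v) - f (x + t *\<^sub>R u) - f (x + t *\<^sub>R v) + f x) / t\<^sup>2"
  have eq: "?q u v = ?q v u" by (simp add: algebra_simps)
  have H: "(?q u v \<longlongrightarrow> H v) (at_right 0)"
    by (rule second_difference_quotient[OF assms(1-4)])
  have "(?q v u \<longlongrightarrow> K u) (at_right 0)"
    by (rule second_difference_quotient[OF assms(1-3,5)])
  then have "(?q u v \<longlongrightarrow> K u) (at_right 0)" by (simp only: eq)
  with H show ?thesis
    by (rule tendsto_unique[OF trivial_limit_at_right_real])
qed

text \<open>Comparison of norms on a finite-dimensional space, by induction on the basis. The induction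
  hypothesis makes the coefficients of a convergent sequence in \<open>span F\<close> Cauchy, so \<open>span F\<close> is closed and a
  further basis vector \<open>v\<close> has positive distance \<open>\<delta>\<close> from it; this bounds the coefficient of \<open>v\<close>,
  and then the others.\<close>

lemma independent_coefficients_bounded:
  fixes F :: "'a::real_normed_vector set"
  assumes "finite F" "independent F"
  shows "\<exists>C. \<forall>a. \<forall>b\<in>F. \<bar>a b\<bar> \<le> C * norm (\<Sum>b\<in>F. a b *\<^sub>R b)"
  using assms
proof (induction F rule: finite_induct)
  case (insert v F)
  from insert.prems insert.hyps have "independent F" and v: "v \<notin> span F"
    by (auto simp: independent_insert)
  with insert.IH obtain C where C: "\<And>a b. b \<in> F \<Longrightarrow> \<bar>a b\<bar> \<le> C * norm (\<Sum>b\<in>F. a b *\<^sub>R b)"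
    by blast
  have "\<exists>\<delta>>0. \<forall>a. \<delta> \<le> norm (v + (\<Sum>b\<in>F. a b *\<^sub>R b))"
  proof (rule ccontr)
    assume "\<not> ?thesis"
    then have "\<forall>n. \<exists>a. norm (v + (\<Sum>b\<in>F. a b *\<^sub>R b)) < inverse (real (Suc n))"
      by (metis inverse_positive_iff_positive not_le of_nat_0_less_iff zero_less_Suc)
    then obtain a where a: "\<And>n. norm (v + (\<Sum>b\<in>F. a n b *\<^sub>R b)) < inverse (real (Suc n))"
      by metis
    define w where "w = (\<lambda>n. \<Sum>b\<in>F. a n b *\<^sub>R b)"
    have "norm (v + w n) \<le> inverse (real (Suc n))" for n
      using a[of n] by (simp only: w_def less_imp_le)
    then have "(\<lambda>n. v + w n) \<longlonglongrightarrow> 0"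
      by (intro Lim_null_comparison[OF _ LIMSEQ_inverse_real_of_nat] always_eventually allI)
    then have w: "w \<longlonglongrightarrow> - v"
      using tendsto_diff[OF _ tendsto_const[of v], of "\<lambda>n. v + w n" 0] by simp
    have "Cauchy w" using w LIMSEQ_imp_Cauchy by blast
    have conv: "convergent (\<lambda>n. a n b)" if "b \<in> F" for b
    proof -
      have bd: "\<bar>a m b - a n b\<bar> \<le> (\<bar>C\<bar> + 1) * norm (w m - w n)" for m n
      proof -
        have "\<bar>a m b - a n b\<bar> \<le> C * norm (\<Sum>b\<in>F. (a m b - a n b) *\<^sub>R b)"
          using C[OF that, of "\<lambda>b. a m b - a n b"] .
        also have "(\<Sum>b\<in>F. (a m b - a n b) *\<^sub>R b) = w m - w n"
          by (simp add: w_def scaleR_diff_left sum_subtractf)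
        also have "C * norm (w m - w n) \<le> (\<bar>C\<bar> + 1) * norm (w m - w n)"
          by (intro mult_right_mono) auto
        finally show ?thesis .
      qed
      have "Cauchy (\<lambda>n. a n b)"
      proof (rule CauchyI)
        fix e :: real assume "e > 0"
        then have "e / (\<bar>C\<bar> + 1) > 0" by (simp add: add_nonneg_pos)
        from CauchyD[OF \<open>Cauchy w\<close> this] obtain M
          where M: "\<And>m n. M \<le> m \<Longrightarrow> M \<le> n \<Longrightarrow> norm (w m - w n) < e / (\<bar>C\<bar> + 1)" by blast
        have "norm (a m b - a n b) < e" if "M \<le> m" "M \<le> n" for m n
        proof -
          have "(\<bar>C\<bar> + 1) * norm (w m - w n) < e"
            using M[OF that] by (simp add: pos_less_divide_eq add_nonneg_pos mult.commute)
          with bd[of m n] show ?thesis by simp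
        qed
        then show "\<exists>M. \<forall>m\<ge>M. \<forall>n\<ge>M. norm (a m b - a n b) < e" by blast
      qed
      then show ?thesis by (rule real_Cauchy_convergent)
    qed
    then have "\<forall>b\<in>F. \<exists>l. (\<lambda>n. a n b) \<longlonglongrightarrow> l" by (simp add: convergent_def)
    then obtain l where l: "\<And>b. b \<in> F \<Longrightarrow> (\<lambda>n. a n b) \<longlonglongrightarrow> l b" by metis
    have "w \<longlonglongrightarrow> (\<Sum>b\<in>F. l b *\<^sub>R b)"
      unfolding w_def by (intro tendsto_sum tendsto_scaleR l tendsto_const)
    with w have "- v = (\<Sum>b\<in>F. l b *\<^sub>R b)" by (rule LIMSEQ_unique)
    then have "- v \<in> span F" by (simp add: span_sum span_scale span_base)
    then show False using v span_neg[of "- v" F] by simp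
  qed
  then obtain \<delta> where \<delta>: "\<delta> > 0" "\<And>a. \<delta> \<le> norm (v + (\<Sum>b\<in>F. a b *\<^sub>R b))" by blast
  define C' where "C' = 1 / \<delta> + \<bar>C\<bar> * (1 + norm v / \<delta>)"
  have "\<bar>a b\<bar> \<le> C' * norm (\<Sum>b\<in>insert v F. a b *\<^sub>R b)" if "b \<in> insert v F" for a b
  proof -
    define N where "N = norm (\<Sum>b\<in>insert v F. a b *\<^sub>R b)"
    have N: "N = norm (a v *\<^sub>R v + (\<Sum>b\<in>F. a b *\<^sub>R b))" using insert.hyps by (simp add: N_def)
    have "N \<ge> 0" by (simp add: N_def)
    have av: "\<bar>a v\<bar> * \<delta> \<le> N"
    proof (cases "a v = 0")
      case False
      have "\<bar>a v\<bar> * \<delta> \<le> \<bar>a v\<bar> * norm (v + (\<Sum>b\<in>F. (a b / a v) *\<^sub>R b))"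
        using \<delta>(2)[of "\<lambda>b. a b / a v"] by (intro mult_left_mono) auto
      also have "\<dots> = norm (a v *\<^sub>R (v + (\<Sum>b\<in>F. (a b / a v) *\<^sub>R b)))" by simp
      also have "a v *\<^sub>R (v + (\<Sum>b\<in>F. (a b / a v) *\<^sub>R b)) = a v *\<^sub>R v + (\<Sum>b\<in>F. a b *\<^sub>R b)"
        using False by (simp add: scaleR_add_right scaleR_sum_right)
      finally show ?thesis by (simp add: N)
    qed (simp add: \<open>N \<ge> 0\<close>)
    then have av': "\<bar>a v\<bar> \<le> N / \<delta>" using \<delta>(1) by (simp add: pos_le_divide_eq)
    show ?thesis
    proof (cases "b = v")
      case True
      have "N / \<delta> \<le> C' * N" using \<open>N \<ge> 0\<close> \<delta>(1) by (simp add: C'_def algebra_simps)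
      then show ?thesis using av' True by (simp add: N_def)
    next
      case False
      with that have "b \<in> F" by simp
      have "norm (\<Sum>b\<in>F. a b *\<^sub>R b) \<le> N + \<bar>a v\<bar> * norm v"
        using norm_triangle_ineq4[of "a v *\<^sub>R v + (\<Sum>b\<in>F. a b *\<^sub>R b)" "a v *\<^sub>R v"] by (simp add: N)
      also have "\<dots> \<le> N + N / \<delta> * norm v" using av' by (intro add_left_mono mult_right_mono) auto
      finally have n: "norm (\<Sum>b\<in>F. a b *\<^sub>R b) \<le> N + N / \<delta> * norm v" .
      have "\<bar>a b\<bar> \<le> C * norm (\<Sum>b\<in>F. a b *\<^sub>R b)" using C[OF \<open>b \<in> F\<close>] .
      also have "\<dots> \<le> \<bar>C\<bar> * norm (\<Sum>b\<in>F. a b *\<^sub>R b)" by (intro mult_right_mono) auto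
      also have "\<dots> \<le> \<bar>C\<bar> * (N + N / \<delta> * norm v)" using n by (intro mult_left_mono) auto
      also have "\<dots> \<le> C' * N" using \<open>N \<ge> 0\<close> \<delta>(1) by (simp add: C'_def algebra_simps)
      finally show ?thesis by (simp add: N_def)
    qed
  qed
  then show ?case by blast
qed simp

lemma leibniz_sum:
  "leibniz (\<lambda>vs. \<Sum>i\<in>I. c i * \<eta> i vs) ps = (\<Sum>i\<in>I. c i * leibniz (\<eta> i) ps)"
proof (induction ps arbitrary: \<eta>)
  case (Cons p ps)
  then show ?case by (simp add: sum.distrib algebra_simps)
qed simp

text \<open>Linear relations between values of \<open>\<omega>\<close> that hold on a neighbourhood pass to the derivative.\<close>

lemma derivative_alternating:
  fixes \<omega> :: "'a::real_normed_vector \<Rightarrow> 'a list \<Rightarrow> real"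
  assumes "open S" "x \<in> S" and alt: "\<And>y. y \<in> S \<Longrightarrow> alternating (\<omega> y)"
    and deriv: "\<And>vs. ((\<lambda>y. \<omega> y vs) has_derivative (\<lambda>h. \<omega>' h vs)) (at x)"
  shows "alternating (\<omega>' h)"
  unfolding alternating_def
proof (intro conjI allI impI)
  fix vs :: "'a list" and i assume i: "i < length vs"
  have lin: "linear (\<lambda>v. \<omega> y (vs[i := v]))" if "y \<in> S" for y
    using alt[OF that] i by (simp add: alternating_def)
  show "linear (\<lambda>v. \<omega>' h (vs[i := v]))"
  proof (rule linearI)
    fix a b
    have "(\<lambda>h. \<omega>' h (vs[i := a + b])) = (\<lambda>h. \<omega>' h (vs[i := a]) + \<omega>' h (vs[i := b]))"
      by (rule has_derivative_eq_on_open[OF deriv has_derivative_add[OF deriv deriv] assms(1,2)])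
         (rule linear_add[OF lin])
    then show "\<omega>' h (vs[i := a + b]) = \<omega>' h (vs[i := a]) + \<omega>' h (vs[i := b])" by (rule fun_cong)
  next
    fix r b
    have "(\<lambda>h. \<omega>' h (vs[i := r *\<^sub>R b])) = (\<lambda>h. r *\<^sub>R \<omega>' h (vs[i := b]))"
      by (rule has_derivative_eq_on_open[OF deriv has_derivative_scaleR_right[OF deriv] assms(1,2)])
         (rule linear_scale[OF lin])
    then show "\<omega>' h (vs[i := r *\<^sub>R b]) = r *\<^sub>R \<omega>' h (vs[i := b])" by (rule fun_cong)
  qed
next
  fix vs :: "'a list" assume "\<not> distinct vs"
  then have "(\<lambda>h. \<omega>' h vs) = (\<lambda>h. 0)"
    by (intro has_derivative_eq_on_open[OF deriv has_derivative_const[of 0] assms(1,2)])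
       (rule alternating_distinct[OF alt])
  then show "\<omega>' h vs = 0" by (rule fun_cong)
qed

context finite_dim
begin

lemma linear_functional_bounded:
  fixes f :: "'e \<Rightarrow> real"
  assumes "linear f" shows "bounded_linear f"
proof -
  obtain C where C: "\<And>a b. b \<in> B \<Longrightarrow> \<bar>a b\<bar> \<le> C * norm (\<Sum>b\<in>B. a b *\<^sub>R b)"
    using independent_coefficients_bounded[OF finite_B independent_B] by blast
  have "\<bar>f x\<bar> \<le> norm x * (C * (\<Sum>b\<in>B. \<bar>f b\<bar>))" for x
  proof -
    define a where "a = representation B x"
    have x: "(\<Sum>b\<in>B. a b *\<^sub>R b) = x"
      unfolding a_def by (rule sum_representation_eq[OF independent_B]) (simp_all add: span_B finite_B)
    have "f x = (\<Sum>b\<in>B. a b * f b)"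
      by (subst x[symmetric]) (simp add: linear_sum[OF assms] linear_scale[OF assms])
    also have "\<bar>\<dots>\<bar> \<le> (\<Sum>b\<in>B. \<bar>a b\<bar> * \<bar>f b\<bar>)"
      using sum_abs[of "\<lambda>b. a b * f b" B] by (simp add: abs_mult)
    also have "\<dots> \<le> (\<Sum>b\<in>B. (C * norm x) * \<bar>f b\<bar>)"
      using C[of _ a] by (intro sum_mono mult_right_mono) (simp_all add: x)
    finally show ?thesis by (simp add: sum_distrib_left algebra_simps)
  qed
  then show ?thesis
    using assms by (intro bounded_linear_intro[where K="C * (\<Sum>b\<in>B. \<bar>f b\<bar>)"])
      (simp_all add: linear_add linear_scale)
qed

abbreviation coord :: "'e \<Rightarrow> 'e \<Rightarrow> real" where
  "coord b v \<equiv> representation B v b"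

lemma linear_coord: "linear (coord b)"
  by (rule linearI) (simp_all add: representation_add representation_scale independent_B span_B)

lemma bounded_linear_coord: "bounded_linear (coord b)"
  by (intro linear_functional_bounded linear_coord)

lemma coord_expand: "(\<Sum>b\<in>B. coord b v *\<^sub>R b) = v"
  by (rule sum_representation_eq[OF independent_B]) (simp_all add: span_B finite_B)

lemma alternating_expand_Cons:
  assumes "alternating \<eta>"
  shows "\<eta> (v # vs) = (\<Sum>b\<in>B. coord b v * \<eta> (b # vs))"
proof -
  note lin = alternating_linear_Cons[OF assms, of vs]
  have "\<eta> (v # vs) = \<eta> ((\<Sum>b\<in>B. coord b v *\<^sub>R b) # vs)" by (simp only: coord_expand)
  also have "\<dots> = (\<Sum>b\<in>B. coord b v * \<eta> (b # vs))"
    by (simp add: linear_sum[OF lin] linear_scale[OF lin])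
  finally show ?thesis .
qed

lemma second_derivative_symmetric_vector:
  fixes f :: "'a::real_normed_vector \<Rightarrow> 'e"
  assumes "open S" "x \<in> S" and f': "\<And>y. y \<in> S \<Longrightarrow> (f has_derivative f' y) (at y)"
    and H: "((\<lambda>y. f' y u) has_derivative H) (at x)" and K: "((\<lambda>y. f' y v) has_derivative K) (at x)"
  shows "H v = K u"
proof -
  have "coord b (H v) = coord b (K u)" for b
    using second_derivative_symmetric[OF assms(1,2)
        bounded_linear.has_derivative[OF bounded_linear_coord f']
        bounded_linear.has_derivative[OF bounded_linear_coord H]
        bounded_linear.has_derivative[OF bounded_linear_coord K]] .
  then have "(\<Sum>b\<in>B. coord b (H v) *\<^sub>R b) = (\<Sum>b\<in>B. coord b (K u) *\<^sub>R b)" by simp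
  then show ?thesis by (simp only: coord_expand)
qed

text \<open>The product rule for a form evaluated along the map \<open>\<tau>\<close> at varying vectors, the entries \<open>(f, f')\<close> of \<open>ps\<close> being
  these vectors and their derivatives. Only the derivatives of \<open>\<omega>\<close> at fixed vectors are given; they suffice
  because each varying vector can be expanded in the basis, one argument after the other, into constant
  vectors with varying scalar coefficients.\<close>

lemma has_derivative_alternating:
  fixes \<omega> :: "'e \<Rightarrow> 'e list \<Rightarrow> real"
  assumes \<tau>: "(\<tau> has_derivative T) (at x)" and "open S" "\<tau> x \<in> S"
    and "\<And>y. y \<in> S \<Longrightarrow> alternating (\<omega> y)"
    and "\<And>vs. ((\<lambda>y. \<omega> y vs) has_derivative (\<lambda>h. \<omega>' h vs)) (at (\<tau> x))"
    and "\<And>p. p \<in> set ps \<Longrightarrow> (fst p has_derivative snd p) (at x)"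
  shows "((\<lambda>y. \<omega> (\<tau> y) (map (\<lambda>p. fst p y) ps)) has_derivative
          (\<lambda>h. \<omega>' (T h) (map (\<lambda>p. fst p x) ps) +
               leibniz (\<omega> (\<tau> x)) (map (\<lambda>p. (fst p x, snd p h)) ps))) (at x)"
  using assms(4-6)
proof (induction ps arbitrary: \<omega> \<omega>')
  case Nil
  then show ?case using has_derivative_compose[OF \<tau> Nil.prems(2)[of "[]"]] by simp
next
  case (Cons p ps)
  note alt = Cons.prems(1) and \<omega>' = Cons.prems(2)
  have p: "(fst p has_derivative snd p) (at x)" using Cons.prems(3) by simp
  define X where "X = map (\<lambda>p. fst p x) ps"
  define L where "L = (\<lambda>h. map (\<lambda>p. (fst p x, snd p h)) ps)"
  have IH: "((\<lambda>y. \<omega> (\<tau> y) (b # map (\<lambda>p. fst p y) ps)) has_derivative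
          (\<lambda>h. \<omega>' (T h) (b # X) + leibniz (\<lambda>vs. \<omega> (\<tau> x) (b # vs)) (L h))) (at x)" for b
    unfolding X_def L_def
    using Cons.IH[of "\<lambda>y vs. \<omega> y (b # vs)" "\<lambda>h vs. \<omega>' h (b # vs)"] \<omega>' Cons.prems(3)
    by (simp add: alternating_Cons alt)
  have "((\<lambda>y. \<Sum>b\<in>B. coord b (fst p y) * \<omega> (\<tau> y) (b # map (\<lambda>p. fst p y) ps)) has_derivative
      (\<lambda>h. \<Sum>b\<in>B. coord b (fst p x) * (\<omega>' (T h) (b # X) + leibniz (\<lambda>vs. \<omega> (\<tau> x) (b # vs)) (L h))
                 + coord b (snd p h) * \<omega> (\<tau> x) (b # X))) (at x)"
    unfolding X_def
    by (intro has_derivative_sum has_derivative_mult IH[unfolded X_def]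
        bounded_linear.has_derivative[OF bounded_linear_coord p])
  moreover have "(\<Sum>b\<in>B. coord b (fst p x) * (\<omega>' (T h) (b # X) + leibniz (\<lambda>vs. \<omega> (\<tau> x) (b # vs)) (L h))
                 + coord b (snd p h) * \<omega> (\<tau> x) (b # X))
      = \<omega>' (T h) (fst p x # X) + (\<omega> (\<tau> x) (snd p h # X) + leibniz (\<lambda>vs. \<omega> (\<tau> x) (fst p x # vs)) (L h))" for h
  proof -
    have alt': "alternating (\<omega>' (T h))"
      by (rule derivative_alternating[OF assms(2,3) alt \<omega>'])
    have "leibniz (\<lambda>vs. \<omega> (\<tau> x) (fst p x # vs)) (L h) =
          (\<Sum>b\<in>B. coord b (fst p x) * leibniz (\<lambda>vs. \<omega> (\<tau> x) (b # vs)) (L h))"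
      by (subst leibniz_sum[symmetric], subst alternating_expand_Cons[OF alt[OF assms(3)]], rule refl)
    then show ?thesis
      by (simp add: alternating_expand_Cons[OF alt', of "fst p x"]
           alternating_expand_Cons[OF alt[OF assms(3)], of "snd p h"] sum.distrib algebra_simps)
  qed
  ultimately have D: "((\<lambda>y. \<Sum>b\<in>B. coord b (fst p y) * \<omega> (\<tau> y) (b # map (\<lambda>p. fst p y) ps)) has_derivative
      (\<lambda>h. \<omega>' (T h) (fst p x # X) + (\<omega> (\<tau> x) (snd p h # X) + leibniz (\<lambda>vs. \<omega> (\<tau> x) (fst p x # vs)) (L h)))) (at x)"
    by simp
  have "eventually (\<lambda>y. \<tau> y \<in> S) (nhds x)"
    using has_derivative_continuous[OF \<tau>] assms(2,3)
    by (simp add: continuous_at topological_tendstoD tendsto_nhds_iff)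
  then obtain N where N: "open N" "x \<in> N" "\<And>y. y \<in> N \<Longrightarrow> \<tau> y \<in> S"
    by (auto simp: eventually_nhds)
  have "((\<lambda>y. \<omega> (\<tau> y) (fst p y # map (\<lambda>p. fst p y) ps)) has_derivative
      (\<lambda>h. \<omega>' (T h) (fst p x # X) + (\<omega> (\<tau> x) (snd p h # X) + leibniz (\<lambda>vs. \<omega> (\<tau> x) (fst p x # vs)) (L h)))) (at x)"
    by (rule has_derivative_transform_within_open[OF D N(1,2)])
       (rule alternating_expand_Cons[OF alt[OF N(3)], symmetric])
  then show ?case by (simp add: X_def L_def comp_def)
qed

end

section \<open>Cartan calculus in a chart\<close>

lemma frechet_derivative_eq:
  "(f has_derivative f') (at x) \<Longrightarrow> frechet_derivative f (at x) = f'"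
  using frechet_derivative_at by metis

lemma alt_sum_map:
  "alt_sum (\<lambda>u us. \<phi> (t u) (map t us)) vs = alt_sum \<phi> (map t vs)"
proof (induction vs arbitrary: \<phi>)
  case (Cons a vs)
  show ?case using Cons.IH[of "\<lambda>u us. \<phi> u (t a # us)"] by simp
qed simp

lemma has_derivative_alt_sum:
  fixes \<phi> :: "'a::real_normed_vector \<Rightarrow> 'b \<Rightarrow> 'b list \<Rightarrow> real"
  assumes "\<And>u us. ((\<lambda>y. \<phi> y u us) has_derivative (\<lambda>h. \<phi>' h u us)) F"
  shows "((\<lambda>y. alt_sum (\<phi> y) vs) has_derivative (\<lambda>h. alt_sum (\<phi>' h) vs)) F"
  using assms
proof (induction vs arbitrary: \<phi> \<phi>')
  case (Cons a vs)
  then show ?case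
    using Cons.IH[of "\<lambda>y u us. \<phi> y u (a # us)" "\<lambda>h u us. \<phi>' h u (a # us)"]
    by (simp add: has_derivative_diff)
qed simp

lemma smooth_on_alt_sum:
  assumes "open S" "\<And>u us. smooth_on S (\<lambda>x. \<phi> x u us)"
  shows "smooth_on S (\<lambda>x. alt_sum (\<phi> x) vs)"
  using assms(2)
proof (induction vs arbitrary: \<phi>)
  case (Cons a vs)
  then show ?case
    using Cons.IH[of "\<lambda>y u us. \<phi> y u (a # us)"] by (simp add: smooth_on_diff assms(1))
qed simp

definition local_forms :: "'e::real_normed_vector set \<Rightarrow> nat \<Rightarrow> ('e \<Rightarrow> 'e list \<Rightarrow> real) set" where
  "local_forms S k = {\<omega>. (\<forall>x\<in>S. \<omega> x \<in> alt_forms k) \<and> (\<forall>vs. smooth_on S (\<lambda>x. \<omega> x vs))}"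

definition local_mvfs ::
    "'e::real_normed_vector set \<Rightarrow> nat \<Rightarrow> ('e \<Rightarrow> ('e list \<Rightarrow> real) \<Rightarrow> real) set" where
  "local_mvfs S p = {U. (\<forall>x\<in>S. U x \<in> multivectors p) \<and>
                         (\<forall>\<eta>\<in>alt_forms p. smooth_on S (\<lambda>x. U x \<eta>))}"

definition dir_deriv ::
    "('e::real_normed_vector \<Rightarrow> 'e list \<Rightarrow> real) \<Rightarrow> 'e \<Rightarrow> 'e \<Rightarrow> 'e list \<Rightarrow> real" where
  "dir_deriv \<omega> x v us = frechet_derivative (\<lambda>y. \<omega> y us) (at x) v"

definition local_d ::
    "('e::real_normed_vector \<Rightarrow> 'e list \<Rightarrow> real) \<Rightarrow> 'e \<Rightarrow> 'e list \<Rightarrow> real" where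
  "local_d \<omega> x = alt_sum (dir_deriv \<omega> x)"

definition local_contract ::
    "('e \<Rightarrow> ('e list \<Rightarrow> real) \<Rightarrow> real) \<Rightarrow> ('e \<Rightarrow> 'e list \<Rightarrow> real) \<Rightarrow> 'e \<Rightarrow> 'e list \<Rightarrow> real" where
  "local_contract U \<omega> x ws = U x (\<lambda>vs. \<omega> x (vs @ ws))"

definition local_lie ::
    "nat \<Rightarrow> ('e::real_normed_vector \<Rightarrow> ('e list \<Rightarrow> real) \<Rightarrow> real) \<Rightarrow>
     ('e \<Rightarrow> 'e list \<Rightarrow> real) \<Rightarrow> 'e \<Rightarrow> 'e list \<Rightarrow> real" where
  "local_lie p U \<omega> x ws =
     local_d (local_contract U \<omega>) x ws - (-1) ^ p * local_contract U (local_d \<omega>) x ws"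

definition local_bracket ::
    "nat \<Rightarrow> nat \<Rightarrow> ('e::real_normed_vector \<Rightarrow> ('e list \<Rightarrow> real) \<Rightarrow> real) \<Rightarrow>
     ('e \<Rightarrow> ('e list \<Rightarrow> real) \<Rightarrow> real) \<Rightarrow> ('e \<Rightarrow> 'e list \<Rightarrow> real) \<Rightarrow> 'e \<Rightarrow> 'e list \<Rightarrow> real" where
  "local_bracket p q U V \<omega> x ws =
     (-1) ^ ((p - 1) * q) * local_lie p U (local_contract V \<omega>) x ws
     - local_contract V (local_lie p U \<omega>) x ws"

lemma local_formsD:
  assumes "\<omega> \<in> local_forms S k" "x \<in> S"
  shows "\<omega> x \<in> alt_forms k" "(\<lambda>y. \<omega> y vs) differentiable (at x)" "smooth_on S (\<lambda>x. \<omega> x vs)"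
  using assms by (auto simp: local_forms_def intro: smooth_on_differentiable[of S])

lemma local_mvfsD:
  assumes "U \<in> local_mvfs S p" "x \<in> S"
  shows "U x \<in> multivectors p"
    "\<eta> \<in> alt_forms p \<Longrightarrow> (\<lambda>y. U y \<eta>) differentiable (at x)"
    "\<eta> \<in> alt_forms p \<Longrightarrow> smooth_on S (\<lambda>x. U x \<eta>)"
  using assms by (auto simp: local_mvfs_def intro: smooth_on_differentiable[of S])

lemma dir_deriv_works:
  assumes "\<And>vs. (\<lambda>y. \<omega> y vs) differentiable (at x)"
  shows "((\<lambda>y. \<omega> y vs) has_derivative (\<lambda>h. dir_deriv \<omega> x h vs)) (at x)"
  unfolding dir_deriv_def using assms frechet_derivative_works by blast

lemma dir_deriv_eq:
  assumes "\<And>vs. ((\<lambda>y. \<omega> y vs) has_derivative (\<lambda>h. \<omega>' h vs)) (at x)"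
  shows "dir_deriv \<omega> x = \<omega>'"
  unfolding dir_deriv_def by (intro ext) (simp add: frechet_derivative_eq[OF assms])

lemma dir_deriv_alt_forms:
  assumes "open S" "x \<in> S" "\<And>y. y \<in> S \<Longrightarrow> \<omega> y \<in> alt_forms k"
    and d: "\<And>vs. (\<lambda>y. \<omega> y vs) differentiable (at x)"
  shows "dir_deriv \<omega> x v \<in> alt_forms k"
proof -
  have "alternating (dir_deriv \<omega> x v)"
    by (rule derivative_alternating[OF assms(1,2) _ dir_deriv_works[OF d]])
       (use assms(3) in \<open>simp add: alt_forms_iff\<close>)
  moreover have "dir_deriv \<omega> x v vs = 0" if "length vs \<noteq> k" for vs
  proof -
    have "(\<lambda>h. dir_deriv \<omega> x h vs) = (\<lambda>h. 0)"
      by (rule has_derivative_eq_on_open[OF dir_deriv_works[OF d] has_derivative_const[of 0] assms(1,2)])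
         (use assms(3) that in \<open>simp add: alt_forms_iff\<close>)
    then show ?thesis by (rule fun_cong)
  qed
  ultimately show ?thesis by (simp add: alt_forms_iff)
qed

lemma linear_dir_deriv:
  assumes "\<And>vs. (\<lambda>y. \<omega> y vs) differentiable (at x)"
  shows "linear (\<lambda>v. dir_deriv \<omega> x v us)"
  unfolding dir_deriv_def by (rule linear_frechet_derivative[OF assms])

lemma local_d_cong:
  assumes "open S" "x \<in> S" "\<And>y. y \<in> S \<Longrightarrow> \<omega> y = \<zeta> y"
    and "\<And>vs. (\<lambda>y. \<zeta> y vs) differentiable (at x)"
  shows "local_d \<omega> x = local_d \<zeta> x"
proof -
  have "((\<lambda>y. \<omega> y vs) has_derivative (\<lambda>h. dir_deriv \<zeta> x h vs)) (at x)" for vs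
    by (rule has_derivative_transform_within_open[OF dir_deriv_works[OF assms(4)] assms(1,2)])
       (simp add: assms(3))
  from dir_deriv_eq[OF this] show ?thesis by (simp add: local_d_def)
qed

lemma local_d_alt_forms:
  assumes "open S" "x \<in> S" "\<And>y. y \<in> S \<Longrightarrow> \<omega> y \<in> alt_forms k"
    and "\<And>vs. (\<lambda>y. \<omega> y vs) differentiable (at x)"
  shows "local_d \<omega> x \<in> alt_forms (Suc k)"
proof -
  note D = dir_deriv_alt_forms[OF assms]
  have "alternating (local_d \<omega> x)"
    unfolding local_d_def using D
    by (intro alternating_alt_sum linear_dir_deriv assms) (simp add: alt_forms_iff)
  moreover have "local_d \<omega> x vs = 0" if "length vs \<noteq> Suc k" for vs
  proof -
    have "alt_sum (dir_deriv \<omega> x) vs = alt_sum (\<lambda>u us. 0) vs"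
      using D that by (intro alt_sum_cong) (auto simp: alt_forms_iff)
    then show ?thesis by (simp add: local_d_def)
  qed
  ultimately show ?thesis by (simp add: alt_forms_iff)
qed

lemma local_d_forms:
  assumes "open S" "\<omega> \<in> local_forms S k"
  shows "local_d \<omega> \<in> local_forms S (Suc k)"
  unfolding local_forms_def
proof (intro CollectI conjI allI ballI)
  fix x assume "x \<in> S"
  then show "local_d \<omega> x \<in> alt_forms (Suc k)"
    by (intro local_d_alt_forms[OF assms(1)]) (use assms(2) local_formsD in auto)
next
  fix vs show "smooth_on S (\<lambda>x. local_d \<omega> x vs)"
    unfolding local_d_def dir_deriv_def using assms
    by (intro smooth_on_alt_sum smooth_on_derivative) (simp_all add: local_forms_def)
qed

text \<open>The second derivatives of the components are symmetric, so \<open>alt_sum_symmetric\<close> applies.\<close>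

lemma local_d_local_d:
  assumes "open S" "\<omega> \<in> local_forms S k" "x \<in> S"
  shows "local_d (local_d \<omega>) x = (\<lambda>vs. 0)"
proof
  fix vs
  define h where "h = (\<lambda>v u us. frechet_derivative (\<lambda>y. frechet_derivative (\<lambda>z. \<omega> z us) (at y) u) (at x) v)"
  have sm: "smooth_on S (\<lambda>y. \<omega> y us)" for us
    using assms(2) by (simp add: local_forms_def)
  have sm': "smooth_on S (\<lambda>y. dir_deriv \<omega> y u us)" for u us
    unfolding dir_deriv_def by (intro smooth_on_derivative sm)
  have hd: "((\<lambda>y. dir_deriv \<omega> y u us) has_derivative (\<lambda>v. h v u us)) (at x)" for u us
    using smooth_on_has_derivative[OF sm' \<open>x \<in> S\<close>] by (simp add: h_def dir_deriv_def)
  have "dir_deriv (local_d \<omega>) x = (\<lambda>v us. alt_sum (h v) us)"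
    unfolding local_d_def by (intro dir_deriv_eq has_derivative_alt_sum hd)
  moreover have "h u v us = h v u us" for u v us
    using second_derivative_symmetric[OF assms(1,3) smooth_on_has_derivative[OF sm]
        hd[unfolded dir_deriv_def] hd[unfolded dir_deriv_def]] .
  ultimately show "local_d (local_d \<omega>) x vs = 0"
    unfolding local_d_def[of "local_d \<omega>"] by (simp add: alt_sum_symmetric)
qed

context finite_dim
begin

lemma frame_contract_add: "frame_contract p u (\<lambda>ws. \<eta> ws + \<zeta> ws) = (\<lambda>ws. frame_contract p u \<eta> ws + frame_contract p u \<zeta> ws)"
  by (simp add: fun_eq_iff frame_contract_def sum.distrib algebra_simps)

lemma frame_contract_cmult: "frame_contract p u (\<lambda>ws. c * \<eta> ws) ws = c * frame_contract p u \<eta> ws"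
  by (simp add: frame_contract_def sum_distrib_left algebra_simps)

lemma frame_contract_linear:
  "frame_contract p u (\<lambda>ws. \<eta> ws + c * \<zeta> ws) = (\<lambda>ws. frame_contract p u \<eta> ws + c * frame_contract p u \<zeta> ws)"
  by (simp add: fun_eq_iff frame_contract_add frame_contract_cmult)

lemma frame_contract_append: "frame_contract p u (\<lambda>vs. \<eta> (vs @ ws)) us = frame_contract p u \<eta> (us @ ws)"
  by (simp add: frame_contract_def)

lemma frame_contract_degree:
  assumes "\<eta> \<in> alt_forms k" "p + length ws \<noteq> k" shows "frame_contract p u \<eta> ws = 0"
  unfolding frame_contract_def using assms
  by (intro sum.neutral) (auto simp: alt_forms_iff length_basis_lists)

text \<open>The part of the contraction with \<open>alt_sum \<phi>\<close> in which the vector \<open>v\<close> of \<open>\<phi> v\<close> is one of the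
  contracted ones. For \<open>\<phi> v = \<lambda> v \<cdot> \<eta>\<close> with a covector \<open>\<lambda>\<close> this is, up to sign,
  contraction of \<open>\<eta>\<close> with the interior product of \<open>\<lambda>\<close> and the multivector.\<close>

definition insertion ::
    "nat \<Rightarrow> ('e list \<Rightarrow> real) \<Rightarrow> ('e \<Rightarrow> 'e list \<Rightarrow> real) \<Rightarrow> 'e list \<Rightarrow> real" where
  "insertion p u \<phi> ws = (\<Sum>bs\<in>basis_lists p. u bs * alt_sum (\<lambda>v vs. \<phi> v (vs @ ws)) bs)"

lemma insertion_add:
  "insertion p u (\<lambda>v vs. \<phi> v vs + \<psi> v vs) ws = insertion p u \<phi> ws + insertion p u \<psi> ws"
  by (simp add: insertion_def alt_sum_add sum.distrib algebra_simps)

lemma insertion_cmult: "insertion p u (\<lambda>v vs. c * \<phi> v vs) ws = c * insertion p u \<phi> ws"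
  by (simp add: insertion_def alt_sum_cmult sum_distrib_left algebra_simps)

text \<open>The commutator of a contraction with antisymmetrisation: the vector removed by the alternating sum is
  either contracted or one of the remaining arguments.\<close>

lemma frame_contract_alt_sum:
  "frame_contract p u (alt_sum \<phi>) ws = insertion p u \<phi> ws + (-1) ^ p * alt_sum (\<lambda>v. frame_contract p u (\<phi> v)) ws"
proof -
  have "frame_contract p u (alt_sum \<phi>) ws = (\<Sum>bs\<in>basis_lists p. u bs * alt_sum (\<lambda>v vs. \<phi> v (vs @ ws)) bs +
          (-1) ^ p * (u bs * alt_sum (\<lambda>v vs. \<phi> v (bs @ vs)) ws))"
    unfolding frame_contract_def
    by (intro sum.cong refl) (simp add: alt_sum_append length_basis_lists algebra_simps)
  also have "\<dots> = insertion p u \<phi> ws +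
      (-1) ^ p * (\<Sum>bs\<in>basis_lists p. alt_sum (\<lambda>v vs. u bs * \<phi> v (bs @ vs)) ws)"
    by (simp add: sum.distrib insertion_def sum_distrib_left alt_sum_cmult)
  finally show ?thesis by (simp add: alt_sum_sum frame_contract_def[abs_def])
qed

text \<open>The exponent is \<open>p - 1\<close> and not \<open>p\<close> because an insertion fills only \<open>p - 1\<close> of the slots with contracted
  vectors; the \<open>q\<close> further ones are moved past these.\<close>

lemma frame_contract_insertion:
  assumes "\<And>v. alternating (\<phi> v)"
  shows "frame_contract q w (insertion p u \<phi>) ws = (-1) ^ ((p - 1) * q) * insertion p u (\<lambda>v. frame_contract q w (\<phi> v)) ws"
proof -
  have "frame_contract q w (insertion p u \<phi>) ws =
      (\<Sum>cs\<in>basis_lists q. \<Sum>bs\<in>basis_lists p. w cs * (u bs * alt_sum (\<lambda>v vs. \<phi> v (vs @ cs @ ws)) bs))"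
    by (simp add: frame_contract_def insertion_def sum_distrib_left)
  also have "\<dots> = (\<Sum>bs\<in>basis_lists p. \<Sum>cs\<in>basis_lists q.
                    w cs * (u bs * alt_sum (\<lambda>v vs. \<phi> v (vs @ cs @ ws)) bs))"
    by (rule sum.swap)
  also have "\<dots> = (\<Sum>bs\<in>basis_lists p. \<Sum>cs\<in>basis_lists q.
                (-1) ^ ((p - 1) * q) * (u bs * alt_sum (\<lambda>v vs. w cs * \<phi> v (cs @ vs @ ws)) bs))"
  proof (intro sum.cong refl)
    fix bs cs assume bs: "bs \<in> basis_lists p" and cs: "cs \<in> basis_lists q"
    have "alt_sum (\<lambda>v vs. \<phi> v (vs @ cs @ ws)) bs =
          alt_sum (\<lambda>v vs. (-1) ^ ((p - 1) * q) * \<phi> v (cs @ vs @ ws)) bs"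
    proof (rule alt_sum_cong)
      fix v and vs :: "'e list" assume "Suc (length vs) = length bs"
      then have "length vs = p - 1" "length cs = q"
        using bs cs length_basis_lists by fastforce+
      then show "\<phi> v (vs @ cs @ ws) = (-1) ^ ((p - 1) * q) * \<phi> v (cs @ vs @ ws)"
        using alternating_block_swap[OF assms, of v vs cs ws] by simp
    qed
    then show "w cs * (u bs * alt_sum (\<lambda>v vs. \<phi> v (vs @ cs @ ws)) bs) =
        (-1) ^ ((p - 1) * q) * (u bs * alt_sum (\<lambda>v vs. w cs * \<phi> v (cs @ vs @ ws)) bs)"
      by (simp add: alt_sum_cmult)
  qed
  also have "\<dots> = (-1) ^ ((p - 1) * q) * insertion p u (\<lambda>v. frame_contract q w (\<phi> v)) ws"
    by (simp add: insertion_def frame_contract_def alt_sum_sum sum_distrib_left)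
  finally show ?thesis .
qed

definition coeff_deriv ::
    "nat \<Rightarrow> ('e \<Rightarrow> ('e list \<Rightarrow> real) \<Rightarrow> real) \<Rightarrow> 'e \<Rightarrow> 'e \<Rightarrow> 'e list \<Rightarrow> real" where
  "coeff_deriv p U x v bs = frechet_derivative (\<lambda>y. U y (dual_form p bs)) (at x) v"

lemma local_contract_eq_frame:
  fixes U :: "'e \<Rightarrow> ('e list \<Rightarrow> real) \<Rightarrow> real"
  assumes "U x \<in> multivectors p" "\<omega> x \<in> alt_forms k"
  shows "local_contract U \<omega> x = frame_contract p (coeff p (U x)) (\<omega> x)"
  unfolding local_contract_def by (intro ext contract_eq_frame[OF assms])

lemma local_contract_alt_forms:
  fixes U :: "'e \<Rightarrow> ('e list \<Rightarrow> real) \<Rightarrow> real"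
  assumes "U x \<in> multivectors p" "\<omega> x \<in> alt_forms k"
  shows "local_contract U \<omega> x \<in> alt_forms (k - p)"
  unfolding local_contract_eq_frame[of U x p \<omega> k, OF assms]
  using frame_contract_alt_forms[OF assms(2)] frame_contract_high_degree[OF assms(2)] by (cases "p \<le> k") auto

lemma local_contract_has_derivative:
  assumes S: "open S" "x \<in> S" and U: "U \<in> local_mvfs S p"
    and \<omega>: "\<And>y. y \<in> S \<Longrightarrow> \<omega> y \<in> alt_forms k"
    and d: "\<And>vs. (\<lambda>y. \<omega> y vs) differentiable (at x)"
  shows "((\<lambda>y. local_contract U \<omega> y ws) has_derivative
          (\<lambda>v. frame_contract p (coeff_deriv p U x v) (\<omega> x) ws + frame_contract p (coeff p (U x)) (dir_deriv \<omega> x v) ws)) (at x)"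
proof -
  have U': "((\<lambda>y. coeff p (U y) bs) has_derivative (\<lambda>v. coeff_deriv p U x v bs)) (at x)" for bs
    unfolding coeff_def coeff_deriv_def
    using local_mvfsD(2)[OF U S(2) dual_form_alt] frechet_derivative_works by blast
  have "((\<lambda>y. \<Sum>bs\<in>basis_lists p. coeff p (U y) bs * \<omega> y (bs @ ws)) has_derivative
        (\<lambda>v. \<Sum>bs\<in>basis_lists p. coeff p (U x) bs * dir_deriv \<omega> x v (bs @ ws) +
                                  coeff_deriv p U x v bs * \<omega> x (bs @ ws))) (at x)"
    by (intro has_derivative_sum has_derivative_mult U' dir_deriv_works d)
  then have "((\<lambda>y. frame_contract p (coeff p (U y)) (\<omega> y) ws) has_derivative
          (\<lambda>v. frame_contract p (coeff_deriv p U x v) (\<omega> x) ws + frame_contract p (coeff p (U x)) (dir_deriv \<omega> x v) ws)) (at x)"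
    by (simp add: frame_contract_def sum.distrib add.commute)
  then show ?thesis
    by (rule has_derivative_transform_within_open[OF _ S])
       (simp add: local_contract_eq_frame[OF local_mvfsD(1)[OF U] \<omega>])
qed

lemma local_contract_forms:
  fixes U :: "'e \<Rightarrow> ('e list \<Rightarrow> real) \<Rightarrow> real"
  assumes "open S" and U: "U \<in> local_mvfs S p" and \<omega>: "\<omega> \<in> local_forms S k"
  shows "local_contract U \<omega> \<in> local_forms S (k - p)"
  unfolding local_forms_def
proof (intro CollectI conjI allI ballI)
  fix x assume "x \<in> S"
  then show "local_contract U \<omega> x \<in> alt_forms (k - p)"
    by (intro local_contract_alt_forms local_mvfsD(1)[OF U] local_formsD(1)[OF \<omega>])
next
  fix ws
  have "smooth_on S (\<lambda>x. \<Sum>bs\<in>basis_lists p. coeff p (U x) bs * \<omega> x (bs @ ws))"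
    unfolding coeff_def using U \<omega>
    by (intro smooth_on_sum smooth_on_mult assms(1)) (simp_all add: local_mvfs_def local_forms_def)
  then show "smooth_on S (\<lambda>x. local_contract U \<omega> x ws)"
    by (rule smooth_on_cong[OF assms(1), rotated])
       (simp add: frame_contract_def local_contract_eq_frame[OF local_mvfsD(1)[OF U] local_formsD(1)[OF \<omega>]])
qed

lemma local_contract_commute:
  fixes U V :: "'e \<Rightarrow> ('e list \<Rightarrow> real) \<Rightarrow> real"
  assumes "U x \<in> multivectors p" "V x \<in> multivectors q" "\<omega> x \<in> alt_forms k"
  shows "local_contract U (local_contract V \<omega>) x ws =
         (-1) ^ (p * q) * local_contract V (local_contract U \<omega>) x ws"
proof -
  note U = assms(1) and V = assms(2) and \<omega> = assms(3)
  note altU = local_contract_alt_forms[of U x p \<omega> k, OF U \<omega>]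
  note altV = local_contract_alt_forms[of V x q \<omega> k, OF V \<omega>]
  show ?thesis
    using frame_contract_commute[of "\<omega> x" p "coeff p (U x)" q "coeff q (V x)" ws] \<omega>
    by (simp add: alt_forms_iff local_contract_eq_frame[of U x p \<omega>, OF U \<omega>]
        local_contract_eq_frame[of V x q \<omega>, OF V \<omega>]
        local_contract_eq_frame[of U x p "local_contract V \<omega>", OF U altV]
        local_contract_eq_frame[of V x q "local_contract U \<omega>", OF V altU])
qed

text \<open>The value at \<open>x\<close> of the Schouten bracket as a contraction operator on \<open>\<eta>\<close>. In coordinates it is, up
  to signs, \<open>\<Sum>\<^sub>j (e\<^sup>j \<lrcorner> U) \<and> \<partial>\<^sub>j V\<close> and the same with \<open>U\<close> and \<open>V\<close> interchanged.\<close>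

definition bracket_symbol ::
    "nat \<Rightarrow> nat \<Rightarrow> ('e \<Rightarrow> ('e list \<Rightarrow> real) \<Rightarrow> real) \<Rightarrow> ('e \<Rightarrow> ('e list \<Rightarrow> real) \<Rightarrow> real) \<Rightarrow> 'e \<Rightarrow>
     ('e list \<Rightarrow> real) \<Rightarrow> 'e list \<Rightarrow> real" where
  "bracket_symbol p q U V x \<eta> ws =
     - ((-1) ^ ((p - 1) * q + p) * insertion p (coeff p (U x)) (\<lambda>v. frame_contract q (coeff_deriv q V x v) \<eta>) ws)
     - insertion q (coeff q (V x)) (\<lambda>v. frame_contract p (coeff_deriv p U x v) \<eta>) ws"

text \<open>The property that distinguishes contraction operators: they do not touch the remaining arguments.\<close>

lemma bracket_symbol_append:
  "bracket_symbol p q U V x \<eta> ws = bracket_symbol p q U V x (\<lambda>vs. \<eta> (vs @ ws)) []"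
  by (simp add: bracket_symbol_def insertion_def frame_contract_append)

lemma bracket_symbol_lincomb:
  "bracket_symbol p q U V x (\<lambda>vs. \<eta> vs + c * \<zeta> vs) ws =
   bracket_symbol p q U V x \<eta> ws + c * bracket_symbol p q U V x \<zeta> ws"
  by (simp add: bracket_symbol_def frame_contract_linear insertion_add insertion_cmult algebra_simps)

lemma insertion_degree:
  assumes "\<eta> \<in> alt_forms k" "q + (p - 1) + length ws \<noteq> k"
  shows "insertion p u (\<lambda>v. frame_contract q (w v) \<eta>) ws = 0"
proof -
  have "alt_sum (\<lambda>v vs. frame_contract q (w v) \<eta> (vs @ ws)) bs = 0" if "bs \<in> basis_lists p" for bs
  proof -
    have "alt_sum (\<lambda>v vs. frame_contract q (w v) \<eta> (vs @ ws)) bs = alt_sum (\<lambda>v vs. 0) bs"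
    proof (rule alt_sum_cong)
      fix v and vs :: "'e list" assume "Suc (length vs) = length bs"
      then have "length vs = p - 1" using that length_basis_lists by fastforce
      then show "frame_contract q (w v) \<eta> (vs @ ws) = 0"
        unfolding frame_contract_def using assms
        by (intro sum.neutral) (auto simp: alt_forms_iff length_basis_lists)
    qed
    then show ?thesis by simp
  qed
  then show ?thesis by (simp add: insertion_def)
qed

lemma insertion_zero: "insertion 0 u \<phi> ws = 0"
  unfolding insertion_def by (intro sum.neutral) (auto simp: basis_lists_def)

lemma bracket_symbol_degree:
  assumes "\<eta> \<in> alt_forms k" "p + q - 1 + length ws \<noteq> k" "1 \<le> p"
  shows "bracket_symbol p q U V x \<eta> ws = 0"
proof -
  have "insertion q (coeff q (V x)) (\<lambda>v. frame_contract p (coeff_deriv p U x v) \<eta>) ws = 0"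
    using assms insertion_zero by (cases q) (auto intro!: insertion_degree)
  moreover have "insertion p (coeff p (U x)) (\<lambda>v. frame_contract q (coeff_deriv q V x v) \<eta>) ws = 0"
    using assms by (intro insertion_degree) auto
  ultimately show ?thesis by (simp add: bracket_symbol_def)
qed

lemma local_lie_alt_forms:
  fixes U :: "'e \<Rightarrow> ('e list \<Rightarrow> real) \<Rightarrow> real"
  assumes S: "open S" "x \<in> S" and U: "U \<in> local_mvfs S p"
    and \<omega>: "\<And>y. y \<in> S \<Longrightarrow> \<omega> y \<in> alt_forms k"
    and d: "\<And>vs. (\<lambda>y. \<omega> y vs) differentiable (at x)"
  shows "local_lie p U \<omega> x \<in> alt_forms (Suc k - p)"
proof -
  note mU = local_mvfsD(1)[OF U]
  note deriv = local_contract_has_derivative[OF S U \<omega> d]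
  have dU: "(\<lambda>y. local_contract U \<omega> y ws) differentiable (at x)" for ws
    using deriv unfolding differentiable_def by blast
  have l: "local_lie p U \<omega> x = (\<lambda>ws. local_d (local_contract U \<omega>) x ws
              + (- ((-1) ^ p)) * local_contract U (local_d \<omega>) x ws)"
    by (simp add: local_lie_def fun_eq_iff)
  have "local_d (local_contract U \<omega>) x \<in> alt_forms (Suc k - p)"
  proof (cases "p \<le> k")
    case True
    then show ?thesis
      using local_d_alt_forms[OF S local_contract_alt_forms[of U _ p \<omega>, OF mU \<omega>] dU]
      by (simp add: Suc_diff_le)
  next
    case False
    then have "frame_contract p c (\<omega> x) = (\<lambda>ws. 0)" "frame_contract p c (dir_deriv \<omega> x v) = (\<lambda>ws. 0)" for c v
      using frame_contract_high_degree[OF \<omega>[OF S(2)]] frame_contract_high_degree[OF dir_deriv_alt_forms[OF S \<omega> d]]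
      by simp_all
    then have "local_d (local_contract U \<omega>) x = (\<lambda>ws. 0)"
      by (simp add: local_d_def dir_deriv_eq[OF deriv] fun_eq_iff)
    then show ?thesis by simp
  qed
  moreover have "local_contract U (local_d \<omega>) x \<in> alt_forms (Suc k - p)"
    by (rule local_contract_alt_forms[of U x p "local_d \<omega>", OF mU[OF S(2)] local_d_alt_forms[OF S \<omega> d]])
  ultimately show ?thesis unfolding l by (rule alt_forms_lincomb)
qed

lemma local_lie_forms:
  fixes U :: "'e \<Rightarrow> ('e list \<Rightarrow> real) \<Rightarrow> real"
  assumes "open S" and U: "U \<in> local_mvfs S p" and \<omega>: "\<omega> \<in> local_forms S k"
  shows "local_lie p U \<omega> \<in> local_forms S (Suc k - p)"
  unfolding local_forms_def
proof (intro CollectI conjI allI ballI)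
  fix x assume x: "x \<in> S"
  show "local_lie p U \<omega> x \<in> alt_forms (Suc k - p)"
    by (rule local_lie_alt_forms[OF assms(1) x U local_formsD(1)[OF \<omega>] local_formsD(2)[OF \<omega> x]])
next
  fix vs
  have "smooth_on S (\<lambda>x. local_d (local_contract U \<omega>) x vs)"
    using local_d_forms[OF assms(1) local_contract_forms[OF assms]] by (simp add: local_forms_def)
  moreover have "smooth_on S (\<lambda>x. local_contract U (local_d \<omega>) x vs)"
    using local_contract_forms[OF assms(1) U local_d_forms[OF assms(1) \<omega>]] by (simp add: local_forms_def)
  ultimately show "smooth_on S (\<lambda>x. local_lie p U \<omega> x vs)"
    unfolding local_lie_def by (intro smooth_on_diff smooth_on_mult smooth_on_const assms(1))
qed

lemma local_bracket_smooth:
  fixes U V :: "'e \<Rightarrow> ('e list \<Rightarrow> real) \<Rightarrow> real"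
  assumes "open S" "U \<in> local_mvfs S p" "V \<in> local_mvfs S q" "\<omega> \<in> local_forms S k"
  shows "smooth_on S (\<lambda>x. local_bracket p q U V \<omega> x ws)"
proof -
  have "smooth_on S (\<lambda>x. local_lie p U (local_contract V \<omega>) x ws)"
    using local_lie_forms[OF assms(1,2) local_contract_forms[OF assms(1,3,4)]] by (simp add: local_forms_def)
  moreover have "smooth_on S (\<lambda>x. local_contract V (local_lie p U \<omega>) x ws)"
    using local_contract_forms[OF assms(1,3) local_lie_forms[OF assms(1,2,4)]] by (simp add: local_forms_def)
  ultimately show ?thesis
    unfolding local_bracket_def by (intro smooth_on_diff smooth_on_mult smooth_on_const assms(1))
qed

text \<open>Tensoriality of the bracket. All terms of the product rule that differentiate \<open>\<omega>\<close> cancel, so the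
  value at \<open>x\<close> depends only on \<open>\<omega> x\<close>. Differentiability of \<open>\<omega>\<close> is asked for only at the point \<open>x\<close>, so that
  the lemma applies to pullbacks before their smoothness is known.\<close>

lemma local_bracket_eq_symbol:
  fixes U V :: "'e \<Rightarrow> ('e list \<Rightarrow> real) \<Rightarrow> real"
  assumes S: "open S" "x \<in> S" and U: "U \<in> local_mvfs S p" and V: "V \<in> local_mvfs S q"
    and \<omega>: "\<And>y. y \<in> S \<Longrightarrow> \<omega> y \<in> alt_forms k"
    and d: "\<And>vs. (\<lambda>y. \<omega> y vs) differentiable (at x)"
    and p: "1 \<le> p"
  shows "local_bracket p q U V \<omega> x ws = bracket_symbol p q U V x (\<omega> x) ws"
proof -
  define u w u' w' where "u = coeff p (U x)" and "w = coeff q (V x)"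
    and "u' = coeff_deriv p U x" and "w' = coeff_deriv q V x"
  define \<eta> \<phi> where "\<eta> = \<omega> x" and "\<phi> = dir_deriv \<omega> x"
  note mU = local_mvfsD(1)[OF U] and mV = local_mvfsD(1)[OF V]
  note altU = local_contract_alt_forms[of U _ p \<omega>, OF mU \<omega>]
  note altV = local_contract_alt_forms[of V _ q \<omega>, OF mV \<omega>]
  have alt_\<eta>: "alternating \<eta>" using \<omega>[OF S(2)] by (simp add: \<eta>_def alt_forms_iff)
  have alt_\<phi>: "alternating (\<phi> v)" for v
    using dir_deriv_alt_forms[OF S \<omega> d] by (simp add: \<phi>_def alt_forms_iff)
  note derivU = local_contract_has_derivative[OF S U \<omega> d]
  note derivV = local_contract_has_derivative[OF S V \<omega> d]
  have dU: "(\<lambda>y. local_contract U \<omega> y ws) differentiable (at x)"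
    and dV: "(\<lambda>y. local_contract V \<omega> y ws) differentiable (at x)" for ws
    using derivU derivV unfolding differentiable_def by blast+
  have DU: "dir_deriv (local_contract U \<omega>) x = (\<lambda>v ws. frame_contract p (u' v) \<eta> ws + frame_contract p u (\<phi> v) ws)"
    using dir_deriv_eq[OF derivU] by (simp add: u_def u'_def \<eta>_def \<phi>_def)
  have DV: "dir_deriv (local_contract V \<omega>) x = (\<lambda>v ws. frame_contract q (w' v) \<eta> ws + frame_contract q w (\<phi> v) ws)"
    using dir_deriv_eq[OF derivV] by (simp add: w_def w'_def \<eta>_def \<phi>_def)
  have V_x: "local_contract V \<omega> x = frame_contract q w \<eta>"
    unfolding w_def \<eta>_def by (rule local_contract_eq_frame[of V x q \<omega>, OF mV[OF S(2)] \<omega>[OF S(2)]])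
  have DUV: "dir_deriv (local_contract U (local_contract V \<omega>)) x =
      (\<lambda>v ws. frame_contract p (u' v) (frame_contract q w \<eta>) ws + frame_contract p u (\<lambda>ts. frame_contract q (w' v) \<eta> ts + frame_contract q w (\<phi> v) ts) ws)"
    using dir_deriv_eq[OF local_contract_has_derivative[OF S U altV dV]]
    by (simp only: DV V_x u_def u'_def)
  \<comment> \<open>In the following expansions, the sums over the free arguments cancel after contractions have been
      reordered, and so do the insertions of \<open>\<phi>\<close>, the derivative of \<open>\<omega>\<close>.\<close>
  have T1: "local_d (local_contract U (local_contract V \<omega>)) x ws =
      alt_sum (\<lambda>v. frame_contract p (u' v) (frame_contract q w \<eta>)) ws + (alt_sum (\<lambda>v. frame_contract p u (frame_contract q (w' v) \<eta>)) ws +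
      alt_sum (\<lambda>v. frame_contract p u (frame_contract q w (\<phi> v))) ws)"
    by (simp add: local_d_def DUV frame_contract_add alt_sum_add)
  have T2: "local_contract U (local_d (local_contract V \<omega>)) x ws =
      insertion p u (\<lambda>v. frame_contract q (w' v) \<eta>) ws + insertion p u (\<lambda>v. frame_contract q w (\<phi> v)) ws +
      (-1) ^ p * (alt_sum (\<lambda>v. frame_contract p u (frame_contract q (w' v) \<eta>)) ws + alt_sum (\<lambda>v. frame_contract p u (frame_contract q w (\<phi> v))) ws)"
  proof -
    have "local_contract U (local_d (local_contract V \<omega>)) x =
          frame_contract p u (alt_sum (\<lambda>v ws. frame_contract q (w' v) \<eta> ws + frame_contract q w (\<phi> v) ws))"
      using local_contract_eq_frame[of U x p "local_d (local_contract V \<omega>)", OF mU[OF S(2)] local_d_alt_forms[OF S altV dV]]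
      by (simp only: u_def local_d_def DV)
    then show ?thesis
      by (simp add: frame_contract_alt_sum insertion_add frame_contract_add alt_sum_add)
  qed
  have T34: "local_contract V (local_lie p U \<omega>) x ws =
      insertion q w (\<lambda>v. frame_contract p (u' v) \<eta>) ws + insertion q w (\<lambda>v. frame_contract p u (\<phi> v)) ws +
      (-1) ^ q * (alt_sum (\<lambda>v. frame_contract q w (frame_contract p (u' v) \<eta>)) ws + alt_sum (\<lambda>v. frame_contract q w (frame_contract p u (\<phi> v))) ws)
      - (-1) ^ p * ((-1) ^ ((p - 1) * q) * insertion p u (\<lambda>v. frame_contract q w (\<phi> v)) ws +
         (-1) ^ p * (insertion q w (\<lambda>v. frame_contract p u (\<phi> v)) ws + (-1) ^ q * alt_sum (\<lambda>v. frame_contract q w (frame_contract p u (\<phi> v))) ws))"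
  proof -
    have l1: "local_d (local_contract U \<omega>) x = alt_sum (\<lambda>v ws. frame_contract p (u' v) \<eta> ws + frame_contract p u (\<phi> v) ws)"
      by (simp only: local_d_def DU)
    have l2: "local_contract U (local_d \<omega>) x = frame_contract p u (alt_sum \<phi>)"
      using local_contract_eq_frame[of U x p "local_d \<omega>", OF mU[OF S(2)] local_d_alt_forms[OF S \<omega> d]]
      by (simp only: u_def \<phi>_def local_d_def)
    have l: "local_lie p U \<omega> x = (\<lambda>ws. local_d (local_contract U \<omega>) x ws
                + (- ((-1) ^ p)) * local_contract U (local_d \<omega>) x ws)"
      by (simp add: local_lie_def fun_eq_iff)
    have "local_lie p U \<omega> x \<in> alt_forms (Suc k - p)"
      by (rule local_lie_alt_forms[OF S U \<omega> d])
    from local_contract_eq_frame[of V x q "local_lie p U \<omega>", OF mV[OF S(2)] this]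
    have "local_contract V (local_lie p U \<omega>) x ws =
      frame_contract q w (alt_sum (\<lambda>v ws. frame_contract p (u' v) \<eta> ws + frame_contract p u (\<phi> v) ws)) ws
      - (-1) ^ p * frame_contract q w (frame_contract p u (alt_sum \<phi>)) ws"
      by (simp only: w_def l frame_contract_add frame_contract_cmult l1 l2)
    moreover have "frame_contract q w (frame_contract p u (alt_sum \<phi>)) ws =
        frame_contract q w (\<lambda>ws. insertion p u \<phi> ws + (-1) ^ p * alt_sum (\<lambda>v. frame_contract p u (\<phi> v)) ws) ws"
      by (simp add: frame_contract_alt_sum frame_contract_def[of q])
    ultimately show ?thesis
      by (simp add: frame_contract_add frame_contract_cmult frame_contract_insertion[OF alt_\<phi>] frame_contract_alt_sum insertion_add alt_sum_add)
  qed
  have swap: "alt_sum (\<lambda>v. frame_contract p (u' v) (frame_contract q w \<eta>)) ws =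
        (-1) ^ (p * q) * alt_sum (\<lambda>v. frame_contract q w (frame_contract p (u' v) \<eta>)) ws"
    unfolding alt_sum_cmult[symmetric] by (intro alt_sum_cong frame_contract_commute alt_\<eta>)
  show ?thesis
    unfolding local_bracket_def local_lie_def[of p U "local_contract V \<omega>"] T1 T2 T34 swap
      bracket_symbol_def u_def[symmetric] w_def[symmetric] u'_def[symmetric] w'_def[symmetric] \<eta>_def[symmetric]
    using p by (cases p; cases "even (p - 1)"; cases "even q") (simp_all add: minus_one_power_iff)
qed

end

section \<open>Naturality under changes of coordinates\<close>

definition pullback ::
    "('e::real_normed_vector \<Rightarrow> 'e) \<Rightarrow> ('e \<Rightarrow> 'e list \<Rightarrow> real) \<Rightarrow> 'e \<Rightarrow> 'e list \<Rightarrow> real" where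
  "pullback \<tau> \<omega> x vs = \<omega> (\<tau> x) (map (frechet_derivative \<tau> (at x)) vs)"

text \<open>A change of coordinates. Relations between local objects are stated on \<open>S\<close> as a whole rather than
  at one point, because the exterior derivative needs them on a neighbourhood.\<close>

locale smooth_change = finite_dim B for B :: "'e::real_normed_vector set" +
  fixes S S' :: "'e set" and \<tau> :: "'e \<Rightarrow> 'e"
  assumes open_S: "open S" and open_S': "open S'"
    and \<tau>_in: "x \<in> S \<Longrightarrow> \<tau> x \<in> S'"
    and smooth_\<tau>: "smooth_on S \<tau>"
begin

abbreviation D\<tau> :: "'e \<Rightarrow> 'e \<Rightarrow> 'e" where
  "D\<tau> x \<equiv> frechet_derivative \<tau> (at x)"

definition pulls_back :: "('e \<Rightarrow> 'e list \<Rightarrow> real) \<Rightarrow> ('e \<Rightarrow> 'e list \<Rightarrow> real) \<Rightarrow> bool" where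
  "pulls_back \<zeta> \<omega> \<longleftrightarrow> (\<forall>x\<in>S. \<zeta> x = pullback \<tau> \<omega> x)"

definition pushes_forward ::
    "nat \<Rightarrow> ('e \<Rightarrow> ('e list \<Rightarrow> real) \<Rightarrow> real) \<Rightarrow> ('e \<Rightarrow> ('e list \<Rightarrow> real) \<Rightarrow> real) \<Rightarrow> bool" where
  "pushes_forward p U U' \<longleftrightarrow>
     (\<forall>x\<in>S. \<forall>\<eta>\<in>alt_forms p. U' (\<tau> x) \<eta> = U x (\<lambda>vs. \<eta> (map (D\<tau> x) vs)))"

lemma linear_D\<tau>: "x \<in> S \<Longrightarrow> linear (D\<tau> x)"
  by (intro linear_frechet_derivative smooth_on_differentiable[OF smooth_\<tau>])

lemma pulls_back_alt_forms:
  assumes "pulls_back \<zeta> \<omega>" "\<omega> \<in> local_forms S' k" "x \<in> S"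
  shows "\<zeta> x \<in> alt_forms k"
proof -
  have "\<zeta> x = (\<lambda>vs. \<omega> (\<tau> x) (map (D\<tau> x) vs))"
    using assms(1,3) by (simp add: pulls_back_def pullback_def[abs_def])
  then show ?thesis
    using alt_forms_map[OF local_formsD(1)[OF assms(2) \<tau>_in[OF assms(3)]] linear_D\<tau>[OF assms(3)]]
    by simp
qed

lemma pulls_back_has_derivative:
  assumes "pulls_back \<zeta> \<omega>" and \<omega>: "\<omega> \<in> local_forms S' k" and x: "x \<in> S"
  shows "((\<lambda>y. \<zeta> y vs) has_derivative (\<lambda>h. dir_deriv \<omega> (\<tau> x) (D\<tau> x h) (map (D\<tau> x) vs) +
      leibniz (\<omega> (\<tau> x)) (map (\<lambda>v. (D\<tau> x v, frechet_derivative (\<lambda>y. D\<tau> y v) (at x) h)) vs))) (at x)"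
proof -
  define ps where "ps = map (\<lambda>v. (\<lambda>y. D\<tau> y v, frechet_derivative (\<lambda>y. D\<tau> y v) (at x))) vs"
  have "((\<lambda>y. \<omega> (\<tau> y) (map (\<lambda>p. fst p y) ps)) has_derivative
          (\<lambda>h. dir_deriv \<omega> (\<tau> x) (D\<tau> x h) (map (\<lambda>p. fst p x) ps) +
               leibniz (\<omega> (\<tau> x)) (map (\<lambda>p. (fst p x, snd p h)) ps))) (at x)"
  proof (rule has_derivative_alternating[OF smooth_on_has_derivative[OF smooth_\<tau> x] open_S' \<tau>_in[OF x]])
    show "alternating (\<omega> y)" if "y \<in> S'" for y
      using local_formsD(1)[OF \<omega> that] by (simp add: alt_forms_iff)
    show "((\<lambda>y. \<omega> y us) has_derivative (\<lambda>h. dir_deriv \<omega> (\<tau> x) h us)) (at (\<tau> x))" for us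
      by (intro dir_deriv_works local_formsD(2)[OF \<omega> \<tau>_in[OF x]])
    show "(fst p has_derivative snd p) (at x)" if "p \<in> set ps" for p
      using that smooth_on_has_derivative[OF smooth_on_derivative[OF smooth_\<tau>] x]
      by (auto simp: ps_def)
  qed
  then have "((\<lambda>y. \<omega> (\<tau> y) (map (D\<tau> y) vs)) has_derivative
      (\<lambda>h. dir_deriv \<omega> (\<tau> x) (D\<tau> x h) (map (D\<tau> x) vs) +
      leibniz (\<omega> (\<tau> x)) (map (\<lambda>v. (D\<tau> x v, frechet_derivative (\<lambda>y. D\<tau> y v) (at x) h)) vs))) (at x)"
    by (simp add: ps_def comp_def)
  then show ?thesis
    by (rule has_derivative_transform_within_open[OF _ open_S x])
       (use assms(1) in \<open>simp add: pulls_back_def pullback_def\<close>)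
qed

lemma pulls_back_differentiable:
  assumes "pulls_back \<zeta> \<omega>" "\<omega> \<in> local_forms S' k" "x \<in> S"
  shows "(\<lambda>y. \<zeta> y vs) differentiable (at x)"
  using pulls_back_has_derivative[OF assms] unfolding differentiable_def by blast

text \<open>The second derivatives of \<open>\<tau>\<close> in \<open>pulls_back_has_derivative\<close> drop out by \<open>alt_sum_leibniz\<close>.\<close>

lemma local_d_natural:
  assumes "pulls_back \<zeta> \<omega>" and \<omega>: "\<omega> \<in> local_forms S' k"
  shows "pulls_back (local_d \<zeta>) (local_d \<omega>)"
  unfolding pulls_back_def
proof (intro ballI ext)
  fix x vs assume x: "x \<in> S"
  define \<sigma> where "\<sigma> = (\<lambda>h v. frechet_derivative (\<lambda>y. D\<tau> y v) (at x) h)"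
  have hd: "((\<lambda>y. D\<tau> y v) has_derivative (\<lambda>h. \<sigma> h v)) (at x)" for v
    unfolding \<sigma>_def by (intro smooth_on_has_derivative[OF _ x] smooth_on_derivative smooth_\<tau>)
  have sym: "\<sigma> u v = \<sigma> v u" for u v
    by (rule second_derivative_symmetric_vector[OF open_S x smooth_on_has_derivative[OF smooth_\<tau>] hd hd])
  have alt: "alternating (\<omega> (\<tau> x))"
    using local_formsD(1)[OF \<omega> \<tau>_in[OF x]] by (simp add: alt_forms_iff)
  have "dir_deriv \<zeta> x = (\<lambda>h vs. dir_deriv \<omega> (\<tau> x) (D\<tau> x h) (map (D\<tau> x) vs) +
          leibniz (\<omega> (\<tau> x)) (map (\<lambda>v. (D\<tau> x v, \<sigma> h v)) vs))"
    unfolding \<sigma>_def by (rule dir_deriv_eq[OF pulls_back_has_derivative[OF assms x]])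
  then have "local_d \<zeta> x vs = alt_sum (\<lambda>h vs. dir_deriv \<omega> (\<tau> x) (D\<tau> x h) (map (D\<tau> x) vs)) vs"
    by (simp add: local_d_def alt_sum_add alt_sum_leibniz[OF alt sym])
  then show "local_d \<zeta> x vs = pullback \<tau> (local_d \<omega>) x vs"
    by (simp add: pullback_def local_d_def alt_sum_map)
qed

lemma local_contract_natural:
  assumes "pulls_back \<zeta> \<omega>" and \<omega>: "\<omega> \<in> local_forms S' k"
    and UU': "pushes_forward p U U'" and U: "U \<in> local_mvfs S p" and U': "U' \<in> local_mvfs S' p"
  shows "pulls_back (local_contract U \<zeta>) (local_contract U' \<omega>)"
  unfolding pulls_back_def
proof (intro ballI ext)
  fix x ws assume x: "x \<in> S"
  note mU = local_mvfsD(1)[OF U x] and mU' = local_mvfsD(1)[OF U' \<tau>_in[OF x]]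
  note alt_\<omega> = local_formsD(1)[OF \<omega> \<tau>_in[OF x]]
  note alt_\<zeta> = pulls_back_alt_forms[OF assms(1) \<omega> x]
  show "local_contract U \<zeta> x ws = pullback \<tau> (local_contract U' \<omega>) x ws"
  proof (cases "p + length ws = k")
    case True
    then have "(\<lambda>vs. \<omega> (\<tau> x) (vs @ map (D\<tau> x) ws)) \<in> alt_forms p"
      using alt_forms_append[of "\<omega> (\<tau> x)" "[]" p "map (D\<tau> x) ws"] alt_\<omega> by simp
    then have "U' (\<tau> x) (\<lambda>vs. \<omega> (\<tau> x) (vs @ map (D\<tau> x) ws)) =
          U x (\<lambda>vs. \<omega> (\<tau> x) (map (D\<tau> x) vs @ map (D\<tau> x) ws))"
      using UU' x by (simp add: pushes_forward_def)
    then show ?thesis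
      using assms(1) x by (simp add: local_contract_def pulls_back_def pullback_def)
  next
    case False
    have "local_contract U \<zeta> x ws = 0"
      using False alt_\<zeta> by (simp add: local_contract_eq_frame[of U x p \<zeta>, OF mU alt_\<zeta>] frame_contract_degree)
    moreover have "local_contract U' \<omega> (\<tau> x) (map (D\<tau> x) ws) = 0"
      using False alt_\<omega>
      by (simp add: local_contract_eq_frame[of U' "\<tau> x" p \<omega>, OF mU' alt_\<omega>] frame_contract_degree)
    ultimately show ?thesis by (simp add: pullback_def)
  qed
qed

lemma local_lie_natural:
  assumes "pulls_back \<zeta> \<omega>" and \<omega>: "\<omega> \<in> local_forms S' k"
    and UU': "pushes_forward p U U'" and U: "U \<in> local_mvfs S p" and U': "U' \<in> local_mvfs S' p"
  shows "pulls_back (local_lie p U \<zeta>) (local_lie p U' \<omega>)"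
proof -
  have "pulls_back (local_d (local_contract U \<zeta>)) (local_d (local_contract U' \<omega>))"
    by (rule local_d_natural[OF local_contract_natural[OF assms] local_contract_forms[OF open_S' U' \<omega>]])
  moreover have "pulls_back (local_contract U (local_d \<zeta>)) (local_contract U' (local_d \<omega>))"
    by (rule local_contract_natural[OF local_d_natural[OF assms(1) \<omega>] local_d_forms[OF open_S' \<omega>] UU' U U'])
  ultimately show ?thesis
    by (simp add: pulls_back_def pullback_def local_lie_def fun_eq_iff)
qed

lemma local_bracket_natural:
  assumes "pulls_back \<zeta> \<omega>" and \<omega>: "\<omega> \<in> local_forms S' k"
    and UU': "pushes_forward p U U'" and U: "U \<in> local_mvfs S p" and U': "U' \<in> local_mvfs S' p"
    and VV': "pushes_forward q V V'" and V: "V \<in> local_mvfs S q" and V': "V' \<in> local_mvfs S' q"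
  shows "pulls_back (local_bracket p q U V \<zeta>) (local_bracket p q U' V' \<omega>)"
proof -
  have "pulls_back (local_lie p U (local_contract V \<zeta>)) (local_lie p U' (local_contract V' \<omega>))"
    by (rule local_lie_natural[OF local_contract_natural[OF assms(1) \<omega> VV' V V']
          local_contract_forms[OF open_S' V' \<omega>] UU' U U'])
  moreover have "pulls_back (local_contract V (local_lie p U \<zeta>)) (local_contract V' (local_lie p U' \<omega>))"
    by (rule local_contract_natural[OF local_lie_natural[OF assms(1) \<omega> UU' U U']
          local_lie_forms[OF open_S' U' \<omega>] VV' V V'])
  ultimately show ?thesis
    by (simp add: pulls_back_def pullback_def local_bracket_def fun_eq_iff)
qed

end

lemma Ck_on_subset: "Ck_on k S f \<Longrightarrow> S' \<subseteq> S \<Longrightarrow> Ck_on k S' f"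
  by (induction k arbitrary: f) (auto intro: continuous_on_subset)

lemma smooth_on_subset: "smooth_on S f \<Longrightarrow> S' \<subseteq> S \<Longrightarrow> smooth_on S' f"
  unfolding smooth_on_def by (intro allI, rule Ck_on_subset[of _ S]) auto

lemma local_mvfs_subset: "U \<in> local_mvfs S p \<Longrightarrow> S' \<subseteq> S \<Longrightarrow> U \<in> local_mvfs S' p"
  using smooth_on_subset by (fastforce simp: local_mvfs_def)

section \<open>Differential forms on a manifold\<close>

lemma form_scale_apply [simp]: "(a *\<^sub>F \<omega>) c x vs = a * \<omega> c x vs"
  by (simp add: form_scale_def)

lemma ext_d_eq_local:
  "c \<in> A \<Longrightarrow> x \<in> chart_image c \<Longrightarrow> ext_d A \<omega> c x = local_d (\<omega> c) x"
  by (simp add: ext_d_def local_d_def alt_sum_eq_sum dir_deriv_def fun_eq_iff)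

lemma contract_eq_local: "contract U \<omega> c = local_contract (U c) (\<omega> c)"
  by (simp add: contract_def local_contract_def fun_eq_iff)

lemma lie_deriv_eq_local:
  "c \<in> A \<Longrightarrow> x \<in> chart_image c \<Longrightarrow> lie_deriv A p U \<omega> c x = local_lie p (U c) (\<omega> c) x"
  by (simp add: lie_deriv_def local_lie_def ext_d_eq_local fun_eq_iff
      contract_eq_local[symmetric] local_contract_def contract_def)

lemma multivector_fields_local:
  "U \<in> multivector_fields A p \<Longrightarrow> c \<in> A \<Longrightarrow> U c \<in> local_mvfs (chart_image c) p"
  by (simp add: multivector_fields_def local_mvfs_def)

lemma diff_forms_local:
  "\<omega> \<in> diff_forms A k \<Longrightarrow> c \<in> A \<Longrightarrow> \<omega> c \<in> local_forms (chart_image c) k"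
  by (simp add: diff_forms_def local_forms_def)

lemma multivector_fields_outside:
  assumes "U \<in> multivector_fields A p" "c \<notin> A \<or> x \<notin> chart_image c"
  shows "U c x \<eta> = 0"
proof -
  have "\<forall>c x. c \<notin> A \<or> x \<notin> chart_image c \<longrightarrow> U c x = (\<lambda>\<eta>. 0)"
    using assms(1) unfolding multivector_fields_def by (elim CollectE conjE)
  then have "U c x = (\<lambda>\<eta>. 0)" using assms(2) by blast
  then show ?thesis by (simp only:)
qed

lemma diff_forms_outside:
  assumes "\<omega> \<in> diff_forms A k" "c \<notin> A \<or> x \<notin> chart_image c"
  shows "\<omega> c x vs = 0"
proof -
  have "\<forall>c x. c \<notin> A \<or> x \<notin> chart_image c \<longrightarrow> \<omega> c x = (\<lambda>vs. 0)"
    using assms(1) unfolding diff_forms_def by (elim CollectE conjE)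
  then have "\<omega> c x = (\<lambda>vs. 0)" using assms(2) by blast
  then show ?thesis by (simp only:)
qed

locale based_manifold = finite_dim B for B :: "'e::real_normed_vector set" +
  fixes M :: "'m topology" and A :: "('m, 'e) chart set"
  assumes manifold: "smooth_manifold M A"
begin

lemma
  assumes "c \<in> A"
  shows open_chart_image: "open (chart_image c)"
    and chart_openin: "openin M (fst c)"
    and chart_homeomorphic: "homeomorphic_map (subtopology M (fst c)) (top_of_set (chart_image c)) (snd c)"
  using manifold assms by (auto simp: smooth_manifold_def)

lemma chart_inj: assumes "c \<in> A" shows "inj_on (snd c) (fst c)"
proof -
  have "topspace (subtopology M (fst c)) = fst c"
    using openin_subset[OF chart_openin[OF assms]] by (simp add: inf.absorb2)
  then show ?thesis
    using homeomorphic_imp_injective_map[OF chart_homeomorphic[OF assms]] by simp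
qed

lemma open_overlap: assumes "c \<in> A" "c' \<in> A" shows "open (overlap c c')"
proof -
  have "openin (subtopology M (fst c)) (fst c \<inter> fst c')"
    by (rule openin_subtopology_Int2[OF chart_openin[OF assms(2)]])
  then have "openin (top_of_set (chart_image c)) (overlap c c')"
    using homeomorphic_imp_open_map[OF chart_homeomorphic[OF assms(1)]]
    by (simp add: open_map_def overlap_def)
  then show ?thesis using openin_open_trans[OF _ open_chart_image[OF assms(1)]] by blast
qed

lemma overlap_subset: "overlap c c' \<subseteq> chart_image c"
  by (auto simp: overlap_def chart_image_def)

lemma transition_in:
  assumes "c \<in> A" "x \<in> overlap c c'" shows "transition c c' x \<in> chart_image c'"
  using assms chart_inj[OF assms(1)]
  by (auto simp: overlap_def chart_image_def transition_def inv_into_f_f)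

lemma smooth_change_transition:
  assumes "c \<in> A" "c' \<in> A"
  shows "smooth_change B (overlap c c') (chart_image c') (transition c c')"
proof unfold_locales
  show "smooth_on (overlap c c') (transition c c')"
    using manifold assms by (auto simp: smooth_manifold_def)
qed (use assms open_overlap open_chart_image transition_in in auto)

lemma pulls_back_diff_form:
  assumes "\<omega> \<in> diff_forms A k" "c \<in> A" "c' \<in> A"
  shows "smooth_change.pulls_back (overlap c c') (transition c c') (\<omega> c) (\<omega> c')"
  using assms
  by (simp add: smooth_change.pulls_back_def[OF smooth_change_transition] pullback_def fun_eq_iff
      diff_forms_def)

lemma pushes_forward_mvf:
  assumes "U \<in> multivector_fields A p" "c \<in> A" "c' \<in> A"
  shows "smooth_change.pushes_forward (overlap c c') (transition c c') p (U c) (U c')"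
  using assms
  by (simp add: smooth_change.pushes_forward_def[OF smooth_change_transition] multivector_fields_def)

text \<open>Splits membership into local conditions in the charts and compatibility with changes of
  coordinates, so that closure under an operation follows from its naturality.\<close>

lemma diff_formsI:
  assumes "\<And>c x vs. c \<notin> A \<or> x \<notin> chart_image c \<Longrightarrow> \<omega> c x vs = 0"
    and "\<And>c. c \<in> A \<Longrightarrow> \<omega> c \<in> local_forms (chart_image c) k"
    and "\<And>c c'. c \<in> A \<Longrightarrow> c' \<in> A \<Longrightarrow>
           smooth_change.pulls_back (overlap c c') (transition c c') (\<omega> c) (\<omega> c')"
  shows "\<omega> \<in> diff_forms A k"
proof -
  have "\<omega> c x vs = \<omega> c' (transition c c' x) (map (frechet_derivative (transition c c') (at x)) vs)"
    if "c \<in> A" "c' \<in> A" "x \<in> overlap c c'" for c c' x vs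
    using assms(3)[OF that(1,2)] that
    by (simp add: smooth_change.pulls_back_def[OF smooth_change_transition] pullback_def)
  moreover have "\<omega> c x = (\<lambda>vs. 0)" if "c \<notin> A \<or> x \<notin> chart_image c" for c x
    using assms(1)[OF that] by (simp add: fun_eq_iff)
  ultimately show ?thesis
    using assms(2) by (simp add: diff_forms_def local_forms_def)
qed

lemma contract_diff_forms:
  assumes U: "U \<in> multivector_fields A p" and \<omega>: "\<omega> \<in> diff_forms A k"
  shows "contract U \<omega> \<in> diff_forms A (k - p)"
proof (rule diff_formsI)
  show "contract U \<omega> c x vs = 0" if "c \<notin> A \<or> x \<notin> chart_image c" for c x vs
    using multivector_fields_outside[OF U that] by (simp add: contract_def)
  show "contract U \<omega> c \<in> local_forms (chart_image c) (k - p)" if "c \<in> A" for c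
    unfolding contract_eq_local
    by (intro local_contract_forms open_chart_image multivector_fields_local[OF U]
        diff_forms_local[OF \<omega>] that)
  show "smooth_change.pulls_back (overlap c c') (transition c c') (contract U \<omega> c) (contract U \<omega> c')"
    if "c \<in> A" "c' \<in> A" for c c'
    unfolding contract_eq_local
    by (rule smooth_change.local_contract_natural[OF smooth_change_transition[OF that]
        pulls_back_diff_form[OF \<omega> that] diff_forms_local[OF \<omega> that(2)] pushes_forward_mvf[OF U that]
        local_mvfs_subset[OF multivector_fields_local[OF U that(1)] overlap_subset]
        multivector_fields_local[OF U that(2)]])
qed

lemma local_forms_cong:
  assumes "open S" "\<zeta> \<in> local_forms S k" "\<And>x. x \<in> S \<Longrightarrow> \<omega> x = \<zeta> x"
  shows "\<omega> \<in> local_forms S k"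
  using assms smooth_on_cong[OF assms(1), of "\<lambda>x. \<zeta> x _" "\<lambda>x. \<omega> x _"]
  by (simp add: local_forms_def)

lemma ext_d_diff_forms:
  assumes \<omega>: "\<omega> \<in> diff_forms A k"
  shows "ext_d A \<omega> \<in> diff_forms A (Suc k)"
proof (rule diff_formsI)
  show "ext_d A \<omega> c x vs = 0" if "c \<notin> A \<or> x \<notin> chart_image c" for c x vs
    using that by (simp only: ext_d_def) auto
  show "ext_d A \<omega> c \<in> local_forms (chart_image c) (Suc k)" if "c \<in> A" for c
    by (rule local_forms_cong[OF open_chart_image[OF that]
        local_d_forms[OF open_chart_image[OF that] diff_forms_local[OF \<omega> that]]])
       (rule ext_d_eq_local[OF that])
  show "smooth_change.pulls_back (overlap c c') (transition c c') (ext_d A \<omega> c) (ext_d A \<omega> c')"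
    if "c \<in> A" "c' \<in> A" for c c'
  proof -
    note sc = smooth_change_transition[OF that]
    have "smooth_change.pulls_back (overlap c c') (transition c c') (local_d (\<omega> c)) (local_d (\<omega> c'))"
      by (rule smooth_change.local_d_natural[OF sc pulls_back_diff_form[OF \<omega> that]
            diff_forms_local[OF \<omega> that(2)]])
    then show ?thesis
      using that overlap_subset[of c c'] transition_in[OF that(1)]
      by (auto simp: smooth_change.pulls_back_def[OF sc] pullback_def fun_eq_iff ext_d_eq_local subset_iff)
  qed
qed

lemma ext_d_ext_d:
  assumes \<omega>: "\<omega> \<in> diff_forms A k" shows "ext_d A (ext_d A \<omega>) = 0"
proof (intro ext)
  fix c x vs
  show "ext_d A (ext_d A \<omega>) c x vs = 0 c x vs"
  proof (cases "c \<in> A \<and> x \<in> chart_image c")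
    case True
    then have c: "c \<in> A" and x: "x \<in> chart_image c" by auto
    note \<omega>c = diff_forms_local[OF \<omega> c]
    have "ext_d A (ext_d A \<omega>) c x = local_d (ext_d A \<omega> c) x"
      by (rule ext_d_eq_local[OF c x])
    also have "\<dots> = local_d (local_d (\<omega> c)) x"
      by (rule local_d_cong[OF open_chart_image[OF c] x])
         (simp_all add: ext_d_eq_local c
            local_formsD(2)[OF local_d_forms[OF open_chart_image[OF c] \<omega>c] x])
    also have "\<dots> = (\<lambda>vs. 0)"
      by (rule local_d_local_d[OF open_chart_image[OF c] \<omega>c x])
    finally show ?thesis by simp
  qed (auto simp: ext_d_def)
qed

end

section \<open>Existence of the Schouten bracket\<close>

lemma powi_degree:
  assumes "1 \<le> p" shows "(-1 :: real) powi ((int p - 1) * int q) = (-1) ^ ((p - 1) * q)"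
proof -
  have "(int p - 1) * int q = int ((p - 1) * q)" using assms by (simp add: of_nat_diff)
  then show ?thesis by (simp only: power_int_of_nat)
qed

context based_manifold
begin

text \<open>The field \<open>W\<close> is obtained by applying the operator to forms with constant coefficients in a chart; these
  are smooth on the whole chart, so \<open>W\<close> is smooth. Compatibility on overlaps compares, at a point \<open>x\<close>, the
  constant form in one chart with the pullback of a constant form from the other: they agree at \<open>x\<close>, and by
  tensoriality this is enough.\<close>

lemma schouten_exists:
  assumes p: "1 \<le> p" and U: "U \<in> multivector_fields A p" and V: "V \<in> multivector_fields A q"
  shows "\<exists>W. W \<in> multivector_fields A (p + q - 1) \<and>
     (\<forall>k. \<forall>\<omega>\<in>diff_forms A k.
        contract W \<omega> =
        ((-1) powi ((int p - 1) * int q)) *\<^sub>F lie_deriv A p U (contract V \<omega>)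
        - contract V (lie_deriv A p U \<omega>))"
proof -
  define m where "m = p + q - 1"
  define W where "W = (\<lambda>c x \<eta>. if c \<in> A \<and> x \<in> chart_image c \<and> \<eta> \<in> alt_forms m
                                then local_bracket p q (U c) (V c) (\<lambda>_. \<eta>) x [] else 0)"
  note lU = multivector_fields_local[OF U] and lV = multivector_fields_local[OF V]
  have const: "(\<lambda>_. \<eta>) \<in> local_forms S m" if "\<eta> \<in> alt_forms m" for S :: "'e set" and \<eta>
    using that by (simp add: local_forms_def)
  have W_symbol: "W c x \<eta> = bracket_symbol p q (U c) (V c) x \<eta> []"
    if "c \<in> A" "x \<in> chart_image c" "\<eta> \<in> alt_forms m" for c x \<eta>
    using that local_bracket_eq_symbol[OF open_chart_image[OF that(1)] that(2) lU[OF that(1)] lV[OF that(1)],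
        of "\<lambda>_. \<eta>" m "[]", OF that(3) _ p]
    by (simp add: W_def)
  have "W \<in> multivector_fields A m"
    unfolding multivector_fields_def
  proof (intro CollectI conjI allI ballI impI)
    show "W c x = (\<lambda>\<eta>. 0)" if "c \<notin> A \<or> x \<notin> chart_image c" for c x
      using that by (auto simp: W_def)
    show "W c x \<in> multivectors m" if "c \<in> A" "x \<in> chart_image c" for c x
    proof (rule multivectorsI)
      show "W c x (\<lambda>vs. f vs + a * g vs) = W c x f + a * W c x g"
        if "f \<in> alt_forms m" "g \<in> alt_forms m" for f g a
        using that \<open>c \<in> A\<close> \<open>x \<in> chart_image c\<close>
        by (simp add: W_symbol alt_forms_lincomb bracket_symbol_lincomb)
    qed (simp add: W_def)
    show "smooth_on (chart_image c) (\<lambda>x. W c x \<eta>)" if c: "c \<in> A" and \<eta>: "\<eta> \<in> alt_forms m" for c \<eta>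
      by (rule smooth_on_cong[OF open_chart_image[OF c] _
            local_bracket_smooth[OF open_chart_image[OF c] lU[OF c] lV[OF c] const[OF \<eta>]]])
         (use c \<eta> in \<open>simp add: W_def\<close>)
    show "W c' (transition c c' x) \<eta> =
        W c x (\<lambda>vs. \<eta> (map (frechet_derivative (transition c c') (at x)) vs))"
      if c: "c \<in> A" and c': "c' \<in> A" and x: "x \<in> overlap c c'" and \<eta>: "\<eta> \<in> alt_forms m" for c c' x \<eta>
    proof -
      let ?\<tau> = "transition c c'" and ?S = "overlap c c'"
      \<comment> \<open>\<open>\<zeta>\<close> has variable coefficients, but at \<open>x\<close> it is the form at which \<open>W\<close> must be evaluated\<close>
      define \<zeta> where "\<zeta> = pullback ?\<tau> (\<lambda>_. \<eta>)"
      interpret sc: smooth_change B ?S "chart_image c'" ?\<tau>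
        by (rule smooth_change_transition[OF c c'])
      have pb: "sc.pulls_back \<zeta> (\<lambda>_. \<eta>)" by (simp add: sc.pulls_back_def \<zeta>_def)
      note lU' = local_mvfs_subset[OF lU[OF c] overlap_subset, of c']
      note lV' = local_mvfs_subset[OF lV[OF c] overlap_subset, of c']
      have \<zeta>x: "\<zeta> x = (\<lambda>vs. \<eta> (map (sc.D\<tau> x) vs))" by (simp add: \<zeta>_def pullback_def[abs_def])
      have "sc.pulls_back (local_bracket p q (U c) (V c) \<zeta>) (local_bracket p q (U c') (V c') (\<lambda>_. \<eta>))"
        by (rule sc.local_bracket_natural[OF pb const[OF \<eta>] pushes_forward_mvf[OF U c c'] lU' lU[OF c']
              pushes_forward_mvf[OF V c c'] lV' lV[OF c']])
      then have "local_bracket p q (U c) (V c) \<zeta> x [] = local_bracket p q (U c') (V c') (\<lambda>_. \<eta>) (?\<tau> x) []"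
        using x by (simp add: sc.pulls_back_def pullback_def)
      moreover have "local_bracket p q (U c) (V c) \<zeta> x [] = bracket_symbol p q (U c) (V c) x (\<zeta> x) []"
        by (rule local_bracket_eq_symbol[OF open_overlap[OF c c'] x lU' lV'
              sc.pulls_back_alt_forms[OF pb const[OF \<eta>]]
              sc.pulls_back_differentiable[OF pb const[OF \<eta>] x] p])
      moreover have "\<dots> = W c x (\<zeta> x)"
        using overlap_subset[of c c'] x by (intro W_symbol[symmetric] c sc.pulls_back_alt_forms[OF pb const[OF \<eta>]]) blast+
      ultimately show ?thesis
        using c' \<eta> transition_in[OF c x] by (simp add: \<zeta>x W_def)
    qed
  qed
  moreover have "contract W \<omega> = ((-1) powi ((int p - 1) * int q)) *\<^sub>F lie_deriv A p U (contract V \<omega>)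
        - contract V (lie_deriv A p U \<omega>)" if \<omega>: "\<omega> \<in> diff_forms A k" for k \<omega>
  proof (intro ext)
    fix c x ws
    show "contract W \<omega> c x ws = (((-1) powi ((int p - 1) * int q)) *\<^sub>F lie_deriv A p U (contract V \<omega>)
        - contract V (lie_deriv A p U \<omega>)) c x ws"
    proof (cases "c \<in> A \<and> x \<in> chart_image c")
      case True
      then have c: "c \<in> A" and x: "x \<in> chart_image c" by auto
      note l\<omega> = diff_forms_local[OF \<omega> c]
      have "contract W \<omega> c x ws = bracket_symbol p q (U c) (V c) x (\<omega> c x) ws"
      proof (cases "m + length ws = k")
        case True
        have "(\<lambda>vs. \<omega> c x (vs @ ws)) \<in> alt_forms m"
          using alt_forms_append[of "\<omega> c x" "[]" m ws] local_formsD(1)[OF l\<omega> x] True by simp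
        from W_symbol[OF c x this] show ?thesis
          by (simp add: contract_def bracket_symbol_append[of _ _ _ _ _ _ ws])
      next
        case False
        then have "bracket_symbol p q (U c) (V c) x (\<omega> c x) ws = 0"
          by (intro bracket_symbol_degree[OF local_formsD(1)[OF l\<omega> x]] p) (simp add: m_def)
        moreover have "contract W \<omega> c x ws = frame_contract m (coeff m (W c x)) (\<omega> c x) ws"
          unfolding contract_def
          using \<open>W \<in> multivector_fields A m\<close> c x
          by (intro contract_eq_frame[OF _ local_formsD(1)[OF l\<omega> x]]) (simp add: multivector_fields_def)
        ultimately show ?thesis
          using frame_contract_degree[OF local_formsD(1)[OF l\<omega> x]] False by simp
      qed
      also have "\<dots> = local_bracket p q (U c) (V c) (\<omega> c) x ws"
        by (rule local_bracket_eq_symbol[OF open_chart_image[OF c] x lU[OF c] lV[OF c]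
              local_formsD(1)[OF l\<omega>] local_formsD(2)[OF l\<omega> x] p, symmetric])
      also have "contract V (lie_deriv A p U \<omega>) c x ws = local_contract (V c) (local_lie p (U c) (\<omega> c)) x ws"
        by (simp add: contract_def local_contract_def lie_deriv_eq_local[OF c x])
      then have "local_bracket p q (U c) (V c) (\<omega> c) x ws =
          (((-1) powi ((int p - 1) * int q)) *\<^sub>F lie_deriv A p U (contract V \<omega>)
            - contract V (lie_deriv A p U \<omega>)) c x ws"
        by (simp add: local_bracket_def powi_degree[OF p] lie_deriv_eq_local[OF c x] contract_eq_local)
      finally show ?thesis .
    next
      case False
      then have out: "c \<notin> A \<or> x \<notin> chart_image c" by blast
      then have "ext_d A \<zeta> c x ws = 0" for \<zeta> by (auto simp: ext_d_def)
      moreover have "W c x = (\<lambda>\<eta>. 0)" using False by (auto simp: W_def)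
      ultimately show ?thesis
        using multivector_fields_outside[OF U out] multivector_fields_outside[OF V out]
        by (simp add: contract_def lie_deriv_def)
    qed
  qed
  ultimately show ?thesis unfolding m_def by blast
qed

lemma
  assumes "1 \<le> p" "U \<in> multivector_fields A p" "V \<in> multivector_fields A q"
  shows schouten_mvf: "schouten A p q U V \<in> multivector_fields A (p + q - 1)"
    and contract_schouten_diff_form: "\<omega> \<in> diff_forms A k \<Longrightarrow>
      contract (schouten A p q U V) \<omega> =
        ((-1) powi ((int p - 1) * int q)) *\<^sub>F lie_deriv A p U (contract V \<omega>)
        - contract V (lie_deriv A p U \<omega>)"
  using someI_ex[OF schouten_exists[OF assms], folded schouten_def] by blast+

text \<open>Integer degrees make contraction and the exterior derivative shift degrees without case
  distinctions, so that sums of terms of the same degree are recognised by arithmetic.\<close>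

definition forms :: "int \<Rightarrow> ('m, 'e) form set" where
  "forms m = (if m < 0 then {0} else diff_forms A (nat m))"

lemma zero_diff_forms: "0 \<in> diff_forms A k"
  by (simp add: diff_forms_def zero_fun_def)

lemma zero_forms [simp]: "0 \<in> forms m"
  by (simp add: forms_def zero_diff_forms)

lemma forms_local:
  assumes "\<omega> \<in> forms m" "c \<in> A" shows "\<omega> c \<in> local_forms (chart_image c) (nat m)"
proof -
  have "\<omega> \<in> diff_forms A (nat m)"
    using assms(1) zero_diff_forms by (auto simp: forms_def split: if_splits)
  then show ?thesis by (rule diff_forms_local[OF _ assms(2)])
qed

lemma contract_zero [simp]:
  assumes "U \<in> multivector_fields A p" shows "contract U 0 = 0"
proof (intro ext)
  fix c x ws show "contract U 0 c x ws = 0 c x ws"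
    using multivector_fields_outside[OF assms, of c x]
      multivector_zero[OF local_mvfsD(1)[OF multivector_fields_local[OF assms]], of c x]
    by (cases "c \<in> A \<and> x \<in> chart_image c") (auto simp: contract_def)
qed

lemma ext_d_zero [simp]: "ext_d A 0 = 0"
  by (simp add: ext_d_def fun_eq_iff)

lemma contract_high_degree:
  assumes U: "U \<in> multivector_fields A p" and \<omega>: "\<omega> \<in> diff_forms A k" and "k < p"
  shows "contract U \<omega> = 0"
proof (intro ext)
  fix c x ws show "contract U \<omega> c x ws = 0 c x ws"
  proof (cases "c \<in> A \<and> x \<in> chart_image c")
    case True
    then have "\<omega> c x \<in> alt_forms k" "U c x \<in> multivectors p"
      using local_formsD(1)[OF diff_forms_local[OF \<omega>]] local_mvfsD(1)[OF multivector_fields_local[OF U]]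
      by blast+
    then show ?thesis
      using \<open>k < p\<close> by (simp add: contract_def contract_eq_frame frame_contract_high_degree)
  next
    case False
    then have "c \<notin> A \<or> x \<notin> chart_image c" by blast
    then show ?thesis by (simp add: contract_def multivector_fields_outside[OF U])
  qed
qed

lemma contract_forms:
  assumes U: "U \<in> multivector_fields A p" and \<omega>: "\<omega> \<in> forms m"
  shows "contract U \<omega> \<in> forms (m - int p)"
proof (cases "m < 0")
  case True
  then show ?thesis using assms by (simp add: forms_def)
next
  case False
  then have \<omega>': "\<omega> \<in> diff_forms A (nat m)" using \<omega> by (simp add: forms_def)
  show ?thesis
  proof (cases "nat m < p")
    case True
    then show ?thesis using contract_high_degree[OF U \<omega>'] by simp
  next
    case p: False
    then have "nat (m - int p) = nat m - p" by simp
    then show ?thesis using contract_diff_forms[OF U \<omega>'] p False by (simp add: forms_def)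
  qed
qed

lemma ext_d_forms:
  assumes "\<omega> \<in> forms m" shows "ext_d A \<omega> \<in> forms (m + 1)"
proof (cases "m < 0")
  case True
  then show ?thesis using assms by (simp add: forms_def zero_diff_forms)
next
  case False
  then have "nat (m + 1) = Suc (nat m)" by simp
  then show ?thesis using ext_d_diff_forms[of \<omega> "nat m"] assms False by (simp add: forms_def)
qed

lemma diff_forms_lincomb:
  assumes "\<omega> \<in> diff_forms A k" "\<zeta> \<in> diff_forms A k"
  shows "\<omega> + a *\<^sub>F \<zeta> \<in> diff_forms A k"
proof (rule diff_formsI)
  fix c x vs assume "c \<notin> A \<or> x \<notin> chart_image c"
  then show "(\<omega> + a *\<^sub>F \<zeta>) c x vs = 0"
    using diff_forms_outside[OF assms(1)] diff_forms_outside[OF assms(2)] by simp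
next
  fix c assume c: "c \<in> A"
  have eq: "(\<omega> + a *\<^sub>F \<zeta>) c = (\<lambda>x vs. \<omega> c x vs + a * \<zeta> c x vs)" by (simp add: fun_eq_iff)
  show "(\<omega> + a *\<^sub>F \<zeta>) c \<in> local_forms (chart_image c) k"
    using diff_forms_local[OF assms(1) c] diff_forms_local[OF assms(2) c] open_chart_image[OF c]
    unfolding eq local_forms_def
    by (auto intro!: alt_forms_lincomb smooth_on_add smooth_on_mult)
next
  fix c c' assume c: "c \<in> A" "c' \<in> A"
  show "smooth_change.pulls_back (overlap c c') (transition c c') ((\<omega> + a *\<^sub>F \<zeta>) c) ((\<omega> + a *\<^sub>F \<zeta>) c')"
    using pulls_back_diff_form[OF assms(1) c] pulls_back_diff_form[OF assms(2) c]
    by (simp add: smooth_change.pulls_back_def[OF smooth_change_transition[OF c]] pullback_def fun_eq_iff)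
qed

lemma form_scale_zero [simp]: "a *\<^sub>F 0 = 0"
  by (simp add: form_scale_def fun_eq_iff)

lemma forms_lincomb: "\<omega> \<in> forms m \<Longrightarrow> \<zeta> \<in> forms m \<Longrightarrow> \<omega> + a *\<^sub>F \<zeta> \<in> forms m"
  by (auto simp: forms_def diff_forms_lincomb split: if_splits)

lemma contract_lincomb:
  assumes U: "U \<in> multivector_fields A p" and \<omega>: "\<omega> \<in> forms m" and \<zeta>: "\<zeta> \<in> forms m"
  shows "contract U (\<omega> + a *\<^sub>F \<zeta>) = contract U \<omega> + a *\<^sub>F contract U \<zeta>"
proof (intro ext)
  fix c x ws
  show "contract U (\<omega> + a *\<^sub>F \<zeta>) c x ws = (contract U \<omega> + a *\<^sub>F contract U \<zeta>) c x ws"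
  proof (cases "c \<in> A \<and> x \<in> chart_image c")
    case True
    then have c: "c \<in> A" and x: "x \<in> chart_image c" by auto
    have alt: "\<omega> c x \<in> alt_forms (nat m)" "\<zeta> c x \<in> alt_forms (nat m)"
      using local_formsD(1)[OF forms_local[OF \<omega> c] x] local_formsD(1)[OF forms_local[OF \<zeta> c] x] .
    note mU = local_mvfsD(1)[OF multivector_fields_local[OF U c] x]
    show ?thesis
      using contract_eq_frame[OF mU alt_forms_lincomb[OF alt]] contract_eq_frame[OF mU alt(1)]
        contract_eq_frame[OF mU alt(2)]
      by (simp add: contract_def frame_contract_linear)
  next
    case False
    then have "c \<notin> A \<or> x \<notin> chart_image c" by blast
    then show ?thesis by (simp add: contract_def multivector_fields_outside[OF U])
  qed
qed

lemma ext_d_lincomb: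
  assumes \<omega>: "\<omega> \<in> forms m" and \<zeta>: "\<zeta> \<in> forms m"
  shows "ext_d A (\<omega> + a *\<^sub>F \<zeta>) = ext_d A \<omega> + a *\<^sub>F ext_d A \<zeta>"
proof (intro ext)
  fix c x ws
  show "ext_d A (\<omega> + a *\<^sub>F \<zeta>) c x ws = (ext_d A \<omega> + a *\<^sub>F ext_d A \<zeta>) c x ws"
  proof (cases "c \<in> A \<and> x \<in> chart_image c")
    case True
    then have c: "c \<in> A" and x: "x \<in> chart_image c" by auto
    note d\<omega> = dir_deriv_works[OF local_formsD(2)[OF forms_local[OF \<omega> c] x]]
    note d\<zeta> = dir_deriv_works[OF local_formsD(2)[OF forms_local[OF \<zeta> c] x]]
    have hd: "((\<lambda>y. (\<omega> + a *\<^sub>F \<zeta>) c y vs) has_derivative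
        (\<lambda>h. dir_deriv (\<omega> c) x h vs + a * dir_deriv (\<zeta> c) x h vs)) (at x)" for vs
      using has_derivative_add[OF d\<omega> has_derivative_mult_right[OF d\<zeta>]] by simp
    have "dir_deriv ((\<omega> + a *\<^sub>F \<zeta>) c) x = (\<lambda>h vs. dir_deriv (\<omega> c) x h vs + a * dir_deriv (\<zeta> c) x h vs)"
      by (rule dir_deriv_eq) (rule hd)
    then show ?thesis
      by (simp add: plus_fun_def[of "ext_d A \<omega>"] ext_d_eq_local[OF c x] local_d_def alt_sum_add alt_sum_cmult)
  qed (auto simp: ext_d_def)
qed

lemma contract_commute:
  assumes U: "U \<in> multivector_fields A p" and V: "V \<in> multivector_fields A q" and \<omega>: "\<omega> \<in> forms m"
  shows "contract U (contract V \<omega>) = (-1) ^ (p * q) *\<^sub>F contract V (contract U \<omega>)"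
proof (intro ext)
  fix c x ws
  show "contract U (contract V \<omega>) c x ws = ((-1) ^ (p * q) *\<^sub>F contract V (contract U \<omega>)) c x ws"
  proof (cases "c \<in> A \<and> x \<in> chart_image c")
    case True
    then have c: "c \<in> A" and x: "x \<in> chart_image c" by auto
    show ?thesis
      using local_contract_commute[of "U c" x p "V c" q "\<omega> c" "nat m" ws]
        local_mvfsD(1)[OF multivector_fields_local[OF U c] x]
        local_mvfsD(1)[OF multivector_fields_local[OF V c] x]
        local_formsD(1)[OF forms_local[OF \<omega> c] x]
      by (simp add: contract_eq_local)
  next
    case False
    then have "c \<notin> A \<or> x \<notin> chart_image c" by blast
    then show ?thesis
      by (simp add: contract_def multivector_fields_outside[OF U] multivector_fields_outside[OF V])
  qed
qed

lemma ext_d_ext_d_forms: "\<omega> \<in> forms m \<Longrightarrow> ext_d A (ext_d A \<omega>) = 0"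
  by (cases "m < 0") (auto simp: forms_def intro: ext_d_ext_d)

lemma contract_schouten:
  assumes "1 \<le> p" and U: "U \<in> multivector_fields A p" and V: "V \<in> multivector_fields A q"
    and "\<omega> \<in> forms m"
  shows "contract (schouten A p q U V) \<omega> =
     (-1) ^ ((p - 1) * q) *\<^sub>F lie_deriv A p U (contract V \<omega>) - contract V (lie_deriv A p U \<omega>)"
proof -
  have "\<omega> \<in> diff_forms A (nat m)"
    using assms(4) zero_diff_forms by (auto simp: forms_def split: if_splits)
  then show ?thesis
    using contract_schouten_diff_form[OF assms(1-3)] by (simp only: powi_degree[OF assms(1)])
qed

end

section \<open>Graded Lie algebra of the Schouten bracket\<close>

context based_manifold
begin

lemma forms_diff: "\<omega> \<in> forms m \<Longrightarrow> \<zeta> \<in> forms m \<Longrightarrow> \<omega> - \<zeta> \<in> forms m"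
  using forms_lincomb[of \<omega> m \<zeta> "-1"] by (simp add: form_scale_def fun_diff_def plus_fun_def)

lemma forms_scale: "\<omega> \<in> forms m \<Longrightarrow> a *\<^sub>F \<omega> \<in> forms m"
  using forms_lincomb[of 0 m \<omega> a] by simp

lemma contract_scale:
  "U \<in> multivector_fields A p \<Longrightarrow> \<omega> \<in> forms m \<Longrightarrow> contract U (a *\<^sub>F \<omega>) = a *\<^sub>F contract U \<omega>"
  using contract_lincomb[of U p 0 m \<omega> a] by simp

lemma ext_d_scale: "\<omega> \<in> forms m \<Longrightarrow> ext_d A (a *\<^sub>F \<omega>) = a *\<^sub>F ext_d A \<omega>"
  using ext_d_lincomb[of 0 m \<omega> a] by simp

lemma contract_diff:
  assumes "U \<in> multivector_fields A p" "\<omega> \<in> forms m" "\<zeta> \<in> forms m"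
  shows "contract U (\<omega> - \<zeta>) = contract U \<omega> - contract U \<zeta>"
  using contract_lincomb[OF assms, of "-1"] by (simp add: form_scale_def fun_diff_def plus_fun_def)

lemma ext_d_diff:
  assumes "\<omega> \<in> forms m" "\<zeta> \<in> forms m"
  shows "ext_d A (\<omega> - \<zeta>) = ext_d A \<omega> - ext_d A \<zeta>"
  using ext_d_lincomb[OF assms, of "-1"] by (simp add: form_scale_def fun_diff_def plus_fun_def)

context
  fixes p :: nat and X
  assumes X: "X \<in> multivector_fields A p"
begin

lemma lie_terms_forms:
  assumes "\<omega> \<in> forms m"
  shows "ext_d A (contract X \<omega>) \<in> forms (m + 1 - int p)"
    and "contract X (ext_d A \<omega>) \<in> forms (m + 1 - int p)"
  using ext_d_forms[OF contract_forms[OF X assms]] contract_forms[OF X ext_d_forms[OF assms]]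
  by (simp_all add: algebra_simps)

lemma lie_deriv_forms:
  assumes "\<omega> \<in> forms m" shows "lie_deriv A p X \<omega> \<in> forms (m + 1 - int p)"
  unfolding lie_deriv_def by (intro forms_diff forms_scale lie_terms_forms assms)

lemma lie_deriv_scale:
  assumes \<omega>: "\<omega> \<in> forms m" shows "lie_deriv A p X (a *\<^sub>F \<omega>) = a *\<^sub>F lie_deriv A p X \<omega>"
  unfolding lie_deriv_def contract_scale[OF X \<omega>] ext_d_scale[OF \<omega>]
    ext_d_scale[OF contract_forms[OF X \<omega>]] contract_scale[OF X ext_d_forms[OF \<omega>]]
  by (simp add: fun_eq_iff algebra_simps)

lemma lie_deriv_diff:
  assumes \<omega>: "\<omega> \<in> forms m" and \<zeta>: "\<zeta> \<in> forms m"
  shows "lie_deriv A p X (\<omega> - \<zeta>) = lie_deriv A p X \<omega> - lie_deriv A p X \<zeta>"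
  unfolding lie_deriv_def contract_diff[OF X \<omega> \<zeta>] ext_d_diff[OF \<omega> \<zeta>]
    ext_d_diff[OF contract_forms[OF X \<omega>] contract_forms[OF X \<zeta>]]
    contract_diff[OF X ext_d_forms[OF \<omega>] ext_d_forms[OF \<zeta>]]
  by (simp add: fun_eq_iff algebra_simps)

lemma contract_lie_deriv:
  assumes Y: "Y \<in> multivector_fields A q" and \<omega>: "\<omega> \<in> forms m"
  shows "contract Y (lie_deriv A p X \<omega>) =
    contract Y (ext_d A (contract X \<omega>)) - (-1) ^ p *\<^sub>F contract Y (contract X (ext_d A \<omega>))"
  unfolding lie_deriv_def
  using contract_diff[OF Y lie_terms_forms(1)[OF \<omega>] forms_scale[OF lie_terms_forms(2)[OF \<omega>]]]
    contract_scale[OF Y lie_terms_forms(2)[OF \<omega>]]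
  by simp

text \<open>Graded commutation of \<open>d\<close> and the Lie derivative: both sides reduce, up to sign, to \<open>d \<iota>\<^sub>X d \<omega>\<close>.\<close>

lemma ext_d_lie_deriv:
  assumes \<omega>: "\<omega> \<in> forms m"
  shows "ext_d A (lie_deriv A p X \<omega>) = - ((-1) ^ p *\<^sub>F lie_deriv A p X (ext_d A \<omega>))"
proof -
  have "ext_d A (lie_deriv A p X \<omega>) =
        ext_d A (ext_d A (contract X \<omega>)) - (-1) ^ p *\<^sub>F ext_d A (contract X (ext_d A \<omega>))"
    unfolding lie_deriv_def
    using ext_d_diff[OF lie_terms_forms(1)[OF \<omega>] forms_scale[OF lie_terms_forms(2)[OF \<omega>]]]
      ext_d_scale[OF lie_terms_forms(2)[OF \<omega>]] by simp
  also have "\<dots> = - ((-1) ^ p *\<^sub>F ext_d A (contract X (ext_d A \<omega>)))"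
    by (simp add: ext_d_ext_d_forms[OF contract_forms[OF X \<omega>]])
  also have "ext_d A (contract X (ext_d A \<omega>)) = lie_deriv A p X (ext_d A \<omega>)"
    by (simp add: lie_deriv_def ext_d_ext_d_forms[OF \<omega>] contract_zero[OF X])
  finally show ?thesis .
qed

end

text \<open>Expanding both Lie derivatives gives four terms on each side, built from \<open>d\<close> and the two
  contractions; they agree after the contractions have been brought into the same order.\<close>

lemma schouten_skew:
  assumes p: "1 \<le> p" and q: "1 \<le> q"
    and X: "X \<in> multivector_fields A p" and Y: "Y \<in> multivector_fields A q" and \<omega>: "\<omega> \<in> forms m"
  shows "contract (schouten A p q X Y) \<omega> =
         - ((-1) ^ ((p - 1) * (q - 1)) *\<^sub>F contract (schouten A q p Y X) \<omega>)"
proof -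
  have c1: "ext_d A (contract X (contract Y \<omega>)) = (-1) ^ (p * q) *\<^sub>F ext_d A (contract Y (contract X \<omega>))"
    by (simp only: contract_commute[OF X Y \<omega>] ext_d_scale[OF contract_forms[OF Y contract_forms[OF X \<omega>]]])
  note c2 = contract_commute[OF X Y ext_d_forms[OF \<omega>]]
  show ?thesis
    unfolding contract_schouten[OF p X Y \<omega>] contract_schouten[OF q Y X \<omega>]
      contract_lie_deriv[OF X Y \<omega>] contract_lie_deriv[OF Y X \<omega>]
      lie_deriv_def[of A p X "contract Y \<omega>"] lie_deriv_def[of A q Y "contract X \<omega>"] c1 c2
    using p q
    by (cases p; cases q; cases "even (p - 1)"; cases "even (q - 1)")
       (simp_all add: fun_eq_iff minus_one_power_iff algebra_simps)
qed

text \<open>The Lie derivative of a bracket is the graded commutator of the Lie derivatives, because \<open>d\<close> commutes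
  in the graded sense with \<open>L\<^sub>X\<close> and its commutator with \<open>\<iota>\<^sub>Y\<close> is \<open>L\<^sub>Y\<close>.\<close>

lemma lie_deriv_schouten:
  assumes p: "1 \<le> p" and q: "1 \<le> q"
    and X: "X \<in> multivector_fields A p" and Y: "Y \<in> multivector_fields A q" and \<omega>: "\<omega> \<in> forms m"
  shows "lie_deriv A (p + q - 1) (schouten A p q X Y) \<omega> =
         (-1) ^ ((p - 1) * (q - 1)) *\<^sub>F lie_deriv A p X (lie_deriv A q Y \<omega>)
         - lie_deriv A q Y (lie_deriv A p X \<omega>)"
proof -
  let ?L = "lie_deriv A p X"
  have F1: "?L (contract Y \<omega>) \<in> forms (m - int q + 1 - int p)"
    by (rule lie_deriv_forms[OF X contract_forms[OF Y \<omega>]])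
  have F2: "contract Y (?L \<omega>) \<in> forms (m - int q + 1 - int p)"
    using contract_forms[OF Y lie_deriv_forms[OF X \<omega>]] by (simp add: algebra_simps)
  have "ext_d A (contract (schouten A p q X Y) \<omega>) =
        (-1) ^ ((p - 1) * q) *\<^sub>F ext_d A (?L (contract Y \<omega>)) - ext_d A (contract Y (?L \<omega>))"
    unfolding contract_schouten[OF p X Y \<omega>]
    using ext_d_diff[OF forms_scale[OF F1] F2] ext_d_scale[OF F1] by simp
  also have "ext_d A (?L (contract Y \<omega>)) = - ((-1) ^ p *\<^sub>F ?L (ext_d A (contract Y \<omega>)))"
    by (rule ext_d_lie_deriv[OF X contract_forms[OF Y \<omega>]])
  finally have 1: "ext_d A (contract (schouten A p q X Y) \<omega>) =
      (-1) ^ ((p - 1) * q) *\<^sub>F (- ((-1) ^ p *\<^sub>F ?L (ext_d A (contract Y \<omega>)))) - ext_d A (contract Y (?L \<omega>))" .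
  have 2: "contract (schouten A p q X Y) (ext_d A \<omega>) =
      (-1) ^ ((p - 1) * q) *\<^sub>F ?L (contract Y (ext_d A \<omega>)) - contract Y (?L (ext_d A \<omega>))"
    by (rule contract_schouten[OF p X Y ext_d_forms[OF \<omega>]])
  have "contract Y (ext_d A (?L \<omega>)) = contract Y ((- ((-1) ^ p)) *\<^sub>F ?L (ext_d A \<omega>))"
    by (rule arg_cong[of _ _ "contract Y"]) (simp add: ext_d_lie_deriv[OF X \<omega>] fun_eq_iff)
  also have "\<dots> = (- ((-1) ^ p)) *\<^sub>F contract Y (?L (ext_d A \<omega>))"
    by (rule contract_scale[OF Y lie_deriv_forms[OF X ext_d_forms[OF \<omega>]]])
  finally have 3: "contract Y (ext_d A (?L \<omega>)) = (- ((-1) ^ p)) *\<^sub>F contract Y (?L (ext_d A \<omega>))" .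
  have 4: "?L (lie_deriv A q Y \<omega>) = ?L (ext_d A (contract Y \<omega>)) - (-1) ^ q *\<^sub>F ?L (contract Y (ext_d A \<omega>))"
    unfolding lie_deriv_def[of A q]
    using lie_deriv_diff[OF X lie_terms_forms(1)[OF Y \<omega>] forms_scale[OF lie_terms_forms(2)[OF Y \<omega>]]]
      lie_deriv_scale[OF X lie_terms_forms(2)[OF Y \<omega>]] by simp
  show ?thesis
    unfolding 4 lie_deriv_def[of A q Y "?L \<omega>"] lie_deriv_def[of A "p + q - 1"] 1 2 3
    using p q
    by (cases p; cases q; cases "even (p - 1)"; cases "even (q - 1)")
       (simp_all add: fun_eq_iff minus_one_power_iff algebra_simps)
qed

lemma nested_schouten:
  assumes p: "1 \<le> p" and q: "1 \<le> q"
    and X: "X \<in> multivector_fields A p" and Y: "Y \<in> multivector_fields A q"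
    and Z: "Z \<in> multivector_fields A r" and \<omega>: "\<omega> \<in> forms m"
  shows "contract (schouten A p (q + r - 1) X (schouten A q r Y Z)) \<omega> =
    (-1) ^ ((p - 1) * (q + r - 1)) *\<^sub>F
      ((-1) ^ ((q - 1) * r) *\<^sub>F lie_deriv A p X (lie_deriv A q Y (contract Z \<omega>))
        - lie_deriv A p X (contract Z (lie_deriv A q Y \<omega>)))
    - ((-1) ^ ((q - 1) * r) *\<^sub>F lie_deriv A q Y (contract Z (lie_deriv A p X \<omega>))
        - contract Z (lie_deriv A q Y (lie_deriv A p X \<omega>)))"
proof -
  note YZ = schouten_mvf[OF q Y Z]
  have F1: "lie_deriv A q Y (contract Z \<omega>) \<in> forms (m - int r + 1 - int q)"
    by (rule lie_deriv_forms[OF Y contract_forms[OF Z \<omega>]])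
  have F2: "contract Z (lie_deriv A q Y \<omega>) \<in> forms (m - int r + 1 - int q)"
    using contract_forms[OF Z lie_deriv_forms[OF Y \<omega>]] by (simp add: algebra_simps)
  show ?thesis
    unfolding contract_schouten[OF p X YZ \<omega>] contract_schouten[OF q Y Z \<omega>]
      contract_schouten[OF q Y Z lie_deriv_forms[OF X \<omega>]]
      lie_deriv_diff[OF X forms_scale[OF F1] F2] lie_deriv_scale[OF X F1] ..
qed

text \<open>All three nested brackets are written as combinations of the six words in \<open>L\<^sub>X\<close>, \<open>L\<^sub>Y\<close>, \<open>\<iota>\<^sub>Z\<close>. For
  this the second one is reversed by skew-symmetry to \<open>[[X, Y], Z]\<close>, where \<open>lie_deriv_schouten\<close> applies, and in the third
  the inner bracket is reversed. The signs depend only on the parities of the degrees, and in each of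
  the eight cases the coefficients cancel.\<close>

lemma schouten_jacobi:
  assumes p: "1 \<le> p" and q: "1 \<le> q" and r: "1 \<le> r"
    and X: "X \<in> multivector_fields A p" and Y: "Y \<in> multivector_fields A q"
    and Z: "Z \<in> multivector_fields A r" and \<omega>: "\<omega> \<in> forms m"
  shows "(-1) ^ ((p - 1) * (r - 1)) *\<^sub>F contract (schouten A p (q + r - 1) X (schouten A q r Y Z)) \<omega>
       + (-1) ^ ((r - 1) * (q - 1)) *\<^sub>F contract (schouten A r (p + q - 1) Z (schouten A p q X Y)) \<omega>
       + (-1) ^ ((q - 1) * (p - 1)) *\<^sub>F contract (schouten A q (r + p - 1) Y (schouten A r p Z X)) \<omega> = 0"
proof -
  have pq: "1 \<le> p + q - 1" using p q by simp
  note XY = schouten_mvf[OF p X Y] and ZX = schouten_mvf[OF r Z X]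
  have XZY: "contract (schouten A r (p + q - 1) Z (schouten A p q X Y)) \<omega> =
      - ((-1) ^ ((r - 1) * (p + q - 1 - 1)) *\<^sub>F
          ((-1) ^ ((p + q - 1 - 1) * r) *\<^sub>F
             ((-1) ^ ((p - 1) * (q - 1)) *\<^sub>F lie_deriv A p X (lie_deriv A q Y (contract Z \<omega>))
               - lie_deriv A q Y (lie_deriv A p X (contract Z \<omega>)))
           - ((-1) ^ ((p - 1) * (q - 1)) *\<^sub>F contract Z (lie_deriv A p X (lie_deriv A q Y \<omega>))
               - contract Z (lie_deriv A q Y (lie_deriv A p X \<omega>)))))"
  proof -
    have F1: "lie_deriv A p X (lie_deriv A q Y \<omega>) \<in> forms (m + 1 - int q + 1 - int p)"
      by (intro lie_deriv_forms X Y \<omega>)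
    have F2: "lie_deriv A q Y (lie_deriv A p X \<omega>) \<in> forms (m + 1 - int q + 1 - int p)"
      using lie_deriv_forms[OF Y lie_deriv_forms[OF X \<omega>]] by (simp add: algebra_simps)
    show ?thesis
      unfolding schouten_skew[OF r pq Z XY \<omega>] contract_schouten[OF pq XY Z \<omega>]
        lie_deriv_schouten[OF p q X Y \<omega>] lie_deriv_schouten[OF p q X Y contract_forms[OF Z \<omega>]]
        contract_diff[OF Z forms_scale[OF F1] F2] contract_scale[OF Z F1] ..
  qed
  have YZX: "contract (schouten A q (r + p - 1) Y (schouten A r p Z X)) \<omega> =
      (-1) ^ ((q - 1) * (r + p - 1)) *\<^sub>F
        ((- ((-1) ^ ((r - 1) * (p - 1)))) *\<^sub>F
           ((-1) ^ ((p - 1) * r) *\<^sub>F lie_deriv A q Y (lie_deriv A p X (contract Z \<omega>))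
             - lie_deriv A q Y (contract Z (lie_deriv A p X \<omega>))))
      - (- ((-1) ^ ((r - 1) * (p - 1)))) *\<^sub>F
           ((-1) ^ ((p - 1) * r) *\<^sub>F lie_deriv A p X (contract Z (lie_deriv A q Y \<omega>))
             - contract Z (lie_deriv A p X (lie_deriv A q Y \<omega>)))"
  proof -
    have skew: "contract (schouten A r p Z X) \<zeta> = (- ((-1) ^ ((r - 1) * (p - 1)))) *\<^sub>F
        ((-1) ^ ((p - 1) * r) *\<^sub>F lie_deriv A p X (contract Z \<zeta>) - contract Z (lie_deriv A p X \<zeta>))"
      if "\<zeta> \<in> forms k" for \<zeta> k
      unfolding schouten_skew[OF r p Z X that] contract_schouten[OF p X Z that]
      by (simp add: fun_eq_iff)
    have F1: "lie_deriv A p X (contract Z \<omega>) \<in> forms (m - int r + 1 - int p)"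
      by (rule lie_deriv_forms[OF X contract_forms[OF Z \<omega>]])
    have F2: "contract Z (lie_deriv A p X \<omega>) \<in> forms (m - int r + 1 - int p)"
      using contract_forms[OF Z lie_deriv_forms[OF X \<omega>]] by (simp add: algebra_simps)
    show ?thesis
      unfolding contract_schouten[OF q Y ZX \<omega>] skew[OF \<omega>] skew[OF lie_deriv_forms[OF Y \<omega>]]
        lie_deriv_scale[OF Y forms_diff[OF forms_scale[OF F1] F2]]
        lie_deriv_diff[OF Y forms_scale[OF F1] F2] lie_deriv_scale[OF Y F1] ..
  qed
  show ?thesis
    unfolding nested_schouten[OF p q X Y Z \<omega>] XZY YZX
    using p q r
    by (cases p; cases q; cases r; cases "even (p - 1)"; cases "even (q - 1)"; cases "even (r - 1)")
       (simp_all add: fun_eq_iff minus_one_power_iff algebra_simps)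
qed

end

section \<open>The graded Jacobi bracket of conformal Hamiltonian forms\<close>

context based_manifold
begin

lemma multivector_fields_lincomb:
  assumes U: "U \<in> multivector_fields A p" and V: "V \<in> multivector_fields A p"
  shows "(\<lambda>c x \<eta>. U c x \<eta> + a * V c x \<eta>) \<in> multivector_fields A p"
  unfolding multivector_fields_def
proof (intro CollectI conjI allI ballI impI)
  show "(\<lambda>\<eta>. U c x \<eta> + a * V c x \<eta>) = (\<lambda>\<eta>. 0)" if "c \<notin> A \<or> x \<notin> chart_image c" for c x
    using multivector_fields_outside[OF U that] multivector_fields_outside[OF V that] by simp
  show "(\<lambda>\<eta>. U c x \<eta> + a * V c x \<eta>) \<in> multivectors p" if "c \<in> A" "x \<in> chart_image c" for c x
  proof -
    note mU = local_mvfsD(1)[OF multivector_fields_local[OF U that(1)] that(2)]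
    note mV = local_mvfsD(1)[OF multivector_fields_local[OF V that(1)] that(2)]
    show ?thesis
      by (rule multivectorsI)
         (simp_all add: multivector_lincomb[OF mU] multivector_lincomb[OF mV] multivector_outside[OF mU]
            multivector_outside[OF mV] algebra_simps)
  qed
  show "smooth_on (chart_image c) (\<lambda>x. U c x \<eta> + a * V c x \<eta>)" if "c \<in> A" "\<eta> \<in> alt_forms p" for c \<eta>
    using that multivector_fields_local[OF U that(1)] multivector_fields_local[OF V that(1)]
    by (intro smooth_on_add smooth_on_mult smooth_on_const open_chart_image)
       (simp_all add: local_mvfs_def)
  show "U c' (transition c c' x) \<eta> + a * V c' (transition c c' x) \<eta> =
      U c x (\<lambda>vs. \<eta> (map (frechet_derivative (transition c c') (at x)) vs)) +
      a * V c x (\<lambda>vs. \<eta> (map (frechet_derivative (transition c c') (at x)) vs))"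
    if "c \<in> A" "c' \<in> A" "x \<in> overlap c c'" "\<eta> \<in> alt_forms p" for c c' x \<eta>
    using pushes_forward_mvf[OF U that(1,2)] pushes_forward_mvf[OF V that(1,2)] that(3,4)
    by (simp add: smooth_change.pushes_forward_def[OF smooth_change_transition[OF that(1,2)]])
qed

context
  fixes n :: nat and \<Theta> :: "('m, 'e) form"
  assumes \<Theta>: "\<Theta> \<in> diff_forms A n"
begin

lemma \<Theta>_forms: "\<Theta> \<in> forms (int n)"
  using \<Theta> by (simp add: forms_def)

text \<open>With \<open>L\<^sub>X \<Theta> = \<iota>\<^sub>V \<Theta>\<close> and \<open>L\<^sub>Y \<Theta> = \<iota>\<^sub>W \<Theta>\<close>, the terms \<open>\<iota>\<^sub>V \<iota>\<^sub>W \<Theta>\<close> and \<open>\<iota>\<^sub>W \<iota>\<^sub>V \<Theta>\<close> that arise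
  from the graded commutator of the Lie derivatives cancel. The remaining field is \<open>[X, W] \<mp> [Y, V]\<close>.\<close>

lemma inf_conformal_schouten:
  assumes X: "inf_conformal A n \<Theta> p X" and Y: "inf_conformal A n \<Theta> q Y" and deg: "p + q - 1 \<le> n"
  shows "inf_conformal A n \<Theta> (p + q - 1) (schouten A p q X Y)"
proof -
  from X obtain V where p: "1 \<le> p" and mX: "X \<in> multivector_fields A p"
    and V: "V \<in> multivector_fields A (p - 1)" and LX: "lie_deriv A p X \<Theta> = contract V \<Theta>"
    by (auto simp: inf_conformal_def)
  from Y obtain W where q: "1 \<le> q" and mY: "Y \<in> multivector_fields A q"
    and W: "W \<in> multivector_fields A (q - 1)" and LY: "lie_deriv A q Y \<Theta> = contract W \<Theta>"
    by (auto simp: inf_conformal_def)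
  define s :: real where "s = (-1) ^ ((p - 1) * (q - 1))"
  have ss: "s * (s * t) = t" for t by (simp add: s_def minus_one_power_iff)
  define Z where "Z = (\<lambda>c x \<eta>. schouten A p (q - 1) X W c x \<eta> + (- s) * schouten A q (p - 1) Y V c x \<eta>)"
  have XW: "schouten A p (q - 1) X W \<in> multivector_fields A (p + q - 2)"
    using schouten_mvf[OF p mX W] p q by (simp add: numeral_2_eq_2)
  have YV: "schouten A q (p - 1) Y V \<in> multivector_fields A (p + q - 2)"
    using schouten_mvf[OF q mY V] p q by (simp add: numeral_2_eq_2 add.commute)
  have Z: "Z \<in> multivector_fields A (p + q - 2)"
    unfolding Z_def by (rule multivector_fields_lincomb[OF XW YV])
  have cXW: "contract (schouten A p (q - 1) X W) \<Theta> = s *\<^sub>F lie_deriv A p X (contract W \<Theta>) - contract W (contract V \<Theta>)"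
    unfolding contract_schouten[OF p mX W \<Theta>_forms] LX s_def ..
  have cYV: "contract (schouten A q (p - 1) Y V) \<Theta> = s *\<^sub>F lie_deriv A q Y (contract V \<Theta>) - contract V (contract W \<Theta>)"
    unfolding contract_schouten[OF q mY V \<Theta>_forms] LY s_def by (simp add: mult.commute)
  have VW: "contract V (contract W \<Theta>) = s *\<^sub>F contract W (contract V \<Theta>)"
    unfolding s_def by (rule contract_commute[OF V W \<Theta>_forms])
  have "contract Z \<Theta> = contract (schouten A p (q - 1) X W) \<Theta> + (- s) *\<^sub>F contract (schouten A q (p - 1) Y V) \<Theta>"
    by (simp add: Z_def contract_def fun_eq_iff)
  also have "\<dots> = s *\<^sub>F lie_deriv A p X (contract W \<Theta>) - lie_deriv A q Y (contract V \<Theta>)"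
    unfolding cXW cYV VW by (simp add: fun_eq_iff algebra_simps ss)
  also have "\<dots> = lie_deriv A (p + q - 1) (schouten A p q X Y) \<Theta>"
    by (simp only: lie_deriv_schouten[OF p q mX mY \<Theta>_forms] LX LY s_def)
  finally have "lie_deriv A (p + q - 1) (schouten A p q X Y) \<Theta> = contract Z \<Theta>" ..
  moreover have "Z \<in> multivector_fields A (p + q - 1 - 1)" using Z by (simp add: numeral_2_eq_2)
  ultimately show ?thesis
    using schouten_mvf[OF p mX mY] p q deg unfolding inf_conformal_def by auto
qed

text \<open>After reordering of the contractions, the only term of \<open>\<iota>\<^sub>[\<^sub>X\<^sub>,\<^sub>Y\<^sub>] \<Theta>\<close> in which \<open>X\<close> is contracted with something other than \<open>\<Theta>\<close> is \<open>\<iota>\<^sub>Y \<iota>\<^sub>X d\<Theta>\<close>; it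
  occurs twice, once from \<open>\<iota>\<^sub>X d \<iota>\<^sub>Y \<Theta>\<close>, with opposite signs. Hence the right-hand side contains \<open>X\<close>
  only in \<open>\<iota>\<^sub>X \<Theta>\<close>.\<close>

lemma contract_schouten_conformal:
  assumes p: "1 \<le> p" and mX: "X \<in> multivector_fields A p"
    and q: "1 \<le> q" and mY: "Y \<in> multivector_fields A q"
    and W: "W \<in> multivector_fields A (q - 1)" and LY: "lie_deriv A q Y \<Theta> = contract W \<Theta>"
  shows "contract (schouten A p q X Y) \<Theta> =
    (-1) ^ q *\<^sub>F (ext_d A (contract Y (contract X \<Theta>)) - contract W (contract X \<Theta>))
    - contract Y (ext_d A (contract X \<Theta>))"
proof -
  note c1 = contract_commute[OF mX mY \<Theta>_forms] and c2 = contract_commute[OF mX mY ext_d_forms[OF \<Theta>_forms]]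
  have "ext_d A (contract X (contract Y \<Theta>)) = (-1) ^ (p * q) *\<^sub>F ext_d A (contract Y (contract X \<Theta>))"
    by (simp only: c1 ext_d_scale[OF contract_forms[OF mY contract_forms[OF mX \<Theta>_forms]]])
  moreover have "contract X (ext_d A (contract Y \<Theta>)) =
      (-1) ^ (p * (q - 1)) *\<^sub>F contract W (contract X \<Theta>)
      + (-1) ^ q *\<^sub>F ((-1) ^ (p * q) *\<^sub>F contract Y (contract X (ext_d A \<Theta>)))"
    using contract_lie_deriv[OF mY mX \<Theta>_forms] c2
    unfolding LY contract_commute[OF mX W \<Theta>_forms] by simp
  ultimately show ?thesis
    unfolding contract_schouten[OF p mX mY \<Theta>_forms] contract_lie_deriv[OF mX mY \<Theta>_forms]
      lie_deriv_def[of A p X "contract Y \<Theta>"]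
    using p q
    by (cases p; cases q; cases "even (p - 1)"; cases "even (q - 1)")
       (simp_all add: fun_eq_iff minus_one_power_iff algebra_simps)
qed

lemma contract_schouten_unique_left:
  assumes X: "is_hamiltonian_mvf A n \<Theta> p \<alpha> X" and X': "is_hamiltonian_mvf A n \<Theta> p \<alpha> X'"
    and Y: "is_hamiltonian_mvf A n \<Theta> q \<beta> Y"
  shows "contract (schouten A p q X Y) \<Theta> = contract (schouten A p q X' Y) \<Theta>"
proof -
  from Y obtain W where W: "1 \<le> q" "Y \<in> multivector_fields A q" "W \<in> multivector_fields A (q - 1)"
    "lie_deriv A q Y \<Theta> = contract W \<Theta>"
    by (auto simp: is_hamiltonian_mvf_def inf_conformal_def)
  have "1 \<le> p" "X \<in> multivector_fields A p" "X' \<in> multivector_fields A p"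
    "contract X \<Theta> = - \<alpha>" "contract X' \<Theta> = - \<alpha>"
    using X X' by (auto simp: is_hamiltonian_mvf_def inf_conformal_def)
  then show ?thesis
    by (simp only: contract_schouten_conformal[OF _ _ W])
qed

lemma contract_schouten_unique:
  assumes X: "is_hamiltonian_mvf A n \<Theta> p \<alpha> X" and X': "is_hamiltonian_mvf A n \<Theta> p \<alpha> X'"
    and Y: "is_hamiltonian_mvf A n \<Theta> q \<beta> Y" and Y': "is_hamiltonian_mvf A n \<Theta> q \<beta> Y'"
  shows "contract (schouten A p q X Y) \<Theta> = contract (schouten A p q X' Y') \<Theta>"
proof -
  have skew: "contract (schouten A p q X' Z) \<Theta> =
      - ((-1) ^ ((p - 1) * (q - 1)) *\<^sub>F contract (schouten A q p Z X') \<Theta>)"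
    if "is_hamiltonian_mvf A n \<Theta> q \<beta> Z" for Z
    using that X' by (intro schouten_skew[OF _ _ _ _ \<Theta>_forms])
      (simp_all add: is_hamiltonian_mvf_def inf_conformal_def)
  have "contract (schouten A p q X Y) \<Theta> = contract (schouten A p q X' Y) \<Theta>"
    by (rule contract_schouten_unique_left[OF X X' Y])
  also have "\<dots> = contract (schouten A p q X' Y') \<Theta>"
    unfolding skew[OF Y] skew[OF Y'] contract_schouten_unique_left[OF Y Y' X'] ..
  finally show ?thesis .
qed

lemma jacobi_bracket_eq:
  assumes X: "is_hamiltonian_mvf A n \<Theta> p \<alpha> X" and Y: "is_hamiltonian_mvf A n \<Theta> q \<beta> Y"
  shows "jacobi_bracket A n \<Theta> p q \<alpha> \<beta> =
         (if p + q - 1 \<le> n then - contract (schouten A p q X Y) \<Theta> else 0)"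
proof -
  have "(THE \<gamma>. \<exists>X Y. is_hamiltonian_mvf A n \<Theta> p \<alpha> X \<and> is_hamiltonian_mvf A n \<Theta> q \<beta> Y \<and>
                       \<gamma> = - contract (schouten A p q X Y) \<Theta>) = - contract (schouten A p q X Y) \<Theta>"
  proof (rule the_equality)
    fix \<gamma> assume "\<exists>X Y. is_hamiltonian_mvf A n \<Theta> p \<alpha> X \<and> is_hamiltonian_mvf A n \<Theta> q \<beta> Y \<and>
                       \<gamma> = - contract (schouten A p q X Y) \<Theta>"
    then show "\<gamma> = - contract (schouten A p q X Y) \<Theta>"
      using contract_schouten_unique[OF X _ Y] by fastforce
  qed (use X Y in blast)
  then show ?thesis by (simp add: jacobi_bracket_def)
qed

lemma is_hamiltonian_mvf_schouten:
  assumes X: "is_hamiltonian_mvf A n \<Theta> p \<alpha> X" and Y: "is_hamiltonian_mvf A n \<Theta> q \<beta> Y"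
    and "p + q - 1 \<le> n"
  shows "is_hamiltonian_mvf A n \<Theta> (p + q - 1) (jacobi_bracket A n \<Theta> p q \<alpha> \<beta>) (schouten A p q X Y)"
  using assms inf_conformal_schouten[of p X q Y]
  by (simp add: jacobi_bracket_eq[OF X Y] is_hamiltonian_mvf_def)

text \<open>The degree conditions in the definition of the bracket are consistent: since the degrees of
  Hamiltonian fields are positive, the inner bracket is computed by a Schouten bracket whenever the outer one is.
  The condition obtained is invariant under cyclic permutations.\<close>

lemma nested_jacobi_bracket:
  assumes X: "is_hamiltonian_mvf A n \<Theta> p \<alpha> X" and Y: "is_hamiltonian_mvf A n \<Theta> q \<beta> Y"
    and Z: "is_hamiltonian_mvf A n \<Theta> r \<gamma> Z"
  shows "jacobi_bracket A n \<Theta> p (q + r - 1) \<alpha> (jacobi_bracket A n \<Theta> q r \<beta> \<gamma>) =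
    (if p + q + r - 2 \<le> n then - contract (schouten A p (q + r - 1) X (schouten A q r Y Z)) \<Theta> else 0)"
proof -
  have deg: "1 \<le> p" "1 \<le> q" "1 \<le> r"
    using X Y Z by (simp_all add: is_hamiltonian_mvf_def inf_conformal_def)
  then have eq: "p + (q + r - 1) - 1 = p + q + r - 2" by simp
  show ?thesis
  proof (cases "p + q + r - 2 \<le> n")
    case True
    then have "q + r - 1 \<le> n" using deg by simp
    from jacobi_bracket_eq[OF X is_hamiltonian_mvf_schouten[OF Y Z this]]
    show ?thesis by (simp only: eq)
  next
    case False
    then show ?thesis unfolding jacobi_bracket_def[of A n \<Theta> p] eq by (simp only: if_False)
  qed
qed

lemma jacobi_bracket_skew:
  assumes X: "is_hamiltonian_mvf A n \<Theta> p \<alpha> X" and Y: "is_hamiltonian_mvf A n \<Theta> q \<beta> Y"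
  shows "jacobi_bracket A n \<Theta> p q \<alpha> \<beta> =
         - ((-1) ^ ((p - 1) * (q - 1)) *\<^sub>F jacobi_bracket A n \<Theta> q p \<beta> \<alpha>)"
proof -
  have "1 \<le> p" "1 \<le> q" "X \<in> multivector_fields A p" "Y \<in> multivector_fields A q"
    using X Y by (simp_all add: is_hamiltonian_mvf_def inf_conformal_def)
  from schouten_skew[OF this \<Theta>_forms] show ?thesis
    unfolding jacobi_bracket_eq[OF X Y] jacobi_bracket_eq[OF Y X]
    by (simp add: add.commute fun_eq_iff)
qed

lemma jacobi_bracket_jacobi:
  assumes X: "is_hamiltonian_mvf A n \<Theta> p \<alpha> X" and Y: "is_hamiltonian_mvf A n \<Theta> q \<beta> Y"
    and Z: "is_hamiltonian_mvf A n \<Theta> r \<gamma> Z"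
  shows "(-1) ^ ((p - 1) * (r - 1)) *\<^sub>F
           jacobi_bracket A n \<Theta> p (q + r - 1) \<alpha> (jacobi_bracket A n \<Theta> q r \<beta> \<gamma>)
       + (-1) ^ ((r - 1) * (q - 1)) *\<^sub>F
           jacobi_bracket A n \<Theta> r (p + q - 1) \<gamma> (jacobi_bracket A n \<Theta> p q \<alpha> \<beta>)
       + (-1) ^ ((q - 1) * (p - 1)) *\<^sub>F
           jacobi_bracket A n \<Theta> q (r + p - 1) \<beta> (jacobi_bracket A n \<Theta> r p \<gamma> \<alpha>) = 0"
proof (cases "p + q + r - 2 \<le> n")
  case True
  have "1 \<le> p" "1 \<le> q" "1 \<le> r" "X \<in> multivector_fields A p" "Y \<in> multivector_fields A q"
    "Z \<in> multivector_fields A r"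
    using X Y Z by (simp_all add: is_hamiltonian_mvf_def inf_conformal_def)
  note jac = schouten_jacobi[OF this \<Theta>_forms]
  have deg: "r + p + q - 2 \<le> n" "q + r + p - 2 \<le> n" using True by simp_all
  have neg: "a *\<^sub>F (- x) + b *\<^sub>F (- y) + c *\<^sub>F (- z) = - (a *\<^sub>F x + b *\<^sub>F y + c *\<^sub>F z)"
    for a b c and x y z :: "('m, 'e) form"
    by (simp add: fun_eq_iff)
  show ?thesis
    unfolding nested_jacobi_bracket[OF X Y Z] nested_jacobi_bracket[OF Z X Y]
      nested_jacobi_bracket[OF Y Z X] if_P[OF True] if_P[OF deg(1)] if_P[OF deg(2)] neg jac
    by simp
next
  case False
  have deg: "\<not> r + p + q - 2 \<le> n" "\<not> q + r + p - 2 \<le> n" using False by simp_all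
  show ?thesis
    unfolding nested_jacobi_bracket[OF X Y Z] nested_jacobi_bracket[OF Z X Y]
      nested_jacobi_bracket[OF Y Z X] if_not_P[OF False] if_not_P[OF deg(1)] if_not_P[OF deg(2)]
    by simp
qed

end

end

theorem corollary2p8:
  fixes M :: "'m topology" and A :: "('m, 'e::real_normed_vector) chart set"
    and n p q r :: nat and \<Theta> \<alpha> \<beta> \<gamma> :: "('m, 'e) form"
  assumes "smooth_manifold M A"
    and "\<Theta> \<in> diff_forms A n"
    and "conformal_hamiltonian A n \<Theta> p \<alpha>"
    and "conformal_hamiltonian A n \<Theta> q \<beta>"
    and "conformal_hamiltonian A n \<Theta> r \<gamma>"
  shows "(jacobi_bracket A n \<Theta> p q \<alpha> \<beta> =
           - ((-1) ^ ((p - 1) * (q - 1)) *\<^sub>F jacobi_bracket A n \<Theta> q p \<beta> \<alpha>)) \<and>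
         ((-1) ^ ((p - 1) * (r - 1)) *\<^sub>F
           jacobi_bracket A n \<Theta> p (q + r - 1) \<alpha> (jacobi_bracket A n \<Theta> q r \<beta> \<gamma>)
       + (-1) ^ ((r - 1) * (q - 1)) *\<^sub>F
           jacobi_bracket A n \<Theta> r (p + q - 1) \<gamma> (jacobi_bracket A n \<Theta> p q \<alpha> \<beta>)
       + (-1) ^ ((q - 1) * (p - 1)) *\<^sub>F
           jacobi_bracket A n \<Theta> q (r + p - 1) \<beta> (jacobi_bracket A n \<Theta> r p \<gamma> \<alpha>) = 0)"
proof -
  obtain B0 :: "'e set" where B0: "finite B0" "span B0 = UNIV"
    using assms(1) by (auto simp: smooth_manifold_def)
  obtain B where B: "B \<subseteq> B0" "independent B" "B0 \<subseteq> span B"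
    using maximal_independent_subset[of B0] by blast
  have "span B = UNIV"
    using span_mono[OF B(3)] B0(2) by (simp add: span_span top_unique)
  then interpret based_manifold B M A
    using B B0(1) assms(1) by unfold_locales (auto intro: finite_subset)
  obtain X Y Z where "is_hamiltonian_mvf A n \<Theta> p \<alpha> X" "is_hamiltonian_mvf A n \<Theta> q \<beta> Y"
    "is_hamiltonian_mvf A n \<Theta> r \<gamma> Z"
    using assms(3-5) by (auto simp: conformal_hamiltonian_def)
  then show ?thesis
    using jacobi_bracket_skew[OF assms(2)] jacobi_bracket_jacobi[OF assms(2)] by blast
qed

end
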